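(* Let $C_5^{3-}$ denote the $3$-graph on vertex set $\{1,2,3,4,5\}$ with edge set $\{\{1,2,3\},\{2,3,4\},\{3,4,5\},\{4,5,1\}\}$. Then the Turán density of $C_5^{3-}$ satisfies $$\pi(C_5^{3-})=\lim_{n\to\infty}\frac{\mathrm{ex}(n,C_5^{3-})}{\binom{n}{3}}=\frac14.$$
   Context: A $3$-graph is a collection of $3$-element subsets (edges) of a vertex set. For a $3$-graph $F$, $\mathrm{ex}(n,F)$ is the maximum number of edges in an $n$-vertex $3$-graph containing no copy of $F$ as a (not necessarily induced) subgraph, and $\pi(F)=\lim_{n\to\infty}\mathrm{ex}(n,F)/\binom{n}{3}$ (this limit exists). *)

theory Defs
  imports "HOL-Analysis.Analysis"
begin

type_synonym 'a hypergraph = "'a set \<times> 'a set set"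

definition three_graph :: "'a hypergraph \<Rightarrow> bool" where
  "three_graph G \<longleftrightarrow> (\<forall>e\<in>snd G. e \<subseteq> fst G \<and> card e = 3)"

definition contains_copy :: "'b hypergraph \<Rightarrow> 'a hypergraph \<Rightarrow> bool" where
  "contains_copy G F \<longleftrightarrow>
     (\<exists>\<phi>. inj_on \<phi> (fst F) \<and> \<phi> ` fst F \<subseteq> fst G \<and> (\<forall>e\<in>snd F. \<phi> ` e \<in> snd G))"

text \<open>Every finite 3-graph is isomorphic to one whose vertices are natural numbers, so hosts
  range over those. If \<open>F\<close> has an edge, the maximum is over a finite nonempty set.\<close>

definition free_sizes :: "nat \<Rightarrow> 'a hypergraph \<Rightarrow> nat set" where
  "free_sizes n F = {card (snd G) | G :: nat hypergraph.
     finite (fst G) \<and> card (fst G) = n \<and> three_graph G \<and> \<not> contains_copy G F}"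

definition ex_turan :: "nat \<Rightarrow> 'a hypergraph \<Rightarrow> nat" where
  "ex_turan n F = Max (free_sizes n F)"

definition turan_density :: "'a hypergraph \<Rightarrow> real" where
  "turan_density F = lim (\<lambda>n. real (ex_turan n F) / real (n choose 3))"

definition C5_minus :: "nat hypergraph" where
  "C5_minus = ({1,2,3,4,5}, {{1,2,3}, {2,3,4}, {3,4,5}, {4,5,1}})"

lemma three_graph_C5_minus: "three_graph C5_minus"
  by (simp add: three_graph_def C5_minus_def)

lemma finite_free_sizes: "finite (free_sizes n F)"
proof -
  have "card (snd G) \<le> n choose 3"
    if "finite (fst G)" "card (fst G) = n" "three_graph G" for G :: "nat hypergraph"
  proof -
    have "snd G \<subseteq> {e. e \<subseteq> fst G \<and> card e = 3}"
      using that by (auto simp: three_graph_def)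
    moreover have "finite {e. e \<subseteq> fst G \<and> card e = 3}"
      using that(1) by simp
    ultimately have "card (snd G) \<le> card {e. e \<subseteq> fst G \<and> card e = 3}"
      by (rule card_mono[rotated])
    then show ?thesis
      by (simp only: n_subsets[OF that(1)] that(2))
  qed
  then have "free_sizes n F \<subseteq> {..n choose 3}"
    by (auto simp: free_sizes_def)
  then show ?thesis
    using finite_subset by blast
qed

lemma free_sizes_nonempty:
  assumes "snd F \<noteq> {}"
  shows "free_sizes n F \<noteq> {}"
proof -
  let ?G = "({..<n}, {}) :: nat hypergraph"
  have "three_graph ?G"
    by (simp add: three_graph_def)
  moreover have "\<not> contains_copy ?G F"
    using assms by (simp add: contains_copy_def ex_in_conv[symmetric])
  ultimately have "card (snd ?G) \<in> free_sizes n F"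
    unfolding free_sizes_def by (intro CollectI exI[of _ ?G]) simp
  then show ?thesis
    by blast
qed

end

theory Submission
  imports Defs "HOL-Real_Asymp.Real_Asymp"
begin

text \<open>A 3-graph is treated as a symmetric relation \<open>E\<close>. Two copies of \<open>K\<^sub>4\<^sup>-\<close> (three edges on four vertices) with the
  same three leaves contain the cycle, so a cycle-free 3-graph has few such copies, and sampling reduces the upper bound to
  \<^emph>\<open>hom-free\<close> relations, those without a homomorphic image of the cycle; \<open>K\<^sub>4\<^sup>-\<close> is such an image. Let \<open>d\<close> be their
  extremal density. In a nearly extremal hom-free relation a flag-algebra certificate on six points yields an edge \<open>xyz\<close>
  for which \<open>N(yz)\<close>, \<open>N(xz)\<close>, \<open>N(xy)\<close> almost cover the vertices, are almost equal in size and almost completely joined.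
  The link of every vertex is then concentrated between two of these classes, which partitions the vertices into
  \<open>X\<close>, \<open>Y\<close>, \<open>Z\<close>. Edges that meet exactly two parts are outnumbered by missing transversal triples, so the
  number of ordered edges is at most \<open>d * (\<bar>X\<bar>\<^sup>3 + \<bar>Y\<bar>\<^sup>3 + \<bar>Z\<bar>\<^sup>3) + 6 * \<bar>X\<bar> * \<bar>Y\<bar> * \<bar>Z\<bar>\<close>,
  which forces \<open>d \<le> 1/4\<close>. The iterated balanced blow-up of an edge gives the matching lower bound.\<close>

declare sum_of_bool_eq [simp del]

section \<open>3-graphs as symmetric relations\<close>

locale ternary_graph =
  fixes E :: "'a \<Rightarrow> 'a \<Rightarrow> 'a \<Rightarrow> bool"
  assumes swap_left: "E x y z \<Longrightarrow> E y x z"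
    and swap_right: "E x y z \<Longrightarrow> E x z y"
    and irrefl: "\<not> E x x y"
begin

lemma left_commute: "E x y z = E y x z"
  using swap_left by blast

lemma right_commute: "E x y z = E x z y"
  using swap_right by blast

lemmas edge_ac = left_commute right_commute

lemma not_edge_repeated [simp]: "\<not> E x x y" "\<not> E x y x" "\<not> E y x x"
  using irrefl edge_ac by metis+

end

locale hom_free = ternary_graph +
  assumes no_C5_minus: "E a b c \<Longrightarrow> E b c d \<Longrightarrow> E c d e \<Longrightarrow> \<not> E d e a"
begin

lemma no_K4_minus: "E a b c \<Longrightarrow> E a b d \<Longrightarrow> \<not> E a c d"
  using no_C5_minus[of b a c d a] edge_ac by metis

end

definition pullback :: "('b \<Rightarrow> 'b \<Rightarrow> 'b \<Rightarrow> bool) \<Rightarrow> ('a \<Rightarrow> 'b) \<Rightarrow> 'a \<Rightarrow> 'a \<Rightarrow> 'a \<Rightarrow> bool" where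
  "pullback E f x y z \<longleftrightarrow> E (f x) (f y) (f z)"

lemma pullback_comp: "pullback E (f \<circ> g) = pullback (pullback E f) g"
  by (simp add: pullback_def fun_eq_iff)

lemma hom_free_pullback: "hom_free E \<Longrightarrow> hom_free (pullback E f)"
  unfolding hom_free_def ternary_graph_def hom_free_axioms_def pullback_def by blast

lemma hom_free_empty: "hom_free (\<lambda>_ _ _. False)"
  by unfold_locales simp_all

definition codegree :: "('a \<Rightarrow> 'a \<Rightarrow> 'a \<Rightarrow> bool) \<Rightarrow> 'a \<Rightarrow> 'a \<Rightarrow> 'a set \<Rightarrow> real" where
  "codegree E x y C = (\<Sum>z\<in>C. of_bool (E x y z))"

definition link :: "('a \<Rightarrow> 'a \<Rightarrow> 'a \<Rightarrow> bool) \<Rightarrow> 'a \<Rightarrow> 'a set \<Rightarrow> 'a set \<Rightarrow> real" where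
  "link E x B C = (\<Sum>y\<in>B. codegree E x y C)"

definition edges :: "('a \<Rightarrow> 'a \<Rightarrow> 'a \<Rightarrow> bool) \<Rightarrow> 'a set \<Rightarrow> 'a set \<Rightarrow> 'a set \<Rightarrow> real" where
  "edges E A B C = (\<Sum>x\<in>A. link E x B C)"

abbreviation nedge :: "('a \<Rightarrow> 'a \<Rightarrow> 'a \<Rightarrow> bool) \<Rightarrow> 'a set \<Rightarrow> real" where
  "nedge E W \<equiv> edges E W W W"

abbreviation miss :: "('a \<Rightarrow> 'a \<Rightarrow> 'a \<Rightarrow> bool) \<Rightarrow> 'a set \<Rightarrow> 'a set \<Rightarrow> 'a set \<Rightarrow> real" where
  "miss E \<equiv> edges (\<lambda>x y z. \<not> E x y z)"

lemma link_eq_sum: "link E x B C = (\<Sum>y\<in>B. \<Sum>z\<in>C. of_bool (E x y z))"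
  by (simp add: link_def codegree_def)

lemma edges_eq_sum: "edges E A B C = (\<Sum>x\<in>A. \<Sum>y\<in>B. \<Sum>z\<in>C. of_bool (E x y z))"
  by (simp add: edges_def link_eq_sum)

lemma codegree_nonneg: "0 \<le> codegree E x y C"
  unfolding codegree_def by (intro sum_nonneg) simp

lemma link_nonneg: "0 \<le> link E x B C"
  unfolding link_def by (intro sum_nonneg codegree_nonneg)

lemma edges_nonneg: "0 \<le> edges E A B C"
  unfolding edges_def by (intro sum_nonneg link_nonneg)

lemma codegree_le: "codegree E x y C \<le> real (card C)"
proof -
  have "codegree E x y C \<le> (\<Sum>z\<in>C. 1)"
    unfolding codegree_def by (intro sum_mono) simp
  then show ?thesis by simp
qed

lemma link_le: "link E x B C \<le> real (card B) * real (card C)"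
proof -
  have "link E x B C \<le> (\<Sum>y\<in>B. real (card C))"
    unfolding link_def by (intro sum_mono codegree_le)
  then show ?thesis by simp
qed

lemma edges_le: "edges E A B C \<le> real (card A) * real (card B) * real (card C)"
proof -
  have "edges E A B C \<le> (\<Sum>a\<in>A. real (card B) * real (card C))"
    unfolding edges_def by (intro sum_mono link_le)
  then show ?thesis by simp
qed

lemma miss_eq_sum_link: "miss E A B C = (\<Sum>a\<in>A. real (card B) * real (card C) - link E a B C)"
  by (simp add: edges_eq_sum link_eq_sum of_bool_not_iff sum_subtractf)

lemma edges_add_miss: "edges E A B C + miss E A B C = real (card A) * real (card B) * real (card C)"
  unfolding miss_eq_sum_link by (simp add: edges_def sum_subtractf)

lemma codegree_mono: "finite C' \<Longrightarrow> C \<subseteq> C' \<Longrightarrow> codegree E x y C \<le> codegree E x y C'"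
  unfolding codegree_def by (intro sum_mono2) auto

lemma link_mono:
  assumes "finite B'" "finite C'" "B \<subseteq> B'" "C \<subseteq> C'"
  shows "link E x B C \<le> link E x B' C'"
proof -
  have "link E x B C \<le> (\<Sum>y\<in>B. codegree E x y C')"
    unfolding link_def using assms by (intro sum_mono codegree_mono)
  also have "\<dots> \<le> link E x B' C'"
    unfolding link_def using assms by (intro sum_mono2 codegree_nonneg) auto
  finally show ?thesis .
qed

lemma edges_mono:
  assumes "finite A'" "finite B'" "finite C'" "A \<subseteq> A'" "B \<subseteq> B'" "C \<subseteq> C'"
  shows "edges E A B C \<le> edges E A' B' C'"
proof -
  have "edges E A B C \<le> (\<Sum>a\<in>A. link E a B' C')"
    unfolding edges_def using assms by (intro sum_mono link_mono)
  also have "\<dots> \<le> edges E A' B' C'"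
    unfolding edges_def using assms by (intro sum_mono2 link_nonneg) auto
  finally show ?thesis .
qed

lemma link_Un_left:
  "finite A \<Longrightarrow> finite B \<Longrightarrow> A \<inter> B = {} \<Longrightarrow> link E u (A \<union> B) C = link E u A C + link E u B C"
  unfolding link_def by (rule sum.union_disjoint)

lemma link_Un_right:
  "finite A \<Longrightarrow> finite B \<Longrightarrow> A \<inter> B = {} \<Longrightarrow> link E u C (A \<union> B) = link E u C A + link E u C B"
  unfolding link_eq_sum by (simp add: sum.union_disjoint sum.distrib)

lemma edges_left_commute_if:
  assumes "\<And>x y z. E x y z = E y x z"
  shows "edges E A B C = edges E B A C"
proof -
  have "edges E A B C = (\<Sum>b\<in>B. \<Sum>a\<in>A. \<Sum>c\<in>C. of_bool (E a b c))"
    unfolding edges_eq_sum by (rule sum.swap)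
  also have "\<dots> = edges E B A C"
    unfolding edges_eq_sum by (intro sum.cong refl arg_cong[where f = of_bool] assms)
  finally show ?thesis .
qed

lemma edges_right_commute_if:
  assumes "\<And>x y z. E x y z = E x z y"
  shows "edges E A B C = edges E A C B"
proof -
  have "edges E A B C = (\<Sum>a\<in>A. \<Sum>c\<in>C. \<Sum>b\<in>B. of_bool (E a b c))"
    unfolding edges_eq_sum by (intro sum.cong refl sum.swap)
  also have "\<dots> = edges E A C B"
    unfolding edges_eq_sum by (intro sum.cong refl arg_cong[where f = of_bool] assms)
  finally show ?thesis .
qed

lemma edges_image:
  assumes "inj_on f A" "inj_on f B" "inj_on f C"
  shows "edges E (f ` A) (f ` B) (f ` C) = edges (pullback E f) A B C"
  unfolding edges_eq_sum by (simp add: sum.reindex[OF assms(1)] sum.reindex[OF assms(2)] sum.reindex[OF assms(3)]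
      pullback_def)

context ternary_graph
begin

lemma link_commute: "link E u A B = link E u B A"
  unfolding link_eq_sum by (subst sum.swap) (simp add: right_commute[of u])

lemma edges_ac:
  "edges E A B C = edges E B A C" "edges E A B C = edges E A C B"
  by (rule edges_left_commute_if[OF left_commute], rule edges_right_commute_if[OF right_commute])

lemma miss_ac:
  "miss E A B C = miss E B A C" "miss E A B C = miss E A C B"
  by (rule edges_left_commute_if, simp only: left_commute, rule edges_right_commute_if, simp only: right_commute)

lemma nedge_insert:
  assumes "finite A" "x \<notin> A"
  shows "nedge E (insert x A) = nedge E A + 3 * link E x A A"
proof -
  have x: "codegree E x x A = 0"
    by (simp add: codegree_def)
  have link: "link E a (insert x A) (insert x A) = link E a A A + 2 * codegree E x a A" for a
    using assms right_commute[of a _ x] left_commute[of a x] by (simp add: link_eq_sum codegree_def sum.distrib)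
  have "nedge E (insert x A) = link E x A A + (\<Sum>a\<in>A. link E a A A + 2 * codegree E x a A)"
    unfolding edges_def using assms by (simp add: link x)
  also have "\<dots> = nedge E A + 3 * link E x A A"
    by (simp add: sum.distrib sum_distrib_left[symmetric] link_def edges_def)
  finally show ?thesis .
qed

lemma link_Un3:
  assumes "finite X" "finite Y" "finite Z" "X \<inter> Y = {}" "X \<inter> Z = {}" "Y \<inter> Z = {}"
  shows "link E u (X \<union> Y \<union> Z) (X \<union> Y \<union> Z)
    = link E u X X + link E u Y Y + link E u Z Z + 2 * (link E u X Y + link E u X Z + link E u Y Z)"
  using assms link_commute[of u Y X] link_commute[of u Z X] link_commute[of u Z Y]
  by (simp add: link_Un_left link_Un_right Int_Un_distrib Int_Un_distrib2)

lemma nedge_Un3: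
  assumes fin: "finite X" "finite Y" "finite Z" and disjoint: "X \<inter> Y = {}" "X \<inter> Z = {}" "Y \<inter> Z = {}"
  shows "nedge E (X \<union> Y \<union> Z) = nedge E X + nedge E Y + nedge E Z + 6 * edges E X Y Z
    + 3 * (edges E Y X X + edges E Z X X + edges E X Y Y + edges E Z Y Y + edges E X Z Z + edges E Y Z Z)"
proof -
  have sum_Un3: "sum f (X \<union> Y \<union> Z) = sum f X + sum f Y + sum f Z" for f :: "'a \<Rightarrow> real"
    using fin disjoint by (simp add: sum.union_disjoint Int_Un_distrib2)
  have "nedge E (X \<union> Y \<union> Z) = (\<Sum>u\<in>X \<union> Y \<union> Z. link E u X X + link E u Y Y + link E u Z Z
      + 2 * (link E u X Y + link E u X Z + link E u Y Z))"
    by (simp only: edges_def link_Un3[OF assms])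
  also have "\<dots> = (edges E X X X + edges E Y X X + edges E Z X X) + (edges E X Y Y + edges E Y Y Y + edges E Z Y Y)
      + (edges E X Z Z + edges E Y Z Z + edges E Z Z Z)
      + 2 * ((edges E X X Y + edges E Y X Y + edges E Z X Y) + (edges E X X Z + edges E Y X Z + edges E Z X Z)
      + (edges E X Y Z + edges E Y Y Z + edges E Z Y Z))"
    by (simp only: sum.distrib sum_distrib_left[symmetric] sum_Un3 edges_def)
  finally show ?thesis
    using edges_ac by (smt (verit))
qed

end

section \<open>The extremal density\<close>

definition hom_free_densities :: "real set" where
  "hom_free_densities = {nedge E {..<m} / real m ^ 3 | E m. hom_free (E :: nat \<Rightarrow> nat \<Rightarrow> nat \<Rightarrow> bool) \<and> 0 < m}"

definition extremal_density :: real where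
  "extremal_density = Sup hom_free_densities"

definition deficit :: "('a \<Rightarrow> 'a \<Rightarrow> 'a \<Rightarrow> bool) \<Rightarrow> 'a set \<Rightarrow> real" where
  "deficit E W = extremal_density * real (card W) ^ 3 - nedge E W"

lemma bdd_above_hom_free_densities: "bdd_above hom_free_densities"
proof (rule bdd_aboveI[where M = 1])
  fix d assume "d \<in> hom_free_densities"
  then obtain E m where "d = nedge E {..<m} / real m ^ 3" "0 < m"
    by (auto simp: hom_free_densities_def)
  then show "d \<le> 1"
    using edges_le[of E "{..<m}" "{..<m}" "{..<m}"] by (simp add: divide_le_eq power3_eq_cube)
qed

lemma (in hom_free) deficit_nonneg:
  assumes "finite W"
  shows "0 \<le> deficit E W"
proof (cases "W = {}")
  case False
  then have card: "0 < card W"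
    using assms by (simp add: card_gt_0_iff)
  obtain f where f: "bij_betw f {..<card W} W"
    using ex_bij_betw_nat_finite[OF assms] by (auto simp: lessThan_atLeast0)
  have "nedge E W = nedge (pullback E f) {..<card W}"
    using edges_image[of f "{..<card W}" "{..<card W}" "{..<card W}" E] f by (simp add: bij_betw_def)
  moreover have "nedge (pullback E f) {..<card W} / real (card W) ^ 3 \<in> hom_free_densities"
    using hom_free_pullback[OF hom_free_axioms] card unfolding hom_free_densities_def by blast
  then have "nedge (pullback E f) {..<card W} / real (card W) ^ 3 \<le> extremal_density"
    unfolding extremal_density_def by (rule cSup_upper[OF _ bdd_above_hom_free_densities])
  ultimately show ?thesis
    using card by (simp add: deficit_def divide_le_eq)
qed (simp add: deficit_def edges_def)

lemma extremal_density_nearly_attained: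
  assumes "\<epsilon> > 0"
  obtains E :: "nat \<Rightarrow> nat \<Rightarrow> nat \<Rightarrow> bool" and m where "hom_free E" "m > 0" "deficit E {..<m} < \<epsilon> * real m ^ 3"
proof -
  have "hom_free_densities \<noteq> {}"
    using hom_free_empty unfolding hom_free_densities_def by blast
  moreover have "extremal_density - \<epsilon> < Sup hom_free_densities"
    using assms by (simp add: extremal_density_def)
  ultimately obtain d where "d \<in> hom_free_densities" "extremal_density - \<epsilon> < d"
    using less_cSup_iff[OF _ bdd_above_hom_free_densities] by blast
  then show thesis
    using that by (auto simp: hom_free_densities_def deficit_def pos_less_divide_eq left_diff_distrib)
qed

lemma sum_lessThan_mult: "(\<Sum>i<k * m. f i) = (\<Sum>q<k. \<Sum>r<m. f (q * m + r))" for f :: "nat \<Rightarrow> 'a :: comm_monoid_add"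
proof -
  have "(\<Sum>i=q * m..<q * m + m. f i) = (\<Sum>r<m. f (q * m + r))" for q
    using sum.shift_bounds_nat_ivl[of f 0 "q * m" m] by (simp add: lessThan_atLeast0 add.commute)
  then show ?thesis
    by (simp add: sum.nat_group[symmetric])
qed

lemma deficit_blow_up:
  assumes "m > 0"
  shows "deficit (pullback E (\<lambda>i. i mod m)) {..<k * m} = real k ^ 3 * deficit E {..<m}"
proof -
  have periodic: "(\<Sum>i<k * m. f (i mod m)) = real k * (\<Sum>r<m. f r)" for f :: "nat \<Rightarrow> real"
    by (simp add: sum_lessThan_mult)
  have "nedge (pullback E (\<lambda>i. i mod m)) {..<k * m} = real k ^ 3 * nedge E {..<m}"
    unfolding edges_eq_sum pullback_def periodic[of "\<lambda>z. of_bool (E _ _ z)"]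
      periodic[of "\<lambda>y. real k * (\<Sum>z<m. of_bool (E _ y z))"]
      periodic[of "\<lambda>x. real k * (\<Sum>y<m. real k * (\<Sum>z<m. of_bool (E x y z)))"]
    by (simp only: sum_distrib_left[symmetric] power3_eq_cube mult.assoc)
  then show ?thesis
    by (simp add: deficit_def power_mult_distrib algebra_simps)
qed

lemma ex_minimal_deficit:
  assumes "finite V"
  obtains E where "hom_free E" "\<And>F. hom_free F \<Longrightarrow> deficit E V \<le> deficit F V"
proof -
  have "nedge E V \<in> real ` {..card V ^ 3}" for E
  proof -
    define k :: nat where "k = (\<Sum>x\<in>V. \<Sum>y\<in>V. \<Sum>z\<in>V. of_bool (E x y z))"
    have k: "nedge E V = real k"
      by (simp add: edges_eq_sum k_def)
    then have "real k \<le> real (card V ^ 3)"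
      using edges_le[of E V V V] by (simp add: power3_eq_cube)
    then show ?thesis
      using k by simp
  qed
  then have fin: "finite {nedge E V | E. hom_free E}"
    by (intro finite_subset[OF _ finite_imageI[of "{..card V ^ 3}" real]]) auto
  moreover have "{nedge E V | E. hom_free E} \<noteq> {}"
    using hom_free_empty by blast
  ultimately obtain E where "hom_free E" "nedge E V = Max {nedge E V | E. hom_free E}"
    using Max_in by (smt (verit, best) mem_Collect_eq)
  then show thesis
    using Max_ge[OF fin] by (intro that[of E]) (auto simp: deficit_def)
qed

context hom_free
begin

text \<open>Otherwise replacing \<open>x\<close> by a clone of \<open>y\<close> would increase the number of edges.\<close>

lemma link_le_of_minimal_deficit:
  assumes minimal: "\<And>F. hom_free F \<Longrightarrow> deficit E V \<le> deficit F V" and V: "finite V" "x \<in> V" "y \<in> V"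
  shows "link E y V V \<le> link E x V V + 2 * real (card V)"
proof (cases "y = x")
  case False
  let ?A = "V - {x}" and ?F = "pullback E (id(x := y))"
  have A: "insert x ?A = V" "finite ?A" "x \<notin> ?A" "card ?A \<le> card V"
    using V by (auto intro: card_mono)
  interpret F: hom_free ?F
    by (rule hom_free_pullback[OF hom_free_axioms])
  have "nedge ?F V \<le> nedge E V"
    using minimal[OF F.hom_free_axioms] by (simp add: deficit_def)
  moreover have "nedge ?F V = nedge ?F ?A + 3 * link ?F x ?A ?A" "nedge E V = nedge E ?A + 3 * link E x ?A ?A"
    using nedge_insert[OF A(2,3)] F.nedge_insert[OF A(2,3)] by (simp_all only: A(1))
  moreover have "nedge ?F ?A = nedge E ?A" "link ?F x ?A ?A = link E y ?A ?A"
    unfolding edges_eq_sum link_eq_sum pullback_def by (auto intro!: sum.cong)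
  moreover have "link E x ?A ?A \<le> link E x V V"
    using V by (intro link_mono) auto
  ultimately have "link E y ?A ?A \<le> link E x V V"
    by linarith
  moreover have "link E y V V = link E y ?A ?A + 2 * link E y {x} ?A"
  proof -
    have "link E y ({x} \<union> ?A) ({x} \<union> ?A) = link E y ?A ?A + 2 * link E y {x} ?A + link E y {x} {x}"
      using A(2) link_commute[of y "{x}" ?A] link_Un_left[of "{x}" ?A E y] link_Un_right[of "{x}" ?A E y] by simp
    then show ?thesis
      using A(1) by (simp add: link_eq_sum)
  qed
  moreover have "link E y {x} ?A \<le> real (card V)"
    using link_le[of E y "{x}" ?A] A(4) by simp
  ultimately show ?thesis
    by linarith
qed simp

lemma nedge_le_of_minimal_deficit:
  assumes minimal: "\<And>F. hom_free F \<Longrightarrow> deficit E V \<le> deficit F V" and V: "finite V" "x \<in> V"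
  shows "nedge E V \<le> real (card V) * link E x V V + 2 * real (card V) ^ 2"
proof -
  have "nedge E V \<le> (\<Sum>y\<in>V. link E x V V + 2 * real (card V))"
    unfolding edges_def by (intro sum_mono link_le_of_minimal_deficit[OF assms])
  then show ?thesis
    by (simp add: power2_eq_square algebra_simps)
qed

text \<open>The left-hand side counts the edges after adding \<open>k\<close> clones of \<open>u\<close> to \<open>A\<close>.\<close>

lemma clone_bound:
  assumes "finite A"
  shows "nedge E A + 3 * real k * link E u A A \<le> extremal_density * (real (card A) + real k) ^ 3"
proof -
  let ?F = "pullback E (case_sum id (\<lambda>_ :: nat. u))"
  let ?B = "\<lambda>k. Inl ` A \<union> Inr ` {..<k} :: ('a + nat) set"
  interpret F: hom_free ?F
    by (rule hom_free_pullback[OF hom_free_axioms])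
  have "nedge E A + 3 * real k * link E u A A \<le> nedge ?F (?B k)"
  proof (induction k)
    case 0
    then show ?case
      by (simp add: edges_eq_sum sum.reindex pullback_def)
  next
    case (Suc k)
    have "link ?F (Inr k) (Inl ` A) (Inl ` A) = link E u A A"
      by (simp add: link_eq_sum sum.reindex pullback_def)
    moreover have "link ?F (Inr k) (Inl ` A) (Inl ` A) \<le> link ?F (Inr k) (?B k) (?B k)"
      using assms by (intro link_mono) auto
    moreover have "nedge ?F (?B (Suc k)) = nedge ?F (?B k) + 3 * link ?F (Inr k) (?B k) (?B k)"
      using F.nedge_insert[of "?B k" "Inr k"] assms by (auto simp: lessThan_Suc)
    ultimately show ?case
      using Suc.IH by (simp add: algebra_simps)
  qed
  also have "\<dots> \<le> extremal_density * real (card (?B k)) ^ 3"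
    using F.deficit_nonneg[of "?B k"] assms by (simp add: deficit_def)
  also have "card (?B k) = card A + k"
    using assms by (subst card_Un_disjoint) (auto simp: card_image)
  finally show ?thesis by simp
qed

end

section \<open>Links and missing triples\<close>

lemma weighted_degree_square_sum_le:
  fixes w :: "'a \<Rightarrow> real"
  assumes nonneg: "\<And>x. x \<in> X \<Longrightarrow> 0 \<le> w x" and commute: "\<And>x y. L x y = L y x"
    and triangle_free: "\<And>x y z. L x y \<Longrightarrow> L x z \<Longrightarrow> \<not> L y z"
  defines "wdeg \<equiv> \<lambda>x. \<Sum>y\<in>X. w y * of_bool (L x y)"
  shows "2 * (\<Sum>x\<in>X. w x * (wdeg x)\<^sup>2) \<le> sum w X * (\<Sum>x\<in>X. w x * wdeg x)"
proof -
  have sum_wdeg: "(\<Sum>y\<in>X. w x * w y * of_bool (L x y) * r) = w x * wdeg x * r" for x r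
    by (simp add: wdeg_def sum_distrib_left sum_distrib_right mult.assoc)
  have neighbours: "wdeg x + wdeg y \<le> sum w X" if "L x y" for x y
  proof -
    have "wdeg x + wdeg y = (\<Sum>z\<in>X. w z * (of_bool (L x z) + of_bool (L y z)))"
      by (simp add: wdeg_def sum.distrib distrib_left)
    also have "\<dots> \<le> (\<Sum>z\<in>X. w z * 1)"
      using triangle_free[OF that] nonneg by (intro sum_mono mult_left_mono) auto
    finally show ?thesis by simp
  qed
  have "(\<Sum>x\<in>X. \<Sum>y\<in>X. w x * w y * of_bool (L x y) * wdeg y) = (\<Sum>x\<in>X. w x * (wdeg x)\<^sup>2)"
  proof (subst sum.swap, rule sum.cong[OF refl])
    fix y
    have "(\<Sum>x\<in>X. w x * w y * of_bool (L x y) * wdeg y) = (\<Sum>x\<in>X. w y * w x * of_bool (L y x) * wdeg y)"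
      by (simp only: commute[of y] mult.commute[of "w y"])
    then show "(\<Sum>x\<in>X. w x * w y * of_bool (L x y) * wdeg y) = w y * (wdeg y)\<^sup>2"
      by (simp add: sum_wdeg power2_eq_square)
  qed
  then have "2 * (\<Sum>x\<in>X. w x * (wdeg x)\<^sup>2) = (\<Sum>x\<in>X. \<Sum>y\<in>X. w x * w y * of_bool (L x y) * (wdeg x + wdeg y))"
    by (simp add: distrib_left sum.distrib sum_wdeg power2_eq_square mult.assoc[symmetric])
  also have "\<dots> \<le> (\<Sum>x\<in>X. \<Sum>y\<in>X. w x * w y * of_bool (L x y) * sum w X)"
  proof (intro sum_mono)
    fix x y assume "x \<in> X" "y \<in> X"
    then show "w x * w y * of_bool (L x y) * (wdeg x + wdeg y) \<le> w x * w y * of_bool (L x y) * sum w X"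
      using neighbours[of x y] nonneg by (cases "L x y") (auto intro!: mult_left_mono)
  qed
  also have "\<dots> = sum w X * (\<Sum>x\<in>X. w x * wdeg x)"
    by (simp only: sum_wdeg) (simp add: sum_distrib_left mult_ac)
  finally show ?thesis .
qed

lemma weighted_mantel:
  fixes w :: "'a \<Rightarrow> real"
  assumes nonneg: "\<And>x. x \<in> X \<Longrightarrow> 0 \<le> w x" and commute: "\<And>x y. L x y = L y x"
    and triangle_free: "\<And>x y z. L x y \<Longrightarrow> L x z \<Longrightarrow> \<not> L y z"
  shows "(\<Sum>x\<in>X. \<Sum>y\<in>X. w x * w y * of_bool (L x y)) \<le> (sum w X)\<^sup>2 / 2"
proof -
  define wdeg where "wdeg x = (\<Sum>y\<in>X. w y * of_bool (L x y))" for x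
  define total where "total = (\<Sum>x\<in>X. w x * wdeg x)"
  have total: "(\<Sum>x\<in>X. \<Sum>y\<in>X. w x * w y * of_bool (L x y)) = total"
    by (simp add: total_def wdeg_def sum_distrib_left mult.assoc)
  have "total = (\<Sum>x\<in>X. sqrt (w x) * (sqrt (w x) * wdeg x))"
    unfolding total_def using nonneg by (intro sum.cong) simp_all
  then have "total\<^sup>2 \<le> (\<Sum>x\<in>X. (sqrt (w x))\<^sup>2) * (\<Sum>x\<in>X. (sqrt (w x) * wdeg x)\<^sup>2)"
    by (simp only: Cauchy_Schwarz_ineq_sum)
  also have "\<dots> = sum w X * (\<Sum>x\<in>X. w x * (wdeg x)\<^sup>2)"
    using nonneg by (simp add: power_mult_distrib)
  also have "\<dots> \<le> sum w X * (sum w X * total / 2)"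
  proof (rule mult_left_mono)
    show "(\<Sum>x\<in>X. w x * (wdeg x)\<^sup>2) \<le> sum w X * total / 2"
    proof -
      have "2 * (\<Sum>x\<in>X. w x * (wdeg x)\<^sup>2) \<le> sum w X * total"
        unfolding wdeg_def total_def
        by (intro weighted_degree_square_sum_le nonneg commute) (metis triangle_free)+
      then show ?thesis by simp
    qed
  qed (use nonneg in \<open>simp add: sum_nonneg\<close>)
  finally have "total * total \<le> (sum w X)\<^sup>2 / 2 * total"
    by (simp add: power2_eq_square mult_ac)
  then have "total \<le> (sum w X)\<^sup>2 / 2" if "0 < total"
    using that by (simp only: mult_le_cancel_right_pos)
  then have "total \<le> (sum w X)\<^sup>2 / 2"
    using zero_le_power2[of "sum w X"] by (cases "0 < total") linarith+
  then show ?thesis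
    by (simp only: total)
qed

context hom_free
begin

lemma link_mult_link_le: "link E u A B * link E u B C \<le> 2 * real (card B) * miss E A B C"
proof -
  have "link E u A B * link E u B C
    = (\<Sum>a\<in>A. \<Sum>b\<in>B. \<Sum>b'\<in>B. \<Sum>c\<in>C. of_bool (E u a b) * of_bool (E u b' c))"
    by (simp only: link_eq_sum sum_distrib_left[symmetric] sum_distrib_right[symmetric])
  also have "\<dots> \<le> (\<Sum>a\<in>A. \<Sum>b\<in>B. \<Sum>b'\<in>B. \<Sum>c\<in>C. of_bool (\<not> E a b' c) + of_bool (\<not> E a b c))"
  proof (intro sum_mono)
    fix a b b' c
    have "\<not> (E u a b \<and> E u b' c \<and> E a b' c \<and> E a b c)"
      using no_C5_minus[of u b' c a b] edge_ac by metis
    then show "of_bool (E u a b) * of_bool (E u b' c) \<le> (of_bool (\<not> E a b' c) + of_bool (\<not> E a b c) :: real)"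
      by auto
  qed
  also have "\<dots> = 2 * real (card B) * miss E A B C"
    by (simp add: sum.distrib edges_eq_sum sum_distrib_left mult.assoc)
  finally show ?thesis .
qed

lemma sum_codegree_mult_le:
  "real (card A) * (\<Sum>b\<in>B. codegree E u b B * codegree E u b C) \<le> 2 * real (card B) * miss E A B C"
proof -
  have "real (card A) * (\<Sum>b\<in>B. codegree E u b B * codegree E u b C)
    = (\<Sum>b\<in>B. \<Sum>b'\<in>B. \<Sum>c\<in>C. \<Sum>a\<in>A. of_bool (E u b b') * of_bool (E u b c))"
    unfolding codegree_def sum_product by (simp add: sum_distrib_left)
  also have "\<dots> \<le> (\<Sum>b\<in>B. \<Sum>b'\<in>B. \<Sum>c\<in>C. \<Sum>a\<in>A. of_bool (\<not> E b c a) + of_bool (\<not> E b' c a))"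
  proof (intro sum_mono)
    fix a b b' c
    have "\<not> (E u b b' \<and> E u b c \<and> E b c a \<and> E b' c a)"
      using no_C5_minus[of b' a c b u] edge_ac by metis
    then show "of_bool (E u b b') * of_bool (E u b c) \<le> (of_bool (\<not> E b c a) + of_bool (\<not> E b' c a) :: real)"
      by auto
  qed
  also have "\<dots> = 2 * real (card B) * miss E B C A"
    by (simp add: sum.distrib edges_eq_sum sum_distrib_left mult.assoc)
  also have "miss E B C A = miss E A B C"
    by (metis miss_ac)
  finally show ?thesis .
qed

lemma link_inside_le:
  assumes fin: "finite A" "finite B" "finite C" and nonempty: "A \<noteq> {}" "C \<noteq> {}"
  shows "link E u B B \<le> (real (card B) - link E u B C / real (card C))\<^sup>2 / 2
     + 4 * real (card B) * miss E A B C / (real (card A) * real (card C))"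
proof -
  have pos: "0 < real (card A)" "0 < real (card C)"
    using fin nonempty by (simp_all add: card_gt_0_iff)
  define \<gamma> where "\<gamma> b = codegree E u b C / real (card C)" for b
  have \<gamma>: "0 \<le> \<gamma> b" "\<gamma> b \<le> 1" for b
    using codegree_nonneg[of E u b C] codegree_le[of E u b C] pos by (simp_all add: \<gamma>_def)
  have sum_\<gamma>: "(\<Sum>b\<in>B. 1 - \<gamma> b) = real (card B) - link E u B C / real (card C)"
    by (simp add: \<gamma>_def sum_subtractf sum_divide_distrib[symmetric] link_def)
  define \<sigma> where "\<sigma> = (\<Sum>b\<in>B. \<gamma> b * codegree E u b B)"
  have "\<sigma> = (\<Sum>b\<in>B. codegree E u b B * codegree E u b C) / real (card C)"
    by (simp add: \<sigma>_def \<gamma>_def sum_divide_distrib mult.commute)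
  then have "real (card A) * (\<sigma> * real (card C)) \<le> 2 * real (card B) * miss E A B C"
    using sum_codegree_mult_le[of A u B C] pos by simp
  then have \<sigma>_le: "\<sigma> \<le> 2 * real (card B) * miss E A B C / (real (card A) * real (card C))"
    using pos by (simp add: pos_le_divide_eq mult_ac)
  have "link E u B B \<le> (\<Sum>b\<in>B. \<Sum>b'\<in>B. ((1 - \<gamma> b) * (1 - \<gamma> b') + \<gamma> b + \<gamma> b') * of_bool (E u b b'))"
    unfolding link_eq_sum
  proof (intro sum_mono)
    fix b b'
    have "1 \<le> (1 - \<gamma> b) * (1 - \<gamma> b') + \<gamma> b + \<gamma> b'"
      using mult_nonneg_nonneg[OF \<gamma>(1)[of b] \<gamma>(1)[of b']] by (simp add: algebra_simps)
    then show "of_bool (E u b b') \<le> ((1 - \<gamma> b) * (1 - \<gamma> b') + \<gamma> b + \<gamma> b') * of_bool (E u b b')"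
      by simp
  qed
  also have "\<dots> = (\<Sum>b\<in>B. \<Sum>b'\<in>B. (1 - \<gamma> b) * (1 - \<gamma> b') * of_bool (E u b b'))
     + \<sigma> + (\<Sum>b\<in>B. \<Sum>b'\<in>B. \<gamma> b' * of_bool (E u b b'))"
    by (simp only: distrib_right sum.distrib \<sigma>_def codegree_def sum_distrib_left)
  also have "(\<Sum>b\<in>B. \<Sum>b'\<in>B. \<gamma> b' * of_bool (E u b b')) = \<sigma>"
    by (subst sum.swap) (simp add: \<sigma>_def codegree_def sum_distrib_left right_commute[of u])
  also have "(\<Sum>b\<in>B. \<Sum>b'\<in>B. (1 - \<gamma> b) * (1 - \<gamma> b') * of_bool (E u b b')) \<le> (\<Sum>b\<in>B. 1 - \<gamma> b)\<^sup>2 / 2"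
    using \<gamma> right_commute no_K4_minus by (intro weighted_mantel) simp_all
  finally show ?thesis
    using \<sigma>_le unfolding sum_\<gamma> by (simp add: algebra_simps)
qed

lemma link_le_of_cover:
  assumes fin: "finite R" "finite A" "finite B" "finite C"
    and disjoint: "A \<inter> B = {}" "A \<inter> C = {}" "B \<inter> C = {}" "R \<inter> (A \<union> B \<union> C) = {}"
  defines "V \<equiv> R \<union> (A \<union> B \<union> C)"
  shows "link E u V V \<le> 2 * real (card R) * real (card V) + 2 * (link E u A B + link E u A C + link E u B C)
     + (link E u A A + link E u B B + link E u C C)"
proof -
  let ?W = "A \<union> B \<union> C"
  have "link E u V V = link E u R V + link E u ?W R + link E u ?W ?W"
    using fin disjoint link_Un_left[of R ?W E u V] link_Un_right[of R ?W E u ?W] by (simp add: V_def)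
  moreover have "link E u R V \<le> real (card R) * real (card V)"
    by (rule link_le)
  moreover have "link E u ?W R \<le> real (card R) * real (card V)"
  proof -
    have "card ?W \<le> card V"
      unfolding V_def using fin by (intro card_mono) auto
    then have "real (card ?W) * real (card R) \<le> real (card V) * real (card R)"
      by (intro mult_right_mono) simp_all
    then show ?thesis
      using link_le[of E u ?W R] by (simp add: mult.commute)
  qed
  ultimately show ?thesis
    using link_Un3[OF fin(2-4) disjoint(1-3), of u] by simp
qed

end

section \<open>The certificate on six points\<close>

text \<open>The integer weights are a rounded solution of a semidefinite program. Summed over all placements of six points,
  \<open>flag_term\<close> is the quantity that has to be negative for some edge \<open>ijk\<close> (\<open>objective\<close>), plus sums of
  squares (\<open>edge_square\<close>, rooted at an edge and a fourth vertex; \<open>pair_square\<close>, rooted at a pair) and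
  multiples of the density constraints on \<open>V\<close> and on the intersections \<open>N(xy) \<inter> N(yz)\<close>, all at
  \<open>extremal_density = 1/4\<close>. The dependence on the density is linear, with coefficient \<open>slope_term\<close>.\<close>

text \<open>Four times the deviation from the density \<open>1/4\<close>.\<close>

definition deviation :: "bool \<Rightarrow> int" where
  "deviation b = (if b then 3 else - 1)"

text \<open>The vertex of the edge \<open>ijk\<close> that \<open>p\<close> can replace; there is at most one.\<close>

definition twin :: "('v \<Rightarrow> 'v \<Rightarrow> 'v \<Rightarrow> bool) \<Rightarrow> 'v \<Rightarrow> 'v \<Rightarrow> 'v \<Rightarrow> 'v \<Rightarrow> 'v option" where
  "twin E i j k p = (if E j k p then Some i else if E i k p then Some j else if E i j p then Some k else None)"

definition transversal :: "'v option \<Rightarrow> 'v option \<Rightarrow> 'v option \<Rightarrow> bool" where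
  "transversal a b c \<longleftrightarrow> a \<noteq> None \<and> b \<noteq> None \<and> c \<noteq> None \<and> a \<noteq> b \<and> a \<noteq> c \<and> b \<noteq> c"

definition monochromatic :: "'v option \<Rightarrow> 'v option \<Rightarrow> 'v option \<Rightarrow> bool" where
  "monochromatic a b c \<longleftrightarrow> a \<noteq> None \<and> a = b \<and> b = c"

definition uncovered_weight :: "'v option \<Rightarrow> int" where
  "uncovered_weight a = (if a = None then 49 else - 1)"

definition covered_weight :: "'v option \<Rightarrow> int" where
  "covered_weight a = (if a = None then - 1 else 3)"

definition objective :: "'v option \<Rightarrow> 'v option \<Rightarrow> 'v option \<Rightarrow> bool \<Rightarrow> int" where
  "objective a b c e = (if transversal a b c \<and> \<not> e then 20250000 else 0) - (if transversal a b c then 18225000 else 0)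
     + (if a \<noteq> None \<and> b \<noteq> None \<and> c \<noteq> None then 4050000 else 0) - (if monochromatic a b c then 4050000 * deviation e else 0)
     + 1500 * (uncovered_weight a * covered_weight b * covered_weight c
         + covered_weight a * uncovered_weight b * covered_weight c
         + covered_weight a * covered_weight b * uncovered_weight c)"

datatype edge_kind = Irrelevant | Twin | Along | Other_Twin_Along | Twin_Across | Twin_Along | Across

type_synonym attachment = "bool \<times> bool \<times> bool \<times> bool \<times> bool \<times> bool"

definition attachment :: "('v \<Rightarrow> 'v \<Rightarrow> 'v \<Rightarrow> bool) \<Rightarrow> 'v \<Rightarrow> 'v \<Rightarrow> 'v \<Rightarrow> 'v \<Rightarrow> 'v \<Rightarrow> attachment" where
  "attachment E i j k l p = (E j k p, E i k p, E i j p, E i l p, E j l p, E k l p)"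

text \<open>The flag of an attachment as seen from the first vertex of the edge.\<close>

fun edge_flag :: "attachment \<Rightarrow> edge_kind" where
  "edge_flag (jk, ik, ij, il, jl, kl) =
    (if jk then (if il then Twin_Along else if jl \<or> kl then Twin_Across else Twin)
     else if ik \<or> ij then (if il then Other_Twin_Along else Irrelevant)
     else if il then (if jl \<or> kl then Irrelevant else Along)
     else if jl \<and> kl then Across else Irrelevant)"

fun edge_flags :: "attachment \<Rightarrow> edge_kind \<times> edge_kind \<times> edge_kind" where
  "edge_flags (jk, ik, ij, il, jl, kl) =
     (edge_flag (jk, ik, ij, il, jl, kl), edge_flag (ik, jk, ij, jl, il, kl), edge_flag (ij, jk, ik, kl, il, jl))"

fun weight_a :: "edge_kind \<Rightarrow> int" where
  "weight_a Irrelevant = 0" | "weight_a Twin = 9" | "weight_a Along = 97" | "weight_a Other_Twin_Along = -15"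
| "weight_a Twin_Across = 12" | "weight_a Twin_Along = -24" | "weight_a Across = 18"

fun weight_b :: "edge_kind \<Rightarrow> int" where
  "weight_b Irrelevant = 0" | "weight_b Twin = -8" | "weight_b Along = 30" | "weight_b Other_Twin_Along = 34"
| "weight_b Twin_Across = 16" | "weight_b Twin_Along = 81" | "weight_b Across = -37"

fun weight_c :: "edge_kind \<Rightarrow> int" where
  "weight_c Irrelevant = 0" | "weight_c Twin = 33" | "weight_c Along = -15" | "weight_c Other_Twin_Along = -9"
| "weight_c Twin_Across = 66" | "weight_c Twin_Along = 28" | "weight_c Across = 61"

fun difference_form :: "('f \<Rightarrow> int) \<Rightarrow> 'f \<times> 'f \<times> 'f \<Rightarrow> 'f \<times> 'f \<times> 'f \<Rightarrow> int" where
  "difference_form w (a, b, c) (a', b', c') =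
     (w a - w b) * (w a' - w b') + (w a - w c) * (w a' - w c') + (w b - w c) * (w b' - w c')"

text \<open>The symmetric group of the edge acts on its flags; \<open>standard_form\<close> is the contribution of the
  two-dimensional irreducible representation to the sum of squares, \<open>orbit_weight\<close> that of the trivial one.\<close>

definition standard_form :: "edge_kind \<times> edge_kind \<times> edge_kind \<Rightarrow> edge_kind \<times> edge_kind \<times> edge_kind \<Rightarrow> int" where
  "standard_form x y = 149 * difference_form weight_a x y + 1129 * difference_form weight_b x y
      + 579 * difference_form weight_c x y"

fun orbit_weight :: "attachment \<Rightarrow> int" where
  "orbit_weight (jk, ik, ij, il, jl, kl) =
    (if jk \<or> ik \<or> ij then (if jk \<and> il \<or> ik \<and> jl \<or> ij \<and> kl then - 39 else if il \<or> jl \<or> kl then - 10 else 46)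
     else if il \<and> jl \<and> kl then - 57 else if il \<and> jl \<or> il \<and> kl \<or> jl \<and> kl then - 45
     else if il \<or> jl \<or> kl then - 29 else 17)"

definition edge_form :: "attachment \<Rightarrow> attachment \<Rightarrow> int" where
  "edge_form x y = standard_form (edge_flags x) (edge_flags y) + 1137 * orbit_weight x * orbit_weight y"

definition edge_square :: "('v \<Rightarrow> 'v \<Rightarrow> 'v \<Rightarrow> bool) \<Rightarrow> 'v \<Rightarrow> 'v \<Rightarrow> 'v \<Rightarrow> 'v \<Rightarrow> 'v \<Rightarrow> 'v \<Rightarrow> int" where
  "edge_square E i j k l p q =
     (if twin E i j k l = None then edge_form (attachment E i j k l p) (attachment E i j k l q) else 0)"

definition in_both_links :: "('v \<Rightarrow> 'v \<Rightarrow> 'v \<Rightarrow> bool) \<Rightarrow> 'v \<Rightarrow> 'v \<Rightarrow> 'v \<Rightarrow> 'v \<Rightarrow> 'v \<Rightarrow> 'v \<Rightarrow> bool" where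
  "in_both_links E x y z p q r \<longleftrightarrow> E x y p \<and> E y z p \<and> E x y q \<and> E y z q \<and> E x y r \<and> E y z r"

definition overlaps :: "('v \<Rightarrow> 'v \<Rightarrow> 'v \<Rightarrow> bool) \<Rightarrow> 'v \<Rightarrow> 'v \<Rightarrow> 'v \<Rightarrow> 'v \<Rightarrow> 'v \<Rightarrow> 'v \<Rightarrow> int" where
  "overlaps E i j k l p q =
     of_bool (in_both_links E i j k l p q) + of_bool (in_both_links E j i k l p q) + of_bool (in_both_links E i k j l p q)"

definition flag_term :: "('v \<Rightarrow> 'v \<Rightarrow> 'v \<Rightarrow> bool) \<Rightarrow> 'v \<Rightarrow> 'v \<Rightarrow> 'v \<Rightarrow> 'v \<Rightarrow> 'v \<Rightarrow> 'v \<Rightarrow> int" where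
  "flag_term E i j k l p q =
     (if E i j k then objective (twin E i j k l) (twin E i j k p) (twin E i j k q) (E l p q)
         + 3 * (edge_square E i j k l p q + edge_square E i j k p l q + edge_square E i j k q l p)
         - 3141000 * deviation (E l p q)
      else 0) + 3784500 * deviation (E i j k) - 8167500 * (overlaps E i j k l p q * deviation (E l p q))"

definition slope_term :: "('v \<Rightarrow> 'v \<Rightarrow> 'v \<Rightarrow> bool) \<Rightarrow> 'v \<Rightarrow> 'v \<Rightarrow> 'v \<Rightarrow> 'v \<Rightarrow> 'v \<Rightarrow> 'v \<Rightarrow> int" where
  "slope_term E i j k l p q =
     (if E i j k then
        (if monochromatic (twin E i j k l) (twin E i j k p) (twin E i j k q) then 16200000 else 0) + 12564000
      else 0) - 15138000 + 32670000 * overlaps E i j k l p q"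

datatype pair_kind = No_Edge | One_On_Pair | Two_On_Pair | Cross | Cross_On_Pair | Two_Cross

definition pair_flag :: "bool \<Rightarrow> bool \<Rightarrow> bool \<Rightarrow> bool \<Rightarrow> pair_kind" where
  "pair_flag apq bpq abp abq =
    (if apq \<and> bpq then Two_Cross else if apq \<or> bpq then (if abp \<or> abq then Cross_On_Pair else Cross)
     else if abp \<and> abq then Two_On_Pair else if abp \<or> abq then One_On_Pair else No_Edge)"

definition pair_flag_of :: "('v \<Rightarrow> 'v \<Rightarrow> 'v \<Rightarrow> bool) \<Rightarrow> 'v \<Rightarrow> 'v \<Rightarrow> 'v \<Rightarrow> 'v \<Rightarrow> pair_kind" where
  "pair_flag_of E a b p q = pair_flag (E a p q) (E b p q) (E a b p) (E a b q)"

fun weight_d :: "pair_kind \<Rightarrow> int" where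
  "weight_d No_Edge = 9" | "weight_d One_On_Pair = -35" | "weight_d Two_On_Pair = 85"
| "weight_d Cross = 7" | "weight_d Cross_On_Pair = -30" | "weight_d Two_Cross = -3"

fun weight_e :: "pair_kind \<Rightarrow> int" where
  "weight_e No_Edge = -29" | "weight_e One_On_Pair = -30" | "weight_e Two_On_Pair = 2"
| "weight_e Cross = 9" | "weight_e Cross_On_Pair = 24" | "weight_e Two_Cross = 88"

definition pair_form :: "pair_kind \<Rightarrow> pair_kind \<Rightarrow> int" where
  "pair_form x y = 194 * weight_d x * weight_d y + 481 * weight_e x * weight_e y"

definition pair_square :: "('v \<Rightarrow> 'v \<Rightarrow> 'v \<Rightarrow> bool) \<Rightarrow> 'v \<Rightarrow> 'v \<Rightarrow> 'v \<Rightarrow> 'v \<Rightarrow> 'v \<Rightarrow> 'v \<Rightarrow> int" where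
  "pair_square E a b c d e f = pair_form (pair_flag_of E a b c d) (pair_flag_of E a b e f)
     + pair_form (pair_flag_of E c d a b) (pair_flag_of E c d e f)
         + pair_form (pair_flag_of E e f a b) (pair_flag_of E e f c d)"

datatype point = V0 | V1 | V2 | V3 | V4 | V5

text \<open>The sums over the 20 ordered splits into two triples and over the 15 partitions into three pairs.\<close>

definition sum_splits :: "(point \<Rightarrow> point \<Rightarrow> point \<Rightarrow> point \<Rightarrow> point \<Rightarrow> point \<Rightarrow> int) \<Rightarrow> int" where
  "sum_splits f =
     f V0 V1 V2 V3 V4 V5 + f V0 V1 V3 V2 V4 V5 + f V0 V1 V4 V2 V3 V5 + f V0 V1 V5 V2 V3 V4
   + f V0 V2 V3 V1 V4 V5 + f V0 V2 V4 V1 V3 V5 + f V0 V2 V5 V1 V3 V4 + f V0 V3 V4 V1 V2 V5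
   + f V0 V3 V5 V1 V2 V4 + f V0 V4 V5 V1 V2 V3 + f V1 V2 V3 V0 V4 V5 + f V1 V2 V4 V0 V3 V5
   + f V1 V2 V5 V0 V3 V4 + f V1 V3 V4 V0 V2 V5 + f V1 V3 V5 V0 V2 V4 + f V1 V4 V5 V0 V2 V3
   + f V2 V3 V4 V0 V1 V5 + f V2 V3 V5 V0 V1 V4 + f V2 V4 V5 V0 V1 V3 + f V3 V4 V5 V0 V1 V2"

definition sum_pairings :: "(point \<Rightarrow> point \<Rightarrow> point \<Rightarrow> point \<Rightarrow> point \<Rightarrow> point \<Rightarrow> int) \<Rightarrow> int" where
  "sum_pairings f =
     f V0 V1 V2 V3 V4 V5 + f V0 V1 V2 V4 V3 V5 + f V0 V1 V2 V5 V3 V4 + f V0 V2 V1 V3 V4 V5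
   + f V0 V2 V1 V4 V3 V5 + f V0 V2 V1 V5 V3 V4 + f V0 V3 V1 V2 V4 V5 + f V0 V3 V1 V4 V2 V5
   + f V0 V3 V1 V5 V2 V4 + f V0 V4 V1 V2 V3 V5 + f V0 V4 V1 V3 V2 V5 + f V0 V4 V1 V5 V2 V3
   + f V0 V5 V1 V2 V3 V4 + f V0 V5 V1 V3 V2 V4 + f V0 V5 V1 V4 V2 V3"

definition certificate :: "(point \<Rightarrow> point \<Rightarrow> point \<Rightarrow> bool) \<Rightarrow> int" where
  "certificate E = sum_splits (flag_term E) + 4 * sum_pairings (pair_square E)"

definition slope :: "(point \<Rightarrow> point \<Rightarrow> point \<Rightarrow> bool) \<Rightarrow> int" where
  "slope E = sum_splits (slope_term E)"

definition certified :: "(point \<Rightarrow> point \<Rightarrow> point \<Rightarrow> bool) \<Rightarrow> bool" where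
  "certified E \<longleftrightarrow> certificate E \<le> - 28800 \<and> slope E \<le> 0"

section \<open>Invariance of the certificate\<close>

lemma pair_square_pullback: "pair_square (pullback E f) i j k l p q = pair_square E (f i) (f j) (f k) (f l) (f p) (f q)"
  unfolding pair_square_def pair_flag_of_def pullback_def by (rule refl)

lemma pair_square_swap:
  assumes "ternary_graph E"
  shows "pair_square E b a c d e f = pair_square E a b c d e f"
    and "pair_square E a b d c e f = pair_square E a b c d e f"
    and "pair_square E a b c d f e = pair_square E a b c d e f"
    and "pair_square E c d a b e f = pair_square E a b c d e f"
    and "pair_square E a b e f c d = pair_square E a b c d e f"
proof -
  interpret ternary_graph E by (rule assms)
  have pair_flag: "pair_flag_of E y x p q = pair_flag_of E x y p q" "pair_flag_of E x y q p = pair_flag_of E x y p q"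
      for x y p q
    by (auto simp: pair_flag_of_def pair_flag_def edge_ac)
  show "pair_square E b a c d e f = pair_square E a b c d e f"
    and "pair_square E a b d c e f = pair_square E a b c d e f"
    and "pair_square E a b c d f e = pair_square E a b c d e f"
    unfolding pair_square_def
    by (simp_all only: pair_flag(1)[of b a] pair_flag(1)[of d c] pair_flag(1)[of f e]
        pair_flag(2)[of _ _ b a] pair_flag(2)[of _ _ d c] pair_flag(2)[of _ _ f e])
  show "pair_square E c d a b e f = pair_square E a b c d e f" "pair_square E a b e f c d = pair_square E a b c d e f"
    by (simp_all add: pair_square_def pair_form_def)
qed

lemma transversal_swap:
  "transversal b a c = transversal a b c" "transversal a c b = transversal a b c"
  by (auto simp: transversal_def)

lemma monochromatic_swap:
  "monochromatic b a c = monochromatic a b c" "monochromatic a c b = monochromatic a b c"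
  by (auto simp: monochromatic_def)

lemma objective_swap:
  "objective b a c e = objective a b c e" "objective a c b e = objective a b c e"
  by (simp_all add: objective_def transversal_swap monochromatic_swap conj_left_commute conj_commute mult_ac)

lemma difference_form_swap:
  "difference_form w (b, a, c) (b', a', c') = difference_form w (a, b, c) (a', b', c')"
  "difference_form w (a, c, b) (a', c', b') = difference_form w (a, b, c) (a', b', c')"
  "difference_form w y x = difference_form w x y"
  by (simp_all add: algebra_simps) (cases x; cases y; simp add: algebra_simps)

lemma edge_square_swap_right: "edge_square E i j k l q p = edge_square E i j k l p q"
  by (simp add: edge_square_def edge_form_def standard_form_def
      difference_form_swap(3)[of _ "edge_flags (attachment E i j k l q)"])

context hom_free
begin

lemma twin_eq_Some:
  assumes "E i j k"
  shows "twin E i j k p = Some i \<longleftrightarrow> E j k p" "twin E i j k p = Some j \<longleftrightarrow> E i k p" "twin E i j k p = Some k \<longleftrightarrow> E i j p"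
proof -
  have "\<not> (E j k p \<and> E i k p)" "\<not> (E i k p \<and> E i j p)" "\<not> (E j k p \<and> E i j p)"
    using assms no_K4_minus[of k i j p] no_K4_minus[of i j k p] no_K4_minus[of j i k p] edge_ac by metis+
  moreover have "i \<noteq> j" "i \<noteq> k" "j \<noteq> k"
    using assms by auto
  ultimately show "twin E i j k p = Some i \<longleftrightarrow> E j k p" "twin E i j k p = Some j \<longleftrightarrow> E i k p" "twin E i j k p = Some k \<longleftrightarrow> E i j p"
    by (auto simp: twin_def)
qed

lemma twin_swap:
  assumes "E i j k"
  shows "twin E j i k p = twin E i j k p" "twin E i k j p = twin E i j k p"
  using twin_eq_Some[OF assms, of p] unfolding twin_def left_commute[of j i] right_commute[of i k] left_commute[of k j]
  by auto

end

lemma edge_flag_swap: "edge_flag (jk, ij, ik, il, kl, jl) = edge_flag (jk, ik, ij, il, jl, kl)"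
  by (simp add: disj_commute conj_commute)

lemma edge_flags_swap:
  assumes "edge_flags (jk, ik, ij, il, jl, kl) = (a, b, c)"
  shows "edge_flags (ik, jk, ij, jl, il, kl) = (b, a, c)" "edge_flags (jk, ij, ik, il, kl, jl) = (a, c, b)"
  using assms edge_flag_swap[of ik ij jk jl kl il] edge_flag_swap[of ij ik jk kl jl il] edge_flag_swap[of jk ij ik il kl jl]
  by (simp_all del: edge_flag.simps)

lemma orbit_weight_swap:
  "orbit_weight (ik, jk, ij, jl, il, kl) = orbit_weight (jk, ik, ij, il, jl, kl)"
  "orbit_weight (jk, ij, ik, il, kl, jl) = orbit_weight (jk, ik, ij, il, jl, kl)"
  by (simp_all add: disj_ac conj_ac)

lemma (in hom_free) edge_square_swap:
  assumes "E i j k"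
  shows "edge_square E j i k l p q = edge_square E i j k l p q" "edge_square E i k j l p q = edge_square E i j k l p q"
proof -
  obtain a b c where p: "edge_flags (attachment E i j k l p) = (a, b, c)"
    by (cases "edge_flags (attachment E i j k l p)")
  obtain a' b' c' where q: "edge_flags (attachment E i j k l q) = (a', b', c')"
    by (cases "edge_flags (attachment E i j k l q)")
  note attachment = attachment_def left_commute[of j i] right_commute[of i k] left_commute[of k j]
  have "edge_flags (attachment E j i k l p) = (b, a, c)" "edge_flags (attachment E j i k l q) = (b', a', c')"
    using edge_flags_swap(1)[OF p[unfolded attachment]] edge_flags_swap(1)[OF q[unfolded attachment]]
    by (simp_all only: attachment)
  moreover have "orbit_weight (attachment E j i k l r) = orbit_weight (attachment E i j k l r)" for r
    by (simp only: attachment orbit_weight_swap)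
  ultimately show "edge_square E j i k l p q = edge_square E i j k l p q"
    by (simp only: edge_square_def twin_swap[OF assms] edge_form_def standard_form_def p q difference_form_swap)
  have "edge_flags (attachment E i k j l p) = (a, c, b)" "edge_flags (attachment E i k j l q) = (a', c', b')"
    using edge_flags_swap(2)[OF p[unfolded attachment]] edge_flags_swap(2)[OF q[unfolded attachment]]
    by (simp_all only: attachment)
  moreover have "orbit_weight (attachment E i k j l r) = orbit_weight (attachment E i j k l r)" for r
    by (simp only: attachment orbit_weight_swap)
  ultimately show "edge_square E i k j l p q = edge_square E i j k l p q"
    by (simp only: edge_square_def twin_swap[OF assms] edge_form_def standard_form_def p q difference_form_swap)
qed

lemma in_both_links_swap:
  assumes "ternary_graph E"
  shows "in_both_links E z y x p q r = in_both_links E x y z p q r"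
    "in_both_links E x y z q p r = in_both_links E x y z p q r"
    "in_both_links E x y z p r q = in_both_links E x y z p q r"
proof -
  interpret ternary_graph E by (rule assms)
  show "in_both_links E z y x p q r = in_both_links E x y z p q r"
      "in_both_links E x y z q p r = in_both_links E x y z p q r"
    "in_both_links E x y z p r q = in_both_links E x y z p q r"
    unfolding in_both_links_def by (auto simp: edge_ac)
qed

lemma overlaps_swap:
  assumes "ternary_graph E"
  shows "overlaps E j i k l p q = overlaps E i j k l p q" "overlaps E i k j l p q = overlaps E i j k l p q"
    "overlaps E i j k p l q = overlaps E i j k l p q" "overlaps E i j k l q p = overlaps E i j k l p q"
  unfolding overlaps_def
  using in_both_links_swap(1)[OF assms, of k i j] in_both_links_swap(1)[OF assms, of k j i]
      in_both_links_swap(1)[OF assms, of j k i]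
    in_both_links_swap(1)[OF assms, of j i k] in_both_links_swap(2)[OF assms, of _ _ _ p l q]
        in_both_links_swap(3)[OF assms, of _ _ _ l q p]
  by simp_all

lemma flag_term_swap:
  assumes "hom_free E"
  shows "flag_term E j i k l p q = flag_term E i j k l p q" "flag_term E i k j l p q = flag_term E i j k l p q"
    "flag_term E i j k p l q = flag_term E i j k l p q" "flag_term E i j k l q p = flag_term E i j k l p q"
proof -
  interpret hom_free E by (rule assms)
  show "flag_term E j i k l p q = flag_term E i j k l p q" "flag_term E i k j l p q = flag_term E i j k l p q"
    using edge_square_swap twin_swap overlaps_swap(1,2)[OF ternary_graph_axioms]
    unfolding flag_term_def left_commute[of j i k] right_commute[of i k j] by auto
  show "flag_term E i j k p l q = flag_term E i j k l p q"
    using edge_square_swap_right[of E] overlaps_swap(3)[OF ternary_graph_axioms]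
    unfolding flag_term_def left_commute[of p l q] by (simp add: objective_swap(1)[of "twin E i j k p"])
  show "flag_term E i j k l q p = flag_term E i j k l p q"
    using edge_square_swap_right[of E] overlaps_swap(4)[OF ternary_graph_axioms]
    unfolding flag_term_def right_commute[of l q p] by (simp add: objective_swap(2)[of _ "twin E i j k q"])
qed

lemma slope_term_swap:
  assumes "hom_free E"
  shows "slope_term E j i k l p q = slope_term E i j k l p q" "slope_term E i k j l p q = slope_term E i j k l p q"
    "slope_term E i j k p l q = slope_term E i j k l p q" "slope_term E i j k l q p = slope_term E i j k l p q"
proof -
  interpret hom_free E by (rule assms)
  show "slope_term E j i k l p q = slope_term E i j k l p q" "slope_term E i k j l p q = slope_term E i j k l p q"
    using twin_swap overlaps_swap(1,2)[OF ternary_graph_axioms]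
    unfolding slope_term_def left_commute[of j i k] right_commute[of i k j] by auto
  show "slope_term E i j k p l q = slope_term E i j k l p q" "slope_term E i j k l q p = slope_term E i j k l p q"
    using overlaps_swap(3,4)[OF ternary_graph_axioms] by (auto simp: slope_term_def monochromatic_def)
qed

lemma sum_splits_transpose:
  assumes "\<And>i j k l p q. f j i k l p q = f i j k l p q" "\<And>i j k l p q. f i k j l p q = f i j k l p q"
    "\<And>i j k l p q. f i j k p l q = f i j k l p q" "\<And>i j k l p q. f i j k l q p = f i j k l p q"
  shows "sum_splits (\<lambda>i j k l p q. f (Transposition.transpose a b i) (Transposition.transpose a b j)
      (Transposition.transpose a b k)
     (Transposition.transpose a b l) (Transposition.transpose a b p) (Transposition.transpose a b q)) = sum_splits f"
  by (cases a; cases b; simp add: sum_splits_def Transposition.transpose_def assms)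

lemma sum_pairings_transpose:
  assumes "\<And>i j k l p q. f j i k l p q = f i j k l p q" "\<And>i j k l p q. f i j l k p q = f i j k l p q"
    "\<And>i j k l p q. f i j k l q p = f i j k l p q" "\<And>i j k l p q. f k l i j p q = f i j k l p q"
    "\<And>i j k l p q. f i j p q k l = f i j k l p q"
  shows "sum_pairings (\<lambda>i j k l p q. f (Transposition.transpose a b i) (Transposition.transpose a b j)
      (Transposition.transpose a b k)
     (Transposition.transpose a b l) (Transposition.transpose a b p) (Transposition.transpose a b q)) = sum_pairings f"
  by (cases a; cases b; simp add: sum_pairings_def Transposition.transpose_def assms)

text \<open>On an edge \<open>ijk\<close> of the pullback \<open>f\<close> is injective, so that comparing twins commutes with \<open>f\<close>.\<close>

lemma (in hom_free) flag_term_pullback: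
  "flag_term (pullback E f) i j k l p q = flag_term E (f i) (f j) (f k) (f l) (f p) (f q)"
  "slope_term (pullback E f) i j k l p q = slope_term E (f i) (f j) (f k) (f l) (f p) (f q)"
proof -
  have twin_None: "twin (pullback E f) i j k x = None \<longleftrightarrow> twin E (f i) (f j) (f k) (f x) = None" for x
    by (simp add: twin_def pullback_def)
  have twin_eq: "twin (pullback E f) i j k x = twin (pullback E f) i j k y
      \<longleftrightarrow> twin E (f i) (f j) (f k) (f x) = twin E (f i) (f j) (f k) (f y)"
    if "E (f i) (f j) (f k)" for x y
    using that not_edge_repeated unfolding twin_def pullback_def by auto
  have squares: "edge_square (pullback E f) i j k x y z = edge_square E (f i) (f j) (f k) (f x) (f y) (f z)" for x y z
    unfolding edge_square_def twin_None attachment_def pullback_def by (rule refl)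
  have overlaps: "overlaps (pullback E f) i j k l p q = overlaps E (f i) (f j) (f k) (f l) (f p) (f q)"
    by (simp add: overlaps_def in_both_links_def pullback_def)
  show "flag_term (pullback E f) i j k l p q = flag_term E (f i) (f j) (f k) (f l) (f p) (f q)"
    unfolding flag_term_def squares overlaps
    by (simp add: pullback_def objective_def transversal_def monochromatic_def uncovered_weight_def covered_weight_def
        twin_None twin_eq)
  show "slope_term (pullback E f) i j k l p q = slope_term E (f i) (f j) (f k) (f l) (f p) (f q)"
    unfolding slope_term_def overlaps by (simp add: pullback_def monochromatic_def twin_None twin_eq)
qed

lemma certified_transpose:
  assumes "hom_free E"
  shows "certified (pullback E (Transposition.transpose a b)) \<longleftrightarrow> certified E"
proof -
  interpret hom_free E by (rule assms)
  show ?thesis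
    unfolding certified_def certificate_def slope_def flag_term_pullback[abs_def] pair_square_pullback[abs_def]
      sum_splits_transpose[of "flag_term E", OF flag_term_swap[OF assms]]
      sum_splits_transpose[of "slope_term E", OF slope_term_swap[OF assms]]
      sum_pairings_transpose[of "pair_square E", OF pair_square_swap[OF ternary_graph_axioms]] ..
qed

lemma UNIV_point: "(UNIV :: point set) = {V0, V1, V2, V3, V4, V5}"
  using point.exhaust by auto

instance point :: finite
  by standard (simp add: UNIV_point)

lemma certified_pullback:
  assumes "bij t" "hom_free E"
  shows "certified (pullback E t) \<longleftrightarrow> certified E"
proof -
  have "t permutes UNIV"
    using bij_imp_permutes[OF assms(1)] by simp
  from this finite show ?thesis
    using assms(2)
  proof (induction t arbitrary: E rule: permutes_induct)
    case id
    then show ?case by (simp add: pullback_def[abs_def])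
  next
    case (swap a b t)
    then show ?case
      by (simp only: pullback_comp swap.IH[OF hom_free_pullback] certified_transpose)
  qed
qed

section \<open>Exhaustive search on six points\<close>

text \<open>The search decides one triple after another. Partial applications and conditionals take the place of lambda
  abstractions and implications, because evaluation by rewriting would normalise the body of an abstraction
  symbolically and the conclusion of an implication whose premise fails.\<close>

fun search :: "('t \<Rightarrow> 't list \<Rightarrow> bool) \<Rightarrow> ('t list \<Rightarrow> bool) \<Rightarrow> 't list \<Rightarrow> 't list \<Rightarrow> bool" where
  "search ok P es [] = P es"
| "search ok P es (t # ts) = (if ok t es then search ok P (t # es) ts \<and> search ok P es ts else search ok P es ts)"

lemma search_sound:
  assumes "search ok P es ts" and "\<And>t fs. Q t \<Longrightarrow> set fs \<subseteq> set es \<union> {t \<in> set ts. Q t} \<Longrightarrow> ok t fs"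
  shows "\<exists>fs. P fs \<and> set fs = set es \<union> {t \<in> set ts. Q t}"
  using assms
proof (induction ts arbitrary: es)
  case (Cons t ts)
  show ?case
  proof (cases "Q t")
    case True
    then have eq: "set es \<union> {u \<in> set (t # ts). Q u} = set (t # es) \<union> {u \<in> set ts. Q u}"
      by auto
    have "search ok P (t # es) ts"
      using Cons.prems True by (simp split: if_splits)
    then show ?thesis
      unfolding eq using Cons.prems(2)[unfolded eq] by (rule Cons.IH)
  next
    case False
    then have eq: "set es \<union> {u \<in> set (t # ts). Q u} = set es \<union> {u \<in> set ts. Q u}"
      by auto
    have "search ok P es ts"
      using Cons.prems(1) by (simp split: if_splits)
    then show ?thesis
      unfolding eq using Cons.prems(2)[unfolded eq] by (rule Cons.IH)
  qed
qed auto

type_synonym triple = "point \<times> point \<times> point"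

definition all_triples :: "triple list" where
  "all_triples = [(V0, V1, V2), (V0, V1, V3), (V0, V1, V4), (V0, V1, V5), (V0, V2, V3), (V0, V2, V4), (V0, V2, V5),
     (V0, V3, V4), (V0, V3, V5), (V0, V4, V5), (V1, V2, V3), (V1, V2, V4), (V1, V2, V5), (V1, V3, V4), (V1, V3, V5),
     (V1, V4, V5), (V2, V3, V4), (V2, V3, V5), (V2, V4, V5), (V3, V4, V5)]"

fun same_triple :: "triple \<Rightarrow> point \<Rightarrow> point \<Rightarrow> point \<Rightarrow> bool" where
  "same_triple (a, b, c) i j k =
    (if i = a then (if j = b then k = c else if j = c then k = b else False)
     else if i = b then (if j = a then k = c else if j = c then k = a else False)
     else if i = c then (if j = a then k = b else if j = b then k = a else False)
     else False)"

primrec rel :: "triple list \<Rightarrow> point \<Rightarrow> point \<Rightarrow> point \<Rightarrow> bool" where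
  "rel [] i j k = False"
| "rel (t # ts) i j k = (if same_triple t i j k then True else rel ts i j k)"

definition all_points :: "(point \<Rightarrow> bool) \<Rightarrow> bool" where
  "all_points P \<longleftrightarrow> P V0 \<and> P V1 \<and> P V2 \<and> P V3 \<and> P V4 \<and> P V5"

definition avoids_K4_minus :: "triple list \<Rightarrow> point \<Rightarrow> point \<Rightarrow> point \<Rightarrow> point \<Rightarrow> bool" where
  "avoids_K4_minus es i j k d \<longleftrightarrow>
    (if rel es i j d then (if rel es i k d then False else \<not> rel es j k d)
     else if rel es i k d then \<not> rel es j k d else True)"

definition avoids_cycle :: "triple list \<Rightarrow> point \<Rightarrow> point \<Rightarrow> point \<Rightarrow> point \<Rightarrow> point \<Rightarrow> bool" where
  "avoids_cycle es b c d e a \<longleftrightarrow>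
    (if rel es a b c then \<not> rel es d e a else if rel es d e a then \<not> rel es e a b else True)"

definition avoids_cycles_via :: "triple list \<Rightarrow> point \<Rightarrow> point \<Rightarrow> point \<Rightarrow> point \<Rightarrow> bool" where
  "avoids_cycles_via es b c d e \<longleftrightarrow> (if rel es c d e then all_points (avoids_cycle es b c d e) else True)"

definition avoids_cycles :: "triple list \<Rightarrow> point \<Rightarrow> point \<Rightarrow> point \<Rightarrow> bool" where
  "avoids_cycles es b c d \<longleftrightarrow> all_points (avoids_cycles_via es b c d)"

fun extends_hom_free :: "triple \<Rightarrow> triple list \<Rightarrow> bool" where
  "extends_hom_free (i, j, k) es \<longleftrightarrow> (if all_points (avoids_K4_minus es i j k) then
     avoids_cycles es i j k \<and> avoids_cycles es i k j \<and> avoids_cycles es j i k \<and> avoids_cycles es j k i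
       \<and> avoids_cycles es k i j \<and> avoids_cycles es k j i
     else False)"

definition unlinked :: "triple list \<Rightarrow> point \<Rightarrow> point \<Rightarrow> point \<Rightarrow> point \<Rightarrow> bool" where
  "unlinked es i j k d \<longleftrightarrow>
    (if rel es i j d then d = k else if rel es i k d then d = j else if rel es j k d then d = i else True)"

fun extends_linear :: "triple \<Rightarrow> triple list \<Rightarrow> bool" where
  "extends_linear (i, j, k) es \<longleftrightarrow> all_points (unlinked es i j k)"

definition certified_edges :: "triple list \<Rightarrow> bool" where
  "certified_edges es \<longleftrightarrow> certified (rel es)"

lemma search_pair_in_three_edges:
  "search extends_hom_free certified_edges [(V0, V1, V2), (V0, V1, V3), (V0, V1, V4)] (drop 3 all_triples)"
  by code_simp

lemma search_pair_in_two_edges: "search extends_hom_free certified_edges [(V0, V1, V2), (V0, V1, V3)] (drop 4 all_triples)"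
  by code_simp

lemma search_linear: "search extends_linear certified_edges [(V0, V1, V2)] (drop 1 all_triples)"
  by code_simp

lemma certified_empty: "certified_edges []"
  by code_simp

lemma all_points_iff: "all_points P \<longleftrightarrow> (\<forall>x. P x)"
  unfolding all_points_def by (metis point.exhaust)

lemma rel_iff: "rel ts i j k \<longleftrightarrow> (\<exists>t\<in>set ts. same_triple t i j k)"
  by (induction ts) auto

lemma rel_all_triples: "i \<noteq> j \<Longrightarrow> i \<noteq> k \<Longrightarrow> j \<noteq> k \<Longrightarrow> rel all_triples i j k"
proof -
  have "all_points (\<lambda>i. all_points (\<lambda>j. all_points (\<lambda>k. i = j \<or> i = k \<or> j = k \<or> rel all_triples i j k)))"
    by code_simp
  then show "i \<noteq> j \<Longrightarrow> i \<noteq> k \<Longrightarrow> j \<noteq> k \<Longrightarrow> rel all_triples i j k"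
    unfolding all_points_iff by blast
qed

context
  fixes E :: "point \<Rightarrow> point \<Rightarrow> point \<Rightarrow> bool"
  assumes hom_free_E: "hom_free E"
begin

interpretation hom_free E
  by (rule hom_free_E)

lemma same_triple_edge: "same_triple (a, b, c) i j k \<Longrightarrow> E i j k = E a b c"
  by (auto simp: edge_ac split: if_splits)

lemma rel_imp_edge:
  assumes "\<And>a b c. (a, b, c) \<in> set es \<Longrightarrow> E a b c" and "rel es i j k"
  shows "E i j k"
  using assms same_triple_edge unfolding rel_iff by fast

lemma rel_eq:
  assumes "set es = {t \<in> set all_triples. case t of (a, b, c) \<Rightarrow> E a b c}"
  shows "rel es = E"
proof (intro ext iffI)
  fix i j k
  show "rel es i j k \<Longrightarrow> E i j k"
    by (rule rel_imp_edge[of es]) (simp_all add: assms)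
  assume e: "E i j k"
  then have "i \<noteq> j" "i \<noteq> k" "j \<noteq> k"
    by auto
  then obtain t where t: "t \<in> set all_triples" "same_triple t i j k"
    using rel_all_triples unfolding rel_iff by blast
  moreover have "case t of (a, b, c) \<Rightarrow> E a b c"
    using t(2) e same_triple_edge by (cases t) blast
  ultimately show "rel es i j k"
    unfolding rel_iff assms by blast
qed

lemma extends_hom_freeI:
  assumes sub: "\<And>a b c. rel es a b c \<Longrightarrow> E a b c" and e: "E i j k"
  shows "extends_hom_free (i, j, k) es"
proof -
  have "avoids_K4_minus es i j k d" for d
  proof -
    have "\<not> (E i j d \<and> E i k d)" "\<not> (E i j d \<and> E j k d)" "\<not> (E i k d \<and> E j k d)"
      using no_K4_minus[of i j k d] no_K4_minus[of j i k d] no_K4_minus[of k i j d] e edge_ac by metis+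
    then show ?thesis
      using sub unfolding avoids_K4_minus_def by auto
  qed
  moreover have "avoids_cycles es b c d" if "E b c d" for b c d
  proof -
    have "avoids_cycle es b c d e a" if "E c d e" for e a
      using sub no_C5_minus[of a b c d e] no_C5_minus[of b c d e a] \<open>E b c d\<close> that unfolding avoids_cycle_def by auto
    then show ?thesis
      using sub by (auto simp: avoids_cycles_def avoids_cycles_via_def all_points_iff)
  qed
  moreover have "E i k j" "E j i k" "E j k i" "E k i j" "E k j i"
    using e edge_ac by metis+
  ultimately show ?thesis
    using e by (simp add: all_points_iff)
qed

lemma extends_linearI:
  assumes sub: "\<And>a b c. rel es a b c \<Longrightarrow> E a b c" and e: "E i j k"
    and linear: "\<And>a b c d. E a b c \<Longrightarrow> E a b d \<Longrightarrow> c = d"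
  shows "extends_linear (i, j, k) es"
proof -
  have "E i k j" "E j k i"
    using e edge_ac by metis+
  then have "unlinked es i j k d" for d
    using linear e sub unfolding unlinked_def by metis
  then show ?thesis
    by (simp add: all_points_iff)
qed

lemma certified_if_search:
  assumes search: "search ok certified_edges es ts"
    and edges: "set es \<union> {t \<in> set ts. case t of (a, b, c) \<Rightarrow> E a b c} = {t \<in> set all_triples. case t of (a, b, c) \<Rightarrow> E a b c}"
    and ok: "\<And>i j k es. (\<And>a b c. rel es a b c \<Longrightarrow> E a b c) \<Longrightarrow> E i j k \<Longrightarrow> ok (i, j, k) es"
  shows "certified E"
proof -
  let ?Q = "\<lambda>t. case t of (a, b, c) \<Rightarrow> E a b c"
  have "\<exists>fs. certified_edges fs \<and> set fs = set es \<union> {t \<in> set ts. ?Q t}"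
  proof (rule search_sound[OF search])
    fix t fs
    assume "?Q t" and fs: "set fs \<subseteq> set es \<union> {t \<in> set ts. ?Q t}"
    moreover have "E a b c" if "rel fs a b c" for a b c
      using _ that by (rule rel_imp_edge) (use fs edges in auto)
    ultimately show "ok t fs"
      using ok by (cases t) auto
  qed
  then show ?thesis
    unfolding edges certified_edges_def using rel_eq by metis
qed

lemma certified_if_pair_in_three_edges:
  assumes "E V0 V1 V2" "E V0 V1 V3" "E V0 V1 V4"
  shows "certified E"
proof (rule certified_if_search[OF search_pair_in_three_edges])
  show "set [(V0, V1, V2), (V0, V1, V3), (V0, V1, V4)] \<union> {t \<in> set (drop 3 all_triples). case t of (a, b, c) \<Rightarrow> E a b c}
      = {t \<in> set all_triples. case t of (a, b, c) \<Rightarrow> E a b c}"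
    using assms unfolding all_triples_def by auto
qed (rule extends_hom_freeI)

lemma certified_if_pair_in_two_edges:
  assumes "E V0 V1 V2" "E V0 V1 V3" "\<not> E V0 V1 V4" "\<not> E V0 V1 V5"
  shows "certified E"
proof (rule certified_if_search[OF search_pair_in_two_edges])
  show "set [(V0, V1, V2), (V0, V1, V3)] \<union> {t \<in> set (drop 4 all_triples). case t of (a, b, c) \<Rightarrow> E a b c}
      = {t \<in> set all_triples. case t of (a, b, c) \<Rightarrow> E a b c}"
    using assms unfolding all_triples_def by auto
qed (rule extends_hom_freeI)

lemma certified_if_linear:
  assumes "E V0 V1 V2" and "\<And>a b c d. E a b c \<Longrightarrow> E a b d \<Longrightarrow> c = d"
  shows "certified E"
proof (rule certified_if_search[OF search_linear])
  show "set [(V0, V1, V2)] \<union> {t \<in> set (drop 1 all_triples). case t of (a, b, c) \<Rightarrow> E a b c}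
      = {t \<in> set all_triples. case t of (a, b, c) \<Rightarrow> E a b c}"
    using assms(1) unfolding all_triples_def by auto
qed (rule extends_linearI[OF _ _ assms(2)])

lemma certified_if_empty:
  assumes "\<And>a b c. \<not> E a b c"
  shows "certified E"
  using certified_empty rel_eq[of "[]"] assms by (simp add: certified_edges_def)

end

lemma bij_extension:
  fixes xs ys :: "'a :: finite list"
  assumes "distinct xs" "distinct ys" "length xs = length ys"
  obtains t where "bij t" "map t xs = ys"
proof -
  have "card (- set xs) = card (- set ys)"
    using assms by (simp add: Compl_eq_Diff_UNIV card_Diff_subset distinct_card)
  then obtain g where g: "bij_betw g (- set xs) (- set ys)"
    using finite_same_card_bij[OF finite finite] by blast
  define f where "f = (\<lambda>x. the (map_of (zip xs ys) x))"
  have f: "map f xs = ys"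
    using assms by (intro nth_equalityI) (simp_all add: f_def map_of_zip_nth)
  then have bij_f: "bij_betw f (set xs) (set ys)"
    using assms by (metis bij_betw_def distinct_map list.set_map)
  define t where "t = (\<lambda>x. if x \<in> set xs then f x else g x)"
  have "bij_betw t (set xs \<union> - set xs) (set ys \<union> - set ys)"
    unfolding t_def by (rule bij_betw_disjoint_Un[OF bij_f]) (use g in auto)
  then have "bij t"
    by simp
  moreover have "map t xs = ys"
    using f by (simp add: t_def cong: map_cong)
  ultimately show thesis
    by (rule that)
qed

lemma certified_by_relabelling:
  assumes E: "hom_free E" and "distinct ps" "distinct xs" "length ps = length xs"
    and certified: "\<And>t. bij t \<Longrightarrow> map t ps = xs \<Longrightarrow> certified (pullback E t)"
  shows "certified E"
proof -
  obtain t where t: "bij t" "map t ps = xs"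
    using bij_extension[OF assms(2-4)] .
  then show ?thesis
    using certified[OF t] certified_pullback[OF t(1) E] by simp
qed

theorem certified_hom_free:
  assumes E: "hom_free E"
  shows "certified E"
proof -
  interpret hom_free E by (rule E)
  consider (empty) "\<And>a b c. \<not> E a b c"
    | (three) a b c d e where "E a b c" "E a b d" "E a b e" "distinct [c, d, e]"
    | (two) a b c d where "E a b c" "E a b d" "c \<noteq> d" "\<And>e. E a b e \<Longrightarrow> e = c \<or> e = d"
    | (linear) a b c where "E a b c" "\<And>a b c d. E a b c \<Longrightarrow> E a b d \<Longrightarrow> c = d"
    by (metis distinct_length_2_or_more distinct_singleton)
  then show ?thesis
  proof cases
    case empty
    then show ?thesis by (rule certified_if_empty[OF E])
  next
    case three
    then show ?thesis
      by (intro certified_by_relabelling[OF E, of "[V0, V1, V2, V3, V4]" "[a, b, c, d, e]"]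
          certified_if_pair_in_three_edges hom_free_pullback E) (auto simp: pullback_def)
  next
    case two
    show ?thesis
    proof (rule certified_by_relabelling[OF E, of "[V0, V1, V2, V3]" "[a, b, c, d]"])
      fix t assume t: "bij t" "map t [V0, V1, V2, V3] = [a, b, c, d]"
      have "x = V2 \<or> x = V3" if "pullback E t V0 V1 x" for x
        using that t(2) two(4)[of "t x"] bij_is_inj[OF t(1)] by (auto simp: pullback_def inj_eq)
      then show "certified (pullback E t)"
        using t(2) two by (intro certified_if_pair_in_two_edges hom_free_pullback E) (auto simp: pullback_def)
    qed (use two in auto)
  next
    case linear
    show ?thesis
    proof (rule certified_by_relabelling[OF E, of "[V0, V1, V2]" "[a, b, c]"])
      fix t assume t: "bij t" "map t [V0, V1, V2] = [a, b, c]"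
      show "certified (pullback E t)"
      proof (rule certified_if_linear[OF hom_free_pullback[OF E]])
        show "pullback E t V0 V1 V2"
          using t(2) linear(1) by (simp add: pullback_def)
        show "c = d" if "pullback E t a b c" "pullback E t a b d" for a b c d
          using that linear(2)[of "t a" "t b" "t c" "t d"] bij_is_inj[OF t(1)] by (simp add: pullback_def inj_eq)
      qed
    qed (use linear in auto)
  qed
qed

section \<open>Averaging over samples\<close>

fun sum_tuples :: "nat \<Rightarrow> 'a set \<Rightarrow> ('a list \<Rightarrow> 'b :: comm_monoid_add) \<Rightarrow> 'b" where
  "sum_tuples 0 V g = g []"
| "sum_tuples (Suc n) V g = (\<Sum>v\<in>V. sum_tuples n V (\<lambda>vs. g (v # vs)))"

lemma sum_PiE_split:
  assumes "i \<in> I"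
  shows "(\<Sum>\<phi>\<in>I \<rightarrow>\<^sub>E V. G \<phi>) = (\<Sum>v\<in>V. \<Sum>\<phi>\<in>(I - {i}) \<rightarrow>\<^sub>E V. G (\<phi>(i := v)))"
proof -
  have "I \<rightarrow>\<^sub>E V = (\<lambda>(v, \<phi>). \<phi>(i := v)) ` (V \<times> ((I - {i}) \<rightarrow>\<^sub>E V))"
    using PiE_insert_eq[of i "I - {i}" "\<lambda>_. V"] assms by (simp add: insert_absorb)
  then have "(\<Sum>\<phi>\<in>I \<rightarrow>\<^sub>E V. G \<phi>) = (\<Sum>(v, \<phi>)\<in>V \<times> ((I - {i}) \<rightarrow>\<^sub>E V). G (\<phi>(i := v)))"
    using inj_combinator[of i "I - {i}" "\<lambda>_. V"] by (simp add: sum.reindex split_def)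
  then show ?thesis
    by (simp add: sum.cartesian_product)
qed

lemma sum_PiE_sample:
  fixes g :: "'a list \<Rightarrow> 'b :: comm_semiring_1"
  assumes "finite I" "distinct xs" "set xs \<subseteq> I"
  shows "(\<Sum>\<phi>\<in>I \<rightarrow>\<^sub>E V. g (map \<phi> xs)) = of_nat (card V) ^ (card I - length xs) * sum_tuples (length xs) V g"
  using assms
proof (induction xs arbitrary: I g)
  case Nil
  then show ?case by (simp add: card_PiE)
next
  case (Cons i xs)
  have "(\<Sum>\<phi>\<in>I \<rightarrow>\<^sub>E V. g (map \<phi> (i # xs))) = (\<Sum>v\<in>V. \<Sum>\<phi>\<in>(I - {i}) \<rightarrow>\<^sub>E V. g (v # map \<phi> xs))"
    using Cons.prems by (simp add: sum_PiE_split[of i I])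
  also have "\<dots> = (\<Sum>v\<in>V. of_nat (card V) ^ (card (I - {i}) - length xs) * sum_tuples (length xs) V (\<lambda>vs. g (v # vs)))"
    using Cons.prems by (intro sum.cong refl Cons.IH) auto
  also have "\<dots> = of_nat (card V) ^ (card I - length (i # xs)) * sum_tuples (length (i # xs)) V g"
    using Cons.prems by (simp add: sum_distrib_left)
  finally show ?case .
qed

lemma card_UNIV_point: "card (UNIV :: point set) = 6"
  by (simp add: UNIV_point)

abbreviation sum6 :: "'a set \<Rightarrow> ('a \<Rightarrow> 'a \<Rightarrow> 'a \<Rightarrow> 'a \<Rightarrow> 'a \<Rightarrow> 'a \<Rightarrow> 'b :: comm_monoid_add) \<Rightarrow> 'b" where
  "sum6 V f \<equiv> (\<Sum>a\<in>V. \<Sum>b\<in>V. \<Sum>c\<in>V. \<Sum>d\<in>V. \<Sum>e\<in>V. \<Sum>g\<in>V. f a b c d e g)"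

lemma sum_placements:
  fixes f :: "'a \<Rightarrow> 'a \<Rightarrow> 'a \<Rightarrow> 'a \<Rightarrow> 'a \<Rightarrow> 'a \<Rightarrow> int" and i j k l p q :: point
  assumes "distinct [i, j, k, l, p, q]"
  shows "(\<Sum>\<phi>\<in>UNIV \<rightarrow>\<^sub>E V. f (\<phi> i) (\<phi> j) (\<phi> k) (\<phi> l) (\<phi> p) (\<phi> q)) = sum6 V f"
  using sum_PiE_sample[OF finite assms, where V = V and g = "\<lambda>vs. f (vs ! 0) (vs ! 1) (vs ! 2) (vs ! 3) (vs ! 4) (vs ! 5)"]
  by (simp add: card_UNIV_point)

lemma sum_sum_splits:
  "(\<Sum>\<phi>\<in>UNIV \<rightarrow>\<^sub>E V. sum_splits (\<lambda>i j k l p q. f (\<phi> i) (\<phi> j) (\<phi> k) (\<phi> l) (\<phi> p) (\<phi> q))) = 20 * sum6 V f"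
  unfolding sum_splits_def by (simp add: sum.distrib sum_placements)

lemma sum_sum_pairings:
  "(\<Sum>\<phi>\<in>UNIV \<rightarrow>\<^sub>E V. sum_pairings (\<lambda>i j k l p q. f (\<phi> i) (\<phi> j) (\<phi> k) (\<phi> l) (\<phi> p) (\<phi> q))) = 15 * sum6 V f"
  unfolding sum_pairings_def by (simp add: sum.distrib sum_placements)

context hom_free
begin

lemma sum_certificate_le:
  assumes "finite V"
  shows "20 * sum6 V (flag_term E) + 60 * sum6 V (pair_square E) \<le> - 28800 * int (card V) ^ 6"
    and "sum6 V (slope_term E) \<le> 0"
proof -
  have certified: "certificate (pullback E \<phi>) \<le> - 28800" "slope (pullback E \<phi>) \<le> 0" for \<phi> :: "point \<Rightarrow> 'a"
    using certified_hom_free[OF hom_free_pullback[OF hom_free_axioms, of \<phi>]] by (simp_all add: certified_def)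
  have "(\<Sum>\<phi>\<in>UNIV \<rightarrow>\<^sub>E V. certificate (pullback E \<phi>)) \<le> (\<Sum>\<phi>\<in>(UNIV :: point set) \<rightarrow>\<^sub>E V. - 28800)"
    by (intro sum_mono certified)
  also have "\<dots> = - 28800 * int (card V) ^ 6"
    by (simp add: card_PiE card_UNIV_point)
  also have "(\<Sum>\<phi>\<in>UNIV \<rightarrow>\<^sub>E V. certificate (pullback E \<phi>)) = 20 * sum6 V (flag_term E) + 60 * sum6 V (pair_square E)"
    unfolding certificate_def flag_term_pullback[abs_def] pair_square_pullback[abs_def]
    by (simp add: sum.distrib sum_distrib_left[symmetric] sum_sum_splits sum_sum_pairings)
  finally show "20 * sum6 V (flag_term E) + 60 * sum6 V (pair_square E) \<le> - 28800 * int (card V) ^ 6" .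
  have "(\<Sum>\<phi>\<in>UNIV \<rightarrow>\<^sub>E V. slope (pullback E \<phi>)) \<le> 0"
    by (intro sum_nonpos certified)
  then show "sum6 V (slope_term E) \<le> 0"
    unfolding slope_def flag_term_pullback[abs_def] by (simp add: sum_sum_splits)
qed

end

lemma sum_rotations_nonneg:
  fixes h :: "'a \<Rightarrow> 'a \<Rightarrow> 'a \<Rightarrow> int"
  assumes "\<And>x. 0 \<le> (\<Sum>y\<in>A. \<Sum>z\<in>A. h x y z)"
  shows "0 \<le> (\<Sum>x\<in>A. \<Sum>y\<in>A. \<Sum>z\<in>A. h x y z + h y x z + h z x y)"
proof -
  have "0 \<le> (\<Sum>x\<in>A. \<Sum>y\<in>A. \<Sum>z\<in>A. h x y z)"
    by (intro sum_nonneg[of A "\<lambda>x. \<Sum>y\<in>A. \<Sum>z\<in>A. h x y z"] assms)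
  moreover have "(\<Sum>x\<in>A. \<Sum>y\<in>A. \<Sum>z\<in>A. h y x z) = (\<Sum>y\<in>A. \<Sum>x\<in>A. \<Sum>z\<in>A. h y x z)"
    by (rule sum.swap)
  moreover have "(\<Sum>x\<in>A. \<Sum>y\<in>A. \<Sum>z\<in>A. h z x y) = (\<Sum>z\<in>A. \<Sum>x\<in>A. \<Sum>y\<in>A. h z x y)"
  proof -
    have "(\<Sum>x\<in>A. \<Sum>y\<in>A. \<Sum>z\<in>A. h z x y) = (\<Sum>x\<in>A. \<Sum>z\<in>A. \<Sum>y\<in>A. h z x y)"
      by (intro sum.cong refl sum.swap)
    also have "\<dots> = (\<Sum>z\<in>A. \<Sum>x\<in>A. \<Sum>y\<in>A. h z x y)"
      by (rule sum.swap)
    finally show ?thesis .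
  qed
  ultimately show ?thesis
    by (simp only: sum.distrib)
qed

lemma sum_product_form: "(\<Sum>p\<in>A. \<Sum>q\<in>A. c * f p * f q) = c * (sum f A)\<^sup>2" for c :: int
  by (simp only: power2_eq_square mult.assoc sum_product) (simp only: sum_distrib_left)

lemma sum_pair_form_nonneg: "0 \<le> (\<Sum>x\<in>A. \<Sum>y\<in>A. pair_form (f x) (f y))"
proof -
  have "(\<Sum>x\<in>A. \<Sum>y\<in>A. pair_form (f x) (f y)) = 194 * (\<Sum>x\<in>A. weight_d (f x))\<^sup>2 + 481 * (\<Sum>x\<in>A. weight_e (f x))\<^sup>2"
    by (simp only: pair_form_def sum.distrib sum_product_form)
  then show ?thesis by simp
qed

lemma sum_pair_square_nonneg: "0 \<le> sum6 V (pair_square E)"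
proof -
  let ?h = "\<lambda>(a, b) (c, d) (e, f). pair_form (pair_flag_of E a b c d) (pair_flag_of E a b e f)"
  have "0 \<le> (\<Sum>x\<in>V \<times> V. \<Sum>y\<in>V \<times> V. \<Sum>z\<in>V \<times> V. ?h x y z + ?h y x z + ?h z x y)"
  proof (rule sum_rotations_nonneg)
    show "0 \<le> (\<Sum>y\<in>V \<times> V. \<Sum>z\<in>V \<times> V. ?h x y z)" for x
      using sum_pair_form_nonneg[where A = "V \<times> V" and f = "\<lambda>(c, d). pair_flag_of E (fst x) (snd x) c d"]
      by (simp add: split_def)
  qed
  also have "\<dots> = sum6 V (pair_square E)"
    by (simp add: pair_square_def sum.cartesian_product')
  finally show ?thesis .
qed

lemma sum_difference_form_nonneg: "0 \<le> (\<Sum>p\<in>A. \<Sum>q\<in>A. difference_form w (f p) (f q))"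
proof -
  let ?a = "\<lambda>p. w (fst (f p))" and ?b = "\<lambda>p. w (fst (snd (f p)))" and ?c = "\<lambda>p. w (snd (snd (f p)))"
  have "difference_form w x y = (w (fst x) - w (fst (snd x))) * (w (fst y) - w (fst (snd y)))
      + (w (fst x) - w (snd (snd x))) * (w (fst y) - w (snd (snd y)))
      + (w (fst (snd x)) - w (snd (snd x))) * (w (fst (snd y)) - w (snd (snd y)))" for x y
    by (cases x; cases y) simp
  then have "(\<Sum>p\<in>A. \<Sum>q\<in>A. difference_form w (f p) (f q))
    = (\<Sum>p\<in>A. ?a p - ?b p)\<^sup>2 + (\<Sum>p\<in>A. ?a p - ?c p)\<^sup>2 + (\<Sum>p\<in>A. ?b p - ?c p)\<^sup>2"
    by (simp only: sum.distrib sum_product[symmetric] power2_eq_square)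
  then show ?thesis by simp
qed

lemma sum_edge_square_nonneg: "0 \<le> (\<Sum>p\<in>V. \<Sum>q\<in>V. edge_square E i j k l p q)"
proof (cases "twin E i j k l = None")
  case True
  let ?x = "attachment E i j k l"
  have "(\<Sum>p\<in>V. \<Sum>q\<in>V. edge_square E i j k l p q) =
      149 * (\<Sum>p\<in>V. \<Sum>q\<in>V. difference_form weight_a (edge_flags (?x p)) (edge_flags (?x q)))
    + 1129 * (\<Sum>p\<in>V. \<Sum>q\<in>V. difference_form weight_b (edge_flags (?x p)) (edge_flags (?x q)))
    + 579 * (\<Sum>p\<in>V. \<Sum>q\<in>V. difference_form weight_c (edge_flags (?x p)) (edge_flags (?x q)))
    + 1137 * (\<Sum>p\<in>V. orbit_weight (?x p))\<^sup>2"
    by (simp only: edge_square_def True simp_thms if_True edge_form_def standard_form_def sum.distrib sum_product_form)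
      (simp only: sum_distrib_left)
  also have "\<dots> \<ge> 0"
    by (intro add_nonneg_nonneg mult_nonneg_nonneg sum_difference_form_nonneg) simp_all
  finally show ?thesis .
qed (simp only: edge_square_def if_False sum.neutral_const order_refl)

section \<open>The objective\<close>

definition imbalance :: "real \<Rightarrow> real \<Rightarrow> real \<Rightarrow> real" where
  "imbalance a b c = (a + b + c) ^ 3 - 27 * a * b * c"

definition objective_at :: "real \<Rightarrow> 'v option \<Rightarrow> 'v option \<Rightarrow> 'v option \<Rightarrow> bool \<Rightarrow> real" where
  "objective_at d a b c e = real_of_int (objective a b c e) + 16200000 * ((d - 1/4) * of_bool (monochromatic a b c))"

definition flag_term_at :: "real \<Rightarrow> ('v \<Rightarrow> 'v \<Rightarrow> 'v \<Rightarrow> bool) \<Rightarrow> 'v \<Rightarrow> 'v \<Rightarrow> 'v \<Rightarrow> 'v \<Rightarrow> 'v \<Rightarrow> 'v \<Rightarrow> real" where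
  "flag_term_at d E i j k l p q = real_of_int (flag_term E i j k l p q) + (d - 1/4) * real_of_int (slope_term E i j k l p q)"

lemma real_deviation: "real_of_int (deviation b) = 4 * of_bool b - 1"
  by (simp add: deviation_def)

lemma flag_term_at_eq:
  "flag_term_at d E i j k l p q =
     of_bool (E i j k) * (objective_at d (twin E i j k l) (twin E i j k p) (twin E i j k q) (E l p q)
       + 3 * real_of_int (edge_square E i j k l p q + edge_square E i j k p l q + edge_square E i j k q l p)
       + 12564000 * (d - of_bool (E l p q)))
     + 15138000 * (of_bool (E i j k) - d)
     + 32670000 * (real_of_int (overlaps E i j k l p q) * (d - of_bool (E l p q)))"
  by (cases "E i j k") (simp_all add: flag_term_at_def flag_term_def slope_term_def objective_at_def real_deviation
      algebra_simps)

lemma objective_at_eq: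
  "objective_at d a b c e = 20250000 * of_bool (transversal a b c \<and> \<not> e) - 18225000 * of_bool (transversal a b c)
     + 4050000 * (of_bool (a \<noteq> None) * of_bool (b \<noteq> None) * of_bool (c \<noteq> None))
     + 16200000 * (d * of_bool (monochromatic a b c) - of_bool (monochromatic a b c \<and> e))
     + 1500 * (real_of_int (uncovered_weight a) * real_of_int (covered_weight b) * real_of_int (covered_weight c)
         + real_of_int (covered_weight a) * real_of_int (uncovered_weight b) * real_of_int (covered_weight c)
         + real_of_int (covered_weight a) * real_of_int (covered_weight b) * real_of_int (uncovered_weight c))"
  by (simp add: objective_at_def objective_def real_deviation algebra_simps)

lemma of_bool_transversal:
  fixes i j k :: 'v
  assumes "i \<noteq> j" "i \<noteq> k" "j \<noteq> k" and "a \<in> {None, Some i, Some j, Some k}" "b \<in> {None, Some i, Some j, Some k}"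
    "c \<in> {None, Some i, Some j, Some k}"
  shows "of_bool (transversal a b c) =
      of_bool (a = Some i \<and> b = Some j \<and> c = Some k) + of_bool (a = Some i \<and> b = Some k \<and> c = Some j)
    + of_bool (a = Some j \<and> b = Some i \<and> c = Some k) + of_bool (a = Some j \<and> b = Some k \<and> c = Some i)
    + of_bool (a = Some k \<and> b = Some i \<and> c = Some j) + (of_bool (a = Some k \<and> b = Some j \<and> c = Some i) :: real)"
  using assms(4-6) by (elim insertE emptyE) (simp_all add: transversal_def assms(1-3) assms(1-3)[symmetric])

lemma of_bool_monochromatic:
  fixes i j k :: 'v
  assumes "i \<noteq> j" "i \<noteq> k" "j \<noteq> k" and "a \<in> {None, Some i, Some j, Some k}" "b \<in> {None, Some i, Some j, Some k}"
    "c \<in> {None, Some i, Some j, Some k}"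
  shows "of_bool (monochromatic a b c) =
      of_bool (a = Some i \<and> b = Some i \<and> c = Some i) + of_bool (a = Some j \<and> b = Some j \<and> c = Some j)
    + (of_bool (a = Some k \<and> b = Some k \<and> c = Some k) :: real)"
  using assms(4-6) by (elim insertE emptyE) (simp_all add: monochromatic_def assms(1-3) assms(1-3)[symmetric])

locale coloured_set =
  fixes V :: "'a set" and colour :: "'a \<Rightarrow> 'v option" and i j k :: 'v
  assumes finite_V: "finite V" and distinct_colours: "i \<noteq> j" "i \<noteq> k" "j \<noteq> k"
    and colour: "colour p \<in> {None, Some i, Some j, Some k}"
begin

definition colour_class :: "'v option \<Rightarrow> 'a set" where
  "colour_class c = V \<inter> {p. colour p = c}"

abbreviation size :: "'v option \<Rightarrow> real" where
  "size c \<equiv> real (card (colour_class c))"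

abbreviation covered :: real where
  "covered \<equiv> size (Some i) + size (Some j) + size (Some k)"

lemma sum_by_colour:
  fixes f :: "'v option \<Rightarrow> real"
  shows "(\<Sum>p\<in>V. f (colour p)) = f None * size None + f (Some i) * size (Some i) + f (Some j) * size (Some j)
      + f (Some k) * size (Some k)"
proof -
  have "f (colour p) = of_bool (colour p = None) * f None + of_bool (colour p = Some i) * f (Some i)
      + of_bool (colour p = Some j) * f (Some j) + of_bool (colour p = Some k) * f (Some k)" for p
    using colour[of p] distinct_colours by auto
  then show ?thesis
    by (simp add: sum.distrib sum_of_bool_mult_eq[OF finite_V] colour_class_def)
qed

lemma sum_colours_edges:
  "(\<Sum>l\<in>V. \<Sum>p\<in>V. \<Sum>q\<in>V. of_bool (colour l = a \<and> colour p = b \<and> colour q = c) * of_bool (R l p q))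
     = edges R (colour_class a) (colour_class b) (colour_class c)"
proof -
  have "(\<Sum>l\<in>V. \<Sum>p\<in>V. \<Sum>q\<in>V. of_bool (colour l = a \<and> colour p = b \<and> colour q = c) * of_bool (R l p q))
      = (\<Sum>l\<in>V. of_bool (colour l = a)
          * (\<Sum>p\<in>V. of_bool (colour p = b) * (\<Sum>q\<in>V. of_bool (colour q = c) * of_bool (R l p q) :: real)))"
    by (simp add: sum_distrib_left of_bool_conj mult.assoc)
  then show ?thesis
    by (simp only: sum_of_bool_mult_eq[OF finite_V] edges_eq_sum colour_class_def)
qed

lemma sum_transversal:
  assumes "\<And>x y z. R x y z = R y x z" "\<And>x y z. R x y z = R x z y"
  shows "(\<Sum>l\<in>V. \<Sum>p\<in>V. \<Sum>q\<in>V. of_bool (transversal (colour l) (colour p) (colour q) \<and> R l p q))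
     = 6 * edges R (colour_class (Some i)) (colour_class (Some j)) (colour_class (Some k))"
proof -
  let ?I = "colour_class (Some i)" and ?J = "colour_class (Some j)" and ?K = "colour_class (Some k)"
  have permuted: "edges R ?I ?K ?J = edges R ?I ?J ?K" "edges R ?J ?I ?K = edges R ?I ?J ?K"
      "edges R ?J ?K ?I = edges R ?I ?J ?K"
      "edges R ?K ?I ?J = edges R ?I ?J ?K" "edges R ?K ?J ?I = edges R ?I ?J ?K"
    using edges_left_commute_if[of R, OF assms(1)] edges_right_commute_if[of R, OF assms(2)] by metis+
  have "of_bool (transversal (colour l) (colour p) (colour q)) =
      of_bool (colour l = Some i \<and> colour p = Some j \<and> colour q = Some k)
          + of_bool (colour l = Some i \<and> colour p = Some k \<and> colour q = Some j)
    + of_bool (colour l = Some j \<and> colour p = Some i \<and> colour q = Some k)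
        + of_bool (colour l = Some j \<and> colour p = Some k \<and> colour q = Some i)
    + of_bool (colour l = Some k \<and> colour p = Some i \<and> colour q = Some j)
        + (of_bool (colour l = Some k \<and> colour p = Some j \<and> colour q = Some i) :: real)"
    for l p q
    by (intro of_bool_transversal distinct_colours colour)
  then show ?thesis
    by (simp add: of_bool_conj distrib_right sum.distrib sum_colours_edges[unfolded of_bool_conj] permuted)
qed

lemma sum_monochromatic:
  "(\<Sum>l\<in>V. \<Sum>p\<in>V. \<Sum>q\<in>V. of_bool (monochromatic (colour l) (colour p) (colour q) \<and> R l p q))
     = nedge R (colour_class (Some i)) + nedge R (colour_class (Some j)) + nedge R (colour_class (Some k))"
proof -
  have "of_bool (monochromatic (colour l) (colour p) (colour q)) =
      of_bool (colour l = Some i \<and> colour p = Some i \<and> colour q = Some i)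
          + of_bool (colour l = Some j \<and> colour p = Some j \<and> colour q = Some j)
    + (of_bool (colour l = Some k \<and> colour p = Some k \<and> colour q = Some k) :: real)" for l p q
    by (intro of_bool_monochromatic distinct_colours colour)
  then show ?thesis
    by (simp add: of_bool_conj distrib_right sum.distrib sum_colours_edges[unfolded of_bool_conj])
qed

lemma sum_objective_at:
  assumes "ternary_graph E"
  defines "W \<equiv> \<lambda>c. colour_class (Some c)"
  shows "(\<Sum>l\<in>V. \<Sum>p\<in>V. \<Sum>q\<in>V. objective_at d (colour l) (colour p) (colour q) (E l p q))
     = 4500 * (27000 * miss E (W i) (W j) (W k) + 900 * imbalance (size (Some i)) (size (Some j)) (size (Some k))
       + 3600 * (\<Sum>c\<in>{i, j, k}. d * size (Some c) ^ 3 - nedge E (W c))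
       + (49 * size None - covered) * (3 * covered - size None)\<^sup>2)"
proof -
  interpret ternary_graph E by (rule assms)
  let ?u = "\<lambda>p. real_of_int (uncovered_weight (colour p))" and ?c = "\<lambda>p. real_of_int (covered_weight (colour p))"
  have complement: "\<And>x y z. (\<not> E x y z) = (\<not> E y x z)" "\<And>x y z. (\<not> E x y z) = (\<not> E x z y)"
    by (simp_all only: left_commute, simp_all only: right_commute)
  have missing: "(\<Sum>l\<in>V. \<Sum>p\<in>V. \<Sum>q\<in>V. of_bool (transversal (colour l) (colour p) (colour q) \<and> \<not> E l p q))
      = 6 * miss E (W i) (W j) (W k)"
    unfolding W_def by (intro sum_transversal complement)
  have all: "(\<Sum>l\<in>V. \<Sum>p\<in>V. \<Sum>q\<in>V. of_bool (transversal (colour l) (colour p) (colour q)))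
      = 6 * (size (Some i) * size (Some j) * size (Some k))"
    using sum_transversal[of "\<lambda>_ _ _. True"] by (simp add: edges_eq_sum mult.assoc)
  have cubes: "(\<Sum>l\<in>V. \<Sum>p\<in>V. \<Sum>q\<in>V. of_bool (monochromatic (colour l) (colour p) (colour q)))
      = size (Some i) ^ 3 + size (Some j) ^ 3 + size (Some k) ^ 3"
    using sum_monochromatic[of "\<lambda>_ _ _. True"] by (simp add: edges_eq_sum power3_eq_cube mult.assoc)
  have u: "sum ?u V = 49 * size None - covered" and c: "sum ?c V = 3 * covered - size None"
    and covered: "(\<Sum>p\<in>V. of_bool (colour p \<noteq> None)) = covered"
    using sum_by_colour[of "\<lambda>c. real_of_int (uncovered_weight c)"] sum_by_colour[of "\<lambda>c. real_of_int (covered_weight c)"]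
      sum_by_colour[of "\<lambda>c. of_bool (c \<noteq> None)"]
    by (simp_all add: uncovered_weight_def covered_weight_def)
  have "(\<Sum>l\<in>V. \<Sum>p\<in>V. \<Sum>q\<in>V. objective_at d (colour l) (colour p) (colour q) (E l p q))
      = 20250000 * (6 * miss E (W i) (W j) (W k)) - 18225000 * (6 * (size (Some i) * size (Some j) * size (Some k)))
        + 4050000 * (covered * covered * covered)
        + 16200000 * (d * (size (Some i) ^ 3 + size (Some j) ^ 3 + size (Some k) ^ 3) - (nedge E (W i) + nedge E (W j)
          + nedge E (W k)))
        + 1500 * ((49 * size None - covered) * (3 * covered - size None) * (3 * covered - size None)
          + (3 * covered - size None) * (49 * size None - covered) * (3 * covered - size None)
          + (3 * covered - size None) * (3 * covered - size None) * (49 * size None - covered))"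
    by (simp only: objective_at_eq sum.distrib sum_subtractf sum_distrib_left[symmetric] sum_distrib_right[symmetric]
        missing all cubes sum_monochromatic u c covered W_def)
  also have "\<dots> = 4500 * (27000 * miss E (W i) (W j) (W k) + 900 * imbalance (size (Some i)) (size (Some j)) (size (Some k))
       + 3600 * (\<Sum>c\<in>{i, j, k}. d * size (Some c) ^ 3 - nedge E (W c))
       + (49 * size None - covered) * (3 * covered - size None)\<^sup>2)"
    using distinct_colours by (simp add: imbalance_def power2_eq_square power3_eq_cube algebra_simps)
  finally show ?thesis .
qed

end

section \<open>A core edge\<close>

lemma (in hom_free) coloured_set_twin:
  assumes "finite V" "E i j k"
  shows "coloured_set V (twin E i j k) i j k"
  using assms(2) by unfold_locales (auto simp: assms(1) twin_def)

locale host = hom_free E for E :: "'a \<Rightarrow> 'a \<Rightarrow> 'a \<Rightarrow> bool" +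
  fixes V :: "'a set"
  assumes finite_V: "finite V" and V_nonempty: "V \<noteq> {}"
begin

abbreviation n :: real where
  "n \<equiv> real (card V)"

lemma n_pos: "0 < n"
  using finite_V V_nonempty by (simp add: card_gt_0_iff)

lemma sum_deviation: "(\<Sum>l\<in>W. \<Sum>p\<in>W. \<Sum>q\<in>W. extremal_density - of_bool (E l p q)) = deficit E W"
  by (simp add: deficit_def edges_eq_sum sum_subtractf power3_eq_cube)

lemma sum_in_both_links:
  "(\<Sum>l\<in>V. \<Sum>p\<in>V. \<Sum>q\<in>V. of_bool (in_both_links E x y z l p q) * (extremal_density - of_bool (E l p q)))
    = deficit E (V \<inter> {p. E x y p \<and> E y z p})"
proof -
  have "(\<Sum>l\<in>V. \<Sum>p\<in>V. \<Sum>q\<in>V. of_bool (in_both_links E x y z l p q) * (extremal_density - of_bool (E l p q)))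
      = (\<Sum>l\<in>V. of_bool (E x y l \<and> E y z l) * (\<Sum>p\<in>V. of_bool (E x y p \<and> E y z p)
          * (\<Sum>q\<in>V. of_bool (E x y q \<and> E y z q) * (extremal_density - of_bool (E l p q)))))"
    by (simp add: in_both_links_def of_bool_conj sum_distrib_left mult_ac)
  then show ?thesis
    by (simp only: sum_of_bool_mult_eq[OF finite_V] sum_deviation)
qed

lemma sum_overlaps_nonneg:
  "0 \<le> (\<Sum>l\<in>V. \<Sum>p\<in>V. \<Sum>q\<in>V. real_of_int (overlaps E i j k l p q) * (extremal_density - of_bool (E l p q)))"
proof -
  have "0 \<le> deficit E (V \<inter> {p. E x y p \<and> E y z p})" for x y z
    using finite_V by (intro deficit_nonneg) simp
  then show ?thesis
    by (simp add: overlaps_def distrib_right sum.distrib sum_in_both_links)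
qed

lemma sum_edge_squares_nonneg:
  "0 \<le> (\<Sum>l\<in>V. \<Sum>p\<in>V. \<Sum>q\<in>V. real_of_int (edge_square E i j k l p q + edge_square E i j k p l q + edge_square E i j k q l p))"
proof -
  have "0 \<le> (\<Sum>l\<in>V. \<Sum>p\<in>V. \<Sum>q\<in>V. edge_square E i j k l p q + edge_square E i j k p l q + edge_square E i j k q l p)"
    by (intro sum_rotations_nonneg sum_edge_square_nonneg)
  then show ?thesis
    by (simp only: of_int_sum[symmetric] of_int_0_le_iff)
qed

abbreviation objective_sum :: "'a \<Rightarrow> 'a \<Rightarrow> 'a \<Rightarrow> real" where
  "objective_sum i j k \<equiv>
    (\<Sum>l\<in>V. \<Sum>p\<in>V. \<Sum>q\<in>V. objective_at extremal_density (twin E i j k l) (twin E i j k p) (twin E i j k q) (E l p q))"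

lemma objective_sum_le_sum_flag_term_at:
  "of_bool (E i j k) * objective_sum i j k + 15138000 * (n ^ 3 * (of_bool (E i j k) - extremal_density))
     \<le> (\<Sum>l\<in>V. \<Sum>p\<in>V. \<Sum>q\<in>V. flag_term_at extremal_density E i j k l p q)"
proof -
  let ?squares = "\<Sum>l\<in>V. \<Sum>p\<in>V. \<Sum>q\<in>V. real_of_int
      (edge_square E i j k l p q + edge_square E i j k p l q + edge_square E i j k q l p)"
  let ?overlaps = "\<Sum>l\<in>V. \<Sum>p\<in>V. \<Sum>q\<in>V. real_of_int (overlaps E i j k l p q) * (extremal_density - of_bool (E l p q))"
  have "(\<Sum>l\<in>V. \<Sum>p\<in>V. \<Sum>q\<in>V. flag_term_at extremal_density E i j k l p q) =
      of_bool (E i j k) * (objective_sum i j k + 3 * ?squares + 12564000 * deficit E V)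
      + n * (n * (n * (15138000 * (of_bool (E i j k) - extremal_density)))) + 32670000 * ?overlaps"
    by (simp only: flag_term_at_eq sum.distrib sum_distrib_left[symmetric] sum_deviation sum_constant)
  moreover have "0 \<le> of_bool (E i j k) * (3 * ?squares + 12564000 * deficit E V)"
    using sum_edge_squares_nonneg deficit_nonneg[OF finite_V] by simp
  ultimately show ?thesis
    using sum_overlaps_nonneg[of i j k] by (simp add: power3_eq_cube algebra_simps)
qed

lemma sum_flag_term_at_le:
  assumes "1/4 \<le> extremal_density"
  shows "sum6 V (flag_term_at extremal_density E) \<le> - 1440 * n ^ 6"
proof -
  have "20 * sum6 V (flag_term E) \<le> - 28800 * int (card V) ^ 6"
    using sum_certificate_le(1)[OF finite_V] sum_pair_square_nonneg[where V = V and E = E] by linarith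
  then have "20 * real_of_int (sum6 V (flag_term E)) \<le> - 28800 * n ^ 6"
    by (simp only: of_int_le_iff[symmetric, where 'a = real]) simp
  moreover have "(extremal_density - 1/4) * real_of_int (sum6 V (slope_term E)) \<le> 0"
    using assms sum_certificate_le(2)[OF finite_V]
    by (intro mult_nonneg_nonpos) (simp_all only: of_int_le_0_iff diff_ge_0_iff_ge)
  moreover have "sum6 V (flag_term_at extremal_density E)
      = real_of_int (sum6 V (flag_term E)) + (extremal_density - 1/4) * real_of_int (sum6 V (slope_term E))"
    by (simp only: flag_term_at_def sum.distrib sum_distrib_left[symmetric] of_int_sum)
  ultimately show ?thesis
    by linarith
qed

lemma ex_edge_objective_sum_neg:
  assumes "1/4 \<le> extremal_density" and deficit: "deficit E V \<le> n ^ 3 / 20000"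
  shows "\<exists>i\<in>V. \<exists>j\<in>V. \<exists>k\<in>V. E i j k \<and> objective_sum i j k < 0"
proof (rule ccontr)
  assume "\<not> ?thesis"
  then have "0 \<le> objective_sum i j k" if "i \<in> V" "j \<in> V" "k \<in> V" "E i j k" for i j k
    using that by (blast intro: leI)
  then have "0 \<le> (\<Sum>i\<in>V. \<Sum>j\<in>V. \<Sum>k\<in>V. of_bool (E i j k) * objective_sum i j k)"
    by (intro sum_nonneg) simp
  moreover have "(\<Sum>i\<in>V. \<Sum>j\<in>V. \<Sum>k\<in>V. of_bool (E i j k) * objective_sum i j k
      + 15138000 * (n ^ 3 * (of_bool (E i j k) - extremal_density)))
      \<le> sum6 V (flag_term_at extremal_density E)"
    by (intro sum_mono objective_sum_le_sum_flag_term_at)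
  moreover have "(\<Sum>i\<in>V. \<Sum>j\<in>V. \<Sum>k\<in>V. 15138000 * (n ^ 3 * (of_bool (E i j k) - extremal_density)))
      = - 15138000 * (n ^ 3 * deficit E V)"
  proof -
    have "15138000 * (n ^ 3 * (of_bool (E i j k) - extremal_density))
        = - 15138000 * n ^ 3 * (extremal_density - of_bool (E i j k))" for i j k
      by (simp add: algebra_simps)
    then show ?thesis
      by (simp only: sum_distrib_left[symmetric] sum_deviation)
  qed
  ultimately have "1440 * n ^ 6 \<le> 15138000 * (n ^ 3 * deficit E V)"
    using sum_flag_term_at_le[OF assms(1)] unfolding sum.distrib by linarith
  moreover have "n ^ 3 * deficit E V \<le> n ^ 3 * (n ^ 3 / 20000)"
    using deficit by (intro mult_left_mono) simp_all
  moreover have "n ^ 3 * (n ^ 3 / 20000) = n ^ 6 / 20000" "0 < n ^ 6"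
    using n_pos by (simp_all add: power_add[symmetric])
  ultimately show False
    by linarith
qed

definition share :: "'a set \<Rightarrow> real" where
  "share X = real (card X) / n"

definition link_density :: "'a \<Rightarrow> 'a set \<Rightarrow> 'a set \<Rightarrow> real" where
  "link_density u X Y = link E u X Y / n ^ 2"

definition edge_density :: "'a set \<Rightarrow> 'a set \<Rightarrow> 'a set \<Rightarrow> real" where
  "edge_density X Y Z = edges E X Y Z / n ^ 3"

definition miss_density :: "'a set \<Rightarrow> 'a set \<Rightarrow> 'a set \<Rightarrow> real" where
  "miss_density X Y Z = miss E X Y Z / n ^ 3"

definition deficit_density :: "'a set \<Rightarrow> real" where
  "deficit_density X = deficit E X / n ^ 3"

lemma densities_nonneg:
  "0 \<le> share X" "0 \<le> link_density u X Y" "0 \<le> edge_density X Y Z" "0 \<le> miss_density X Y Z" "finite X \<Longrightarrow> 0 \<le> deficit_density X"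
  unfolding share_def link_density_def edge_density_def miss_density_def deficit_density_def
  by (simp_all add: link_nonneg edges_nonneg deficit_nonneg)

lemma objective_sum_eq:
  assumes "E i j k"
  defines "W \<equiv> \<lambda>c. coloured_set.colour_class V (twin E i j k) c"
  defines "s \<equiv> share (W (Some i)) + share (W (Some j)) + share (W (Some k))"
  shows "objective_sum i j k = 4500 * n ^ 3 * (27000 * miss_density (W (Some i)) (W (Some j)) (W (Some k))
       + 900 * imbalance (share (W (Some i))) (share (W (Some j))) (share (W (Some k)))
       + 3600 * (deficit_density (W (Some i)) + deficit_density (W (Some j)) + deficit_density (W (Some k)))
       + (49 * share (W None) - s) * (3 * s - share (W None))\<^sup>2)"
proof -
  interpret coloured_set V "twin E i j k" i j k
    by (rule coloured_set_twin[OF finite_V assms(1)])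
  have unnormalise: "real (card (W c)) = n * share (W c)" "miss E X Y Z = n ^ 3 * miss_density X Y Z"
      "deficit E X = n ^ 3 * deficit_density X" for c X Y Z
    using n_pos by (simp_all add: share_def miss_density_def deficit_density_def)
  have "objective_sum i j k = 4500 * (27000 * miss E (W (Some i)) (W (Some j)) (W (Some k))
       + 900 * imbalance (real (card (W (Some i)))) (real (card (W (Some j)))) (real (card (W (Some k))))
       + 3600 * (deficit E (W (Some i)) + deficit E (W (Some j)) + deficit E (W (Some k)))
       + (49 * real (card (W None)) - (real (card (W (Some i))) + real (card (W (Some j))) + real (card (W (Some k)))))
         * (3 * (real (card (W (Some i))) + real (card (W (Some j))) + real (card (W (Some k)))) - real (card (W None)))\<^sup>2)"
    using sum_objective_at[OF ternary_graph_axioms, of extremal_density] distinct_colours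
    by (simp add: W_def deficit_def add.assoc)
  then show ?thesis
    by (simp only: unnormalise s_def) (simp add: imbalance_def power2_eq_square power3_eq_cube algebra_simps)
qed

end

section \<open>Nearly balanced weights\<close>

lemma imbalance_commute:
  "imbalance b a c = imbalance a b c" "imbalance a c b = imbalance a b c"
  by (simp_all add: imbalance_def algebra_simps)

lemma sum_cubes_le:
  fixes a b c :: real
  assumes "0 \<le> a" "0 \<le> b" "0 \<le> c"
  shows "a ^ 3 + b ^ 3 + c ^ 3 + 24 * (a * b * c) \<le> (a + b + c) ^ 3"
proof -
  have "0 \<le> a * (b - c)\<^sup>2 + b * (a - c)\<^sup>2 + c * (a - b)\<^sup>2"
    using assms by simp
  then show ?thesis
    by (simp add: power2_eq_square power3_eq_cube algebra_simps)
qed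

lemma imbalance_ge:
  fixes a b c :: real
  assumes "0 \<le> a"
  defines "s \<equiv> a + b + c"
  shows "27 / 4 * ((s / 3 - a)\<^sup>2 * (s + (s / 3 - a))) \<le> imbalance a b c"
proof -
  have "4 * (b * c) \<le> (s - a)\<^sup>2"
    using zero_le_power2[of "b - c"] by (simp add: s_def power2_eq_square algebra_simps)
  then have "a * (4 * (b * c)) \<le> a * (s - a)\<^sup>2"
    using assms(1) by (rule mult_left_mono)
  then have "s ^ 3 - 27 / 4 * (a * (s - a)\<^sup>2) \<le> imbalance a b c"
    by (simp add: imbalance_def s_def mult_ac)
  moreover have "s ^ 3 - 27 / 4 * (a * (s - a)\<^sup>2) = 27 / 4 * ((s / 3 - a)\<^sup>2 * (s + (s / 3 - a)))"
    by (simp add: power2_eq_square power3_eq_cube field_simps)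
  ultimately show ?thesis
    by simp
qed

lemma imbalance_nonneg:
  assumes "0 \<le> a" "0 \<le> b" "0 \<le> c"
  shows "0 \<le> imbalance a b c"
proof -
  have "0 \<le> 27 / 4 * (((a + b + c) / 3 - a)\<^sup>2 * ((a + b + c) + ((a + b + c) / 3 - a)))"
    using assms by (intro mult_nonneg_nonneg) auto
  then show ?thesis
    using imbalance_ge[OF assms(1), of b c] by linarith
qed

definition near_balanced :: "real \<Rightarrow> real \<Rightarrow> real \<Rightarrow> bool" where
  "near_balanced a b c \<longleftrightarrow> 0 \<le> a \<and> 0 \<le> b \<and> 0 \<le> c \<and> 49/50 \<le> a + b + c \<and> a + b + c \<le> 1 \<and> imbalance a b c \<le> 1/100"

lemma near_balanced_commute: "near_balanced b a c = near_balanced a b c" "near_balanced a c b = near_balanced a b c"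
  by (auto simp: near_balanced_def imbalance_commute add_ac)

lemma abs_le_of_square_le: "x\<^sup>2 \<le> r\<^sup>2 \<Longrightarrow> 0 \<le> r \<Longrightarrow> \<bar>x\<bar> \<le> r" for x r :: real
  by (rule power2_le_imp_le) simp_all

text \<open>A first crude bound on \<open>\<bar>x\<bar>\<close> improves the factor \<open>s + x\<close> in \<open>imbalance_ge\<close>.\<close>

lemma near_balanced_deviation:
  assumes "near_balanced a b c"
  shows "6 * ((a + b + c) / 3 - a)\<^sup>2 \<le> imbalance a b c" "\<bar>(a + b + c) / 3 - a\<bar> \<le> 2017/50000"
proof -
  define s where "s = a + b + c"
  define x where "x = s / 3 - a"
  have s: "49/50 \<le> s" "s \<le> 1" and nonneg: "0 \<le> a" "a \<le> s" and im: "imbalance a b c \<le> 1/100"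
    using assms by (auto simp: near_balanced_def s_def)
  have ge: "27 / 4 * (x\<^sup>2 * (s + x)) \<le> imbalance a b c"
    unfolding x_def s_def using nonneg(1) by (rule imbalance_ge)
  have "x\<^sup>2 * (49/150) \<le> x\<^sup>2 * (s + x)"
    using s nonneg by (intro mult_left_mono) (auto simp: x_def)
  then have "x\<^sup>2 \<le> (674 / 10000)\<^sup>2"
    using ge im by (simp add: power2_eq_square)
  then have "\<bar>x\<bar> \<le> 674 / 10000"
    by (rule abs_le_of_square_le) simp
  then have "x\<^sup>2 * (9126 / 10000) \<le> x\<^sup>2 * (s + x)"
    using s by (intro mult_left_mono) auto
  then have "615/100 * x\<^sup>2 \<le> imbalance a b c"
    using ge zero_le_power2[of x] by linarith
  then have "x\<^sup>2 \<le> (2017/50000)\<^sup>2" and six: "6 * x\<^sup>2 \<le> imbalance a b c"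
    using im zero_le_power2[of x] by (simp add: power2_eq_square, linarith)
  from this(1) have "\<bar>x\<bar> \<le> 2017/50000"
    by (rule abs_le_of_square_le) simp
  with six show "6 * ((a + b + c) / 3 - a)\<^sup>2 \<le> imbalance a b c" "\<bar>(a + b + c) / 3 - a\<bar> \<le> 2017/50000"
    by (simp_all add: x_def s_def)
qed

lemma near_balanced_bounds:
  assumes "near_balanced a b c"
  shows "143/500 \<le> a" "a \<le> 187/500"
  using near_balanced_deviation(2)[OF assms] assms unfolding near_balanced_def abs_le_iff by argo+

lemma balanced_quotient_le:
  fixes x y z M :: real
  assumes "0 \<le> M" "143/500 \<le> x" "143/500 \<le> z" "y \<le> 187/500"
  shows "4 * y * M / (x * z) \<le> 37 / 2 * M"
proof -
  have "143/500 * (143/500) \<le> x * z"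
    using assms by (intro mult_mono) auto
  then have "4 * y \<le> 37/2 * (x * z)" and "0 < x * z"
    using assms by auto
  then show ?thesis
    using mult_right_mono[of "4 * y" "37/2 * (x * z)" M] assms(1) by (simp add: pos_divide_le_eq mult_ac)
qed

lemma near_balanced_sum_inverse:
  assumes "near_balanced a b c"
  shows "(a + b + c) * (1 / a + 1 / b + 1 / c) \<le> 91/10"
proof -
  define s where "s = a + b + c"
  have pos: "0 < a" "0 < b" "0 < c"
    using near_balanced_bounds(1)[of a b c] near_balanced_bounds(1)[of b a c] near_balanced_bounds(1)[of c a b] assms
    by (simp_all add: near_balanced_commute)
  have s: "49/50 \<le> s" and im: "s ^ 3 - 27 * (a * b * c) \<le> 1/100"
    using assms by (simp_all add: near_balanced_def imbalance_def s_def mult.assoc)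
  have "(49/50) ^ 3 \<le> s ^ 3"
    using s by (intro power_mono) auto
  then have "9 * s ^ 3 \<le> 91/10 * 27 * (a * b * c)"
    using im by (simp add: power3_eq_cube)
  moreover have "s * (3 * (a * b + a * c + b * c)) \<le> s ^ 3"
  proof -
    have "0 \<le> (a - b)\<^sup>2 + (a - c)\<^sup>2 + (b - c)\<^sup>2"
      by simp
    then have "3 * (a * b + a * c + b * c) \<le> s\<^sup>2"
      by (simp add: s_def power2_eq_square algebra_simps)
    then show ?thesis
      using s mult_left_mono[of _ "s\<^sup>2" s] by (simp add: power2_eq_square power3_eq_cube)
  qed
  ultimately have "s * (a * b + a * c + b * c) \<le> 91/10 * (a * b * c)"
    by (simp add: algebra_simps)
  then have "s * (a * b + a * c + b * c) / (a * b * c) \<le> 91/10"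
    using pos by (simp add: pos_divide_le_eq)
  moreover have "s * (a * b + a * c + b * c) / (a * b * c) = s * (1 / a + 1 / b + 1 / c)"
    using pos by (simp add: field_simps)
  ultimately show ?thesis
    by (simp only: s_def)
qed

definition clone_weight :: "real \<Rightarrow> real" where
  "clone_weight a = a\<^sup>2 + a / 40 + 1 / 4800"

lemma near_balanced_squares_le:
  assumes "near_balanced a b c"
  shows "(b\<^sup>2 + c\<^sup>2) / 2 + clone_weight a / 4 \<le> 152/1000"
proof -
  define s where "s = a + b + c"
  define x where "x = s / 3 - a"
  have s: "0 \<le> s" "s \<le> 1" and im: "imbalance a b c \<le> 1/100"
    using assms by (auto simp: near_balanced_def s_def)
  have x: "\<bar>x\<bar> \<le> 2017/50000" "6 * x\<^sup>2 \<le> imbalance a b c"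
    using near_balanced_deviation[OF assms] by (simp_all add: x_def s_def)
  have bc: "6 * (s / 3 - b)\<^sup>2 \<le> imbalance a b c" "6 * (s / 3 - c)\<^sup>2 \<le> imbalance a b c"
    using near_balanced_deviation(1)[of b a c] near_balanced_deviation(1)[of c a b] assms
    by (simp_all add: near_balanced_commute imbalance_commute s_def add_ac)
  have "b\<^sup>2 + c\<^sup>2 = 2 / 9 * s\<^sup>2 + 2 / 3 * (s * x) + (s / 3 - b)\<^sup>2 + (s / 3 - c)\<^sup>2"
    unfolding x_def s_def by (simp add: power2_eq_square field_simps)
  moreover have "clone_weight a = s\<^sup>2 / 9 - 2 / 3 * (s * x) + x\<^sup>2 + s / 120 - x / 40 + 1 / 4800"
    unfolding clone_weight_def x_def by (simp add: power2_eq_square field_simps)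
  moreover have "s\<^sup>2 \<le> 1"
    using s by (simp add: power_le_one)
  moreover have "s * x \<le> 2017/50000"
  proof -
    have "s * x \<le> s * \<bar>x\<bar>"
      using s by (intro mult_left_mono) auto
    also have "\<dots> \<le> 1 * \<bar>x\<bar>"
      using s by (intro mult_right_mono) auto
    finally show ?thesis
      using x by simp
  qed
  moreover have "- x \<le> 2017/50000"
    using x by linarith
  ultimately show ?thesis
    using x(2) bc im s by argo
qed

lemma sparse_link_cross_le:
  fixes l y :: real
  assumes "0 \<le> y" "y \<le> 2 * l" "l \<le> 1/20"
  shows "2 * y + l - 55 * (y * l) \<le> 5683/100000"
proof (cases "55 * l \<le> 2")
  case True
  have "y * (2 - 55 * l) \<le> (2 * l) * (2 - 55 * l)"
    using True assms by (intro mult_right_mono) auto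
  moreover have "0 \<le> (l - 1/44)\<^sup>2"
    by simp
  ultimately show ?thesis
    by (simp add: power2_eq_square algebra_simps)
next
  case False
  have "y * (2 - 55 * l) \<le> 0"
    using False assms by (intro mult_nonneg_nonpos) auto
  then show ?thesis
    using assms by (simp add: algebra_simps)
qed

lemma sparse_link_le:
  fixes b c p :: real
  assumes "0 \<le> p" "p \<le> 1"
  shows "(1 - p)\<^sup>2 * (b\<^sup>2 + c\<^sup>2) / 2 + p * (b * c) \<le> (b\<^sup>2 + c\<^sup>2) / 2"
proof -
  have "p * p \<le> p * 1"
    using assms by (intro mult_left_mono)
  then have "(1 - p)\<^sup>2 \<le> 1 - p"
    by (simp add: power2_eq_square algebra_simps)
  then have "(1 - p)\<^sup>2 * (b\<^sup>2 + c\<^sup>2) \<le> (1 - p) * (b\<^sup>2 + c\<^sup>2)"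
    by (intro mult_right_mono) auto
  moreover have "p * (2 * (b * c)) \<le> p * (b\<^sup>2 + c\<^sup>2)"
    using zero_le_power2[of "b - c"] assms by (intro mult_left_mono) (auto simp: power2_eq_square algebra_simps)
  ultimately have "(1 - p)\<^sup>2 * (b\<^sup>2 + c\<^sup>2) + 2 * (p * (b * c)) \<le> b\<^sup>2 + c\<^sup>2"
    by (simp add: algebra_simps)
  then show ?thesis
    by simp
qed

lemma dense_link_le:
  fixes b c p :: real
  assumes "7/20 \<le> p" "p \<le> 3/4"
  shows "(1 - p)\<^sup>2 * (b\<^sup>2 + c\<^sup>2) / 2 + 2 * (p * (b * c)) \<le> 25/64 * (b + c)\<^sup>2"
proof -
  have "(1 - p)\<^sup>2 \<le> (13/20)\<^sup>2"
    using assms by (intro power_mono) auto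
  then have "(b - c)\<^sup>2 * (1 - p)\<^sup>2 \<le> (b - c)\<^sup>2 * (2 * p)"
    using assms by (intro mult_left_mono) (auto simp: power2_eq_square)
  then have "(1 - p)\<^sup>2 * (b\<^sup>2 + c\<^sup>2) / 2 + 2 * (p * (b * c)) \<le> (1 + p\<^sup>2) * (b + c)\<^sup>2 / 4"
    by (simp add: power2_eq_square field_simps)
  also have "\<dots> \<le> 25/16 * (b + c)\<^sup>2 / 4"
  proof -
    have "p\<^sup>2 \<le> (3/4)\<^sup>2"
      using assms by (intro power_mono) auto
    then have "1 + p\<^sup>2 \<le> 25/16"
      by (simp add: power2_eq_square)
    then show ?thesis
      by (intro divide_right_mono mult_right_mono) auto
  qed
  finally show ?thesis
    by simp
qed

lemma near_balanced_dense_link_le: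
  assumes balanced: "near_balanced a b c"
  shows "25/64 * (b + c)\<^sup>2 + clone_weight a / 4 \<le> 208/1000 + 4 * imbalance a b c"
proof -
  define s where "s = a + b + c"
  define x where "x = s / 3 - a"
  have s: "49/50 \<le> s" "s \<le> 1" and a: "0 \<le> a"
    using assms by (auto simp: near_balanced_def s_def)
  have sum: "b + c = 2 / 3 * s + x" "a = s / 3 - x"
    by (simp_all add: s_def x_def field_simps)
  have x: "- (2017/50000) \<le> x" "x \<le> 2017/50000" "6 * x\<^sup>2 \<le> imbalance a b c"
    using near_balanced_deviation[OF balanced, folded s_def, folded x_def] by linarith+
  have "(b + c)\<^sup>2 \<le> (2/3 + x)\<^sup>2"
    unfolding sum(1) using s x by (intro power_mono) auto
  moreover have "clone_weight a \<le> (1/3 - x)\<^sup>2 + (1/3 - x) / 40 + 1/4800"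
  proof -
    have "a\<^sup>2 \<le> (1/3 - x)\<^sup>2"
      using a s sum(2) by (intro power_mono) auto
    then show ?thesis
      unfolding clone_weight_def using s sum(2) by argo
  qed
  moreover have "(2/3 + x)\<^sup>2 = 4/9 + 4/3 * x + x\<^sup>2" "(1/3 - x)\<^sup>2 = 1/9 - 2/3 * x + x\<^sup>2"
    by (simp_all add: power2_eq_square field_simps)
  moreover have "0 \<le> (x - 3/400)\<^sup>2"
    by simp
  then have "0 \<le> x\<^sup>2 - 3/200 * x + 9/160000"
    by (simp add: power2_eq_square field_simps)
  ultimately show ?thesis
    using x s by argo
qed

lemma link_fraction_ge:
  assumes balanced: "near_balanced a b c" and y: "0 \<le> y" "y \<le> 2 * l" and l: "l = p * (b * c)" and p: "p \<le> 1"
    and cross: "55 * (y * l) \<le> 83 * M"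
    and budget: "249/1000 + 83 * M + 4 * imbalance a b c
        \<le> 1/25 + 2 * y + 2 * l + (1 - p)\<^sup>2 * (b\<^sup>2 + c\<^sup>2) / 2 + clone_weight a / 4"
  shows "3/4 \<le> p"
proof (rule ccontr)
  assume p34: "\<not> 3/4 \<le> p"
  have bounds: "143/500 \<le> a" "143/500 \<le> b" "b \<le> 187/500" "143/500 \<le> c" "c \<le> 187/500"
    using near_balanced_bounds[of a b c] near_balanced_bounds[of b a c] near_balanced_bounds[of c a b] balanced
    by (simp_all add: near_balanced_commute)
  have nonneg: "0 \<le> imbalance a b c"
    using balanced by (intro imbalance_nonneg) (auto simp: near_balanced_def)
  show False
  proof (cases "l \<le> 1/20")
    case True
    have "0 < b * c" "0 \<le> p * (b * c)"
      using y l bounds by simp_all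
    then have "0 \<le> p"
      by (simp only: zero_le_mult_iff) linarith
    then show False
      using sparse_link_cross_le[OF y True] sparse_link_le[OF _ p, of b c] near_balanced_squares_le[OF balanced]
        budget cross nonneg l by argo
  next
    case False
    have "b * c \<le> 187/500 * (187/500)"
      using bounds by (intro mult_mono) auto
    then have "7/20 * (b * c) \<le> p * (b * c)"
      using False l by simp
    then have "7/20 \<le> p"
      using bounds by (simp add: mult_le_cancel_right)
    moreover have "y * (2 - 55 * l) \<le> 0"
      using False y by (intro mult_nonneg_nonpos) auto
    then have "2 * y \<le> 83 * M"
      using cross by (simp add: algebra_simps)
    ultimately show False
      using dense_link_le[of p b c] near_balanced_dense_link_le[OF balanced] p34 budget l by argo
  qed
qed

section \<open>The partition around a core edge\<close>

context host
begin

lemma share_Un_disjoint: "finite X \<Longrightarrow> finite Y \<Longrightarrow> X \<inter> Y = {} \<Longrightarrow> share (X \<union> Y) = share X + share Y"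
  by (simp add: share_def card_Un_disjoint add_divide_distrib)

lemma share_Un_le: "share (X \<union> Y) \<le> share X + share Y"
  using card_Un_le[of X Y] n_pos by (simp add: share_def add_divide_distrib[symmetric] divide_right_mono flip: of_nat_add)

lemma share_mono: "finite Y \<Longrightarrow> X \<subseteq> Y \<Longrightarrow> share X \<le> share Y"
  by (simp add: share_def card_mono divide_right_mono)

lemma share_V: "share V = 1"
  using n_pos by (simp add: share_def)

lemma miss_density_ac: "miss_density X Y Z = miss_density Y X Z" "miss_density X Y Z = miss_density X Z Y"
  unfolding miss_density_def by (metis miss_ac)+

lemma link_density_commute: "link_density u X Y = link_density u Y X"
  unfolding link_density_def by (metis link_commute)

lemma link_density_le: "link_density u X Y \<le> share X * share Y"
  using divide_right_mono[OF link_le, of "n ^ 2" E u X Y] by (simp add: link_density_def share_def power2_eq_square)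

lemma miss_density_eq: "miss_density X Y Z = (\<Sum>x\<in>X. share Y * share Z - link_density x Y Z) / n"
  by (simp add: miss_density_def miss_eq_sum_link share_def link_density_def sum_divide_distrib diff_divide_distrib
      power2_eq_square power3_eq_cube)

lemma edge_density_add_miss_density: "edge_density X Y Z + miss_density X Y Z = share X * share Y * share Z"
  using edges_add_miss[of E X Y Z]
  by (simp add: edge_density_def miss_density_def share_def power3_eq_cube flip: add_divide_distrib)

lemma link_density_mult_le: "link_density u X Y * link_density u Y Z \<le> 2 * share Y * miss_density X Y Z"
proof -
  have "link E u X Y * link E u Y Z / n ^ 4 \<le> 2 * real (card Y) * miss E X Y Z / n ^ 4"
    by (intro divide_right_mono link_mult_link_le) simp
  then show ?thesis
    by (simp add: link_density_def share_def miss_density_def power2_eq_square power3_eq_cube power4_eq_xxxx mult_ac)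
qed

lemma link_density_self_le:
  assumes "40 dvd card V" "finite X"
  shows "link_density u X X \<le> extremal_density * clone_weight (share X) + 40/3 * deficit_density X"
proof -
  obtain k where k: "card V = 40 * k"
    using assms(1) by blast
  then have k_pos: "0 < real k" and n: "n = 40 * real k"
    using n_pos by simp_all
  have "nedge E X + 3 * real k * link E u X X \<le> extremal_density * (real (card X) + real k) ^ 3"
    by (rule clone_bound[OF assms(2)])
  also have "\<dots> = extremal_density * real (card X) ^ 3 + 3 * real k * (n ^ 2 * (extremal_density * clone_weight (share X)))"
    using k_pos by (simp add: clone_weight_def share_def n power2_eq_square power3_eq_cube field_simps)
  finally have "3 * real k * link E u X X \<le> 3 * real k *
      (n ^ 2 * (extremal_density * clone_weight (share X)) + deficit E X / (3 * real k))"
    using k_pos by (simp add: deficit_def distrib_left)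
  then have "link E u X X \<le> n ^ 2 * (extremal_density * clone_weight (share X)) + deficit E X / (3 * real k)"
    using k_pos by (simp only: mult_le_cancel_left_pos)
  also have "deficit E X / (3 * real k) = n ^ 2 * (40/3 * deficit_density X)"
    using k_pos by (simp add: deficit_density_def n power2_eq_square power3_eq_cube)
  finally show ?thesis
    using n_pos by (simp add: link_density_def pos_divide_le_eq algebra_simps)
qed

lemma link_density_inside_le:
  assumes "finite X" "finite Y" "finite Z" and pos: "0 < share X" "0 < share Y" "0 < share Z"
    and p: "link_density u Y Z = p * (share Y * share Z)"
  shows "link_density u Y Y \<le> (1 - p)\<^sup>2 * (share Y)\<^sup>2 / 2 + 4 * share Y * miss_density X Y Z / (share X * share Z)"
proof -
  have cards: "real (card X) = n * share X" "real (card Y) = n * share Y" "real (card Z) = n * share Z"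
    and link: "link E u Y Z = n ^ 2 * (p * (share Y * share Z))" and miss: "miss E X Y Z = n ^ 3 * miss_density X Y Z"
    using n_pos p[symmetric] by (simp_all add: share_def link_density_def miss_density_def)
  have "link E u Y Y \<le> (real (card Y) - link E u Y Z / real (card Z))\<^sup>2 / 2
      + 4 * real (card Y) * miss E X Y Z / (real (card X) * real (card Z))"
    using pos by (intro link_inside_le assms(1-3)) (auto simp: share_def)
  also have "link E u Y Z / real (card Z) = n * (p * share Y)"
    using n_pos pos by (simp add: cards link power2_eq_square)
  also have "(real (card Y) - n * (p * share Y))\<^sup>2 / 2 + 4 * real (card Y) * miss E X Y Z / (real (card X) * real (card Z))
      = n ^ 2 * ((1 - p)\<^sup>2 * (share Y)\<^sup>2 / 2 + 4 * share Y * miss_density X Y Z / (share X * share Z))"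
    using n_pos pos by (simp add: cards miss power2_eq_square power3_eq_cube field_simps)
  finally show ?thesis
    using n_pos by (simp add: link_density_def pos_divide_le_eq mult.commute)
qed

definition dense_to :: "'a set \<Rightarrow> 'a set \<Rightarrow> 'a set" where
  "dense_to X Y = {u \<in> V. 3/4 * (share X * share Y) \<le> link_density u X Y}"

lemma dense_to_commute: "dense_to X Y = dense_to Y X"
  unfolding dense_to_def by (metis link_density_commute mult.commute)

lemma dense_to_subset: "dense_to X Y \<subseteq> V"
  by (auto simp: dense_to_def)

end

text \<open>The last inequality is what the objective at a core edge gives; the factor 40 makes room for \<open>card V / 40\<close> clones of a vertex.\<close>

locale core = host E V for E :: "'a \<Rightarrow> 'a \<Rightarrow> 'a \<Rightarrow> bool" and V +
  fixes A B C :: "'a set"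
  assumes subset: "A \<subseteq> V" "B \<subseteq> V" "C \<subseteq> V" and disjoint: "A \<inter> B = {}" "A \<inter> C = {}" "B \<inter> C = {}"
    and forty_dvd: "40 dvd card V"
    and extremal_density_ge: "1/4 \<le> extremal_density"
    and min_degree: "u \<in> V \<Longrightarrow> extremal_density - 1/1000 \<le> link_density u V V"
    and budget: "share (V - (A \<union> B \<union> C)) + 60 * miss_density A B C + 2 * imbalance (share A) (share B) (share C)
      + 8 * (deficit_density A + deficit_density B + deficit_density C) \<le> 1/50"

lemma core_commute:
  assumes "core E V A B C"
  shows "core E V B A C" "core E V A C B"
proof -
  interpret core E V A B C by (rule assms)
  have unions: "B \<union> A \<union> C = A \<union> B \<union> C" "A \<union> C \<union> B = A \<union> B \<union> C"
    by auto
  show "core E V B A C"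
    using subset disjoint forty_dvd extremal_density_ge min_degree budget
    by unfold_locales (auto simp only: unions miss_density_ac(1)[of B A C] imbalance_commute(1)[of "share B"]
        add.commute[of "deficit_density B"] Int_commute)
  show "core E V A C B"
    using subset disjoint forty_dvd extremal_density_ge min_degree budget
    by unfold_locales (auto simp only: unions miss_density_ac(2)[of A C B] imbalance_commute(2)[of _ "share C"] add_ac
        Int_commute)
qed

context core
begin

lemma finite_parts: "finite A" "finite B" "finite C"
  using subset finite_V by (auto intro: finite_subset)

lemma share_partition: "share (V - (A \<union> B \<union> C)) + (share A + share B + share C) = 1"
proof -
  have "share V = share ((V - (A \<union> B \<union> C)) \<union> (A \<union> B \<union> C))"
    using subset by (intro arg_cong[where f = share]) auto
  also have "\<dots> = share (V - (A \<union> B \<union> C)) + share (A \<union> B \<union> C)"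
    using finite_parts finite_V by (intro share_Un_disjoint) auto
  also have "share (A \<union> B \<union> C) = share A + share B + share C"
    using finite_parts disjoint by (simp add: share_Un_disjoint Int_Un_distrib2)
  finally show ?thesis
    by (simp add: share_V)
qed

lemma miss_density_le: "share (V - (A \<union> B \<union> C)) + 60 * miss_density A B C \<le> 1/50"
  and near_balanced_parts: "near_balanced (share A) (share B) (share C)"
proof -
  have nonneg: "0 \<le> share (V - (A \<union> B \<union> C))" "0 \<le> miss_density A B C" "0 \<le> imbalance (share A) (share B) (share C)"
    "0 \<le> deficit_density A" "0 \<le> deficit_density B" "0 \<le> deficit_density C"
    by (intro densities_nonneg imbalance_nonneg finite_parts)+
  then show "share (V - (A \<union> B \<union> C)) + 60 * miss_density A B C \<le> 1/50"
    using budget by argo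
  show "near_balanced (share A) (share B) (share C)"
    unfolding near_balanced_def using nonneg budget share_partition densities_nonneg(1)[of A] densities_nonneg(1)[of B]
        densities_nonneg(1)[of C]
    by (intro conjI) argo+
qed

lemma share_bounds:
  "143/500 \<le> share A" "share A \<le> 187/500" "143/500 \<le> share B" "share B \<le> 187/500" "143/500 \<le> share C" "share C \<le> 187/500"
  using near_balanced_bounds[of "share A" "share B" "share C"] near_balanced_bounds[of "share B" "share A" "share C"]
    near_balanced_bounds[of "share C" "share A" "share B"] near_balanced_parts
  by (simp_all add: near_balanced_commute)

lemma link_density_le_parts:
  "link_density u V V \<le> 2 * share (V - (A \<union> B \<union> C)) + 2 * (link_density u A B + link_density u A C + link_density u B C)
     + (link_density u A A + link_density u B B + link_density u C C)"
proof -
  let ?R = "V - (A \<union> B \<union> C)"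
  have "V = ?R \<union> (A \<union> B \<union> C)"
    using subset by auto
  then have "link E u V V \<le> 2 * real (card ?R) * n + 2 * (link E u A B + link E u A C + link E u B C)
     + (link E u A A + link E u B B + link E u C C)"
    using link_le_of_cover[of ?R A B C u] finite_parts finite_V disjoint by (simp add: Diff_Int_distrib2)
  then have "link E u V V / n ^ 2 \<le> (2 * real (card ?R) * n + 2 * (link E u A B + link E u A C + link E u B C)
     + (link E u A A + link E u B B + link E u C C)) / n ^ 2"
    by (rule divide_right_mono) simp
  then show ?thesis
    using n_pos by (simp add: link_density_def share_def add_divide_distrib power2_eq_square)
qed

text \<open>The clone bound controls the link of \<open>u\<close> inside \<open>A\<close>, the edges missing between the parts control it inside \<open>B\<close> and \<open>C\<close>.\<close>

lemma link_budget:
  assumes "u \<in> V" and p: "link_density u B C = p * (share B * share C)"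
  shows "249/1000 + 83 * miss_density A B C + 4 * imbalance (share A) (share B) (share C)
    \<le> 1/25 + 2 * (link_density u A B + link_density u A C) + 2 * link_density u B C
      + (1 - p)\<^sup>2 * ((share B)\<^sup>2 + (share C)\<^sup>2) / 2 + clone_weight (share A) / 4"
proof -
  let ?M = "miss_density A B C" and ?\<kappa> = "clone_weight (share A)"
  have pos: "0 < share A" "0 < share B" "0 < share C"
    using share_bounds by auto
  note quotient = balanced_quotient_le[OF densities_nonneg(4)[of A B C]]
  have "link_density u B B \<le> (1 - p)\<^sup>2 * (share B)\<^sup>2 / 2 + 37 / 2 * ?M"
    using link_density_inside_le[OF finite_parts pos p] quotient[OF share_bounds(1,5,4)] by linarith
  moreover have "link_density u C C \<le> (1 - p)\<^sup>2 * (share C)\<^sup>2 / 2 + 37 / 2 * ?M"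
  proof -
    have "link_density u C C \<le> (1 - p)\<^sup>2 * (share C)\<^sup>2 / 2 + 4 * share C * miss_density A C B / (share A * share B)"
      using p pos by (intro link_density_inside_le finite_parts) (simp_all add: link_density_commute[of u C B] mult.commute)
    then show ?thesis
      using quotient[OF share_bounds(1,3,6)] by (simp only: miss_density_ac(2)[of A C B])
  qed
  moreover have "link_density u A A \<le> extremal_density * ?\<kappa> + 40/3 * deficit_density A"
    by (rule link_density_self_le[OF forty_dvd finite_parts(1)])
  moreover have "1/4 * (1 - ?\<kappa>) \<le> extremal_density * (1 - ?\<kappa>)"
  proof (intro mult_right_mono extremal_density_ge)
    have "(share A)\<^sup>2 \<le> (1/2)\<^sup>2"
      using share_bounds by (intro power_mono) auto
    then show "0 \<le> 1 - ?\<kappa>"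
      using share_bounds by (simp add: clone_weight_def power2_eq_square)
  qed
  then have "1/4 - ?\<kappa> / 4 \<le> extremal_density - extremal_density * ?\<kappa>"
    by (simp add: right_diff_distrib)
  moreover have "0 \<le> deficit_density A" "0 \<le> deficit_density B" "0 \<le> deficit_density C"
    by (intro densities_nonneg finite_parts)+
  moreover have "(1 - p)\<^sup>2 * ((share B)\<^sup>2 + (share C)\<^sup>2) / 2 = (1 - p)\<^sup>2 * (share B)\<^sup>2 / 2 + (1 - p)\<^sup>2 * (share C)\<^sup>2 / 2"
    by (simp add: distrib_left add_divide_distrib)
  ultimately show ?thesis
    using min_degree[OF assms(1)] link_density_le_parts[of u] budget by argo
qed

lemma mem_dense_to_if_largest:
  assumes "u \<in> V" and largest: "link_density u A B \<le> link_density u B C" "link_density u A C \<le> link_density u B C"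
  shows "u \<in> dense_to B C"
proof -
  let ?l = "link_density u B C" and ?y = "link_density u A B + link_density u A C" and ?M = "miss_density A B C"
  define p where "p = ?l / (share B * share C)"
  have pos: "0 < share B * share C"
    using share_bounds by simp
  then have l: "?l = p * (share B * share C)"
    by (auto simp: p_def)
  have "?y * ?l \<le> 2 * (share B + share C) * ?M"
    using link_density_mult_le[of u A B C] link_density_mult_le[of u A C B]
    by (simp add: link_density_commute[of u C B] miss_density_ac(2)[of A C B] algebra_simps)
  also have "\<dots> \<le> 83/55 * ?M"
    using share_bounds by (intro mult_right_mono densities_nonneg) auto
  finally have "55 * (?y * ?l) \<le> 83 * ?M"
    by simp
  moreover have "p \<le> 1"
    using pos link_density_le[of u B C] by (simp add: p_def)
  moreover have "0 \<le> ?y" "?y \<le> 2 * ?l"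
    using largest densities_nonneg(2)[of u A B] densities_nonneg(2)[of u A C] by simp_all
  ultimately have "3/4 \<le> p"
    using near_balanced_parts l link_budget[OF assms(1) l] by (intro link_fraction_ge)
  then show ?thesis
    using assms(1) pos mult_right_mono[of "3/4" p "share B * share C"] by (simp add: dense_to_def l)
qed

lemma link_density_le_if_mem_dense_to:
  assumes "u \<in> dense_to A C"
  shows "link_density u B C \<le> 32/10000"
proof -
  have "3/4 * (share A * share C) * link_density u B C \<le> link_density u A C * link_density u C B"
    using assms unfolding link_density_commute[of u C B] by (intro mult_right_mono densities_nonneg) (simp add: dense_to_def)
  also have "\<dots> \<le> 2 * share C * miss_density A B C"
    using link_density_mult_le[of u A C B] by (simp only: miss_density_ac(2)[of A C B])
  finally have "share C * (3/4 * share A * link_density u B C) \<le> share C * (2 * miss_density A B C)"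
    by (simp add: mult_ac)
  then have "3/4 * share A * link_density u B C \<le> 2 * miss_density A B C"
    using share_bounds by (subst (asm) mult_le_cancel_left_pos) auto
  moreover have "143/500 * link_density u B C \<le> share A * link_density u B C"
    using share_bounds by (intro mult_right_mono densities_nonneg)
  moreover have "60 * miss_density A B C \<le> 1/50"
    using miss_density_le densities_nonneg(1)[of "V - (A \<union> B \<union> C)"] by linarith
  ultimately show ?thesis
    by simp
qed

lemma dense_to_disjoint: "dense_to A C \<inter> dense_to B C = {}"
proof -
  have "143/500 * (143/500) \<le> share B * share C"
    using share_bounds by (intro mult_mono) auto
  then show ?thesis
    using link_density_le_if_mem_dense_to by (fastforce simp: dense_to_def)
qed

end

lemma (in core) dense_to_cover: "V = dense_to B C \<union> dense_to A C \<union> dense_to A B"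
proof -
  interpret BAC: core E V B A C
    by (rule core_commute[OF core_axioms])
  interpret CAB: core E V C A B
    by (rule core_commute(1)[OF core_commute(2)[OF core_axioms]])
  have "u \<in> dense_to B C \<union> dense_to A C \<union> dense_to A B" if "u \<in> V" for u
  proof -
    consider "link_density u A B \<le> link_density u B C" "link_density u A C \<le> link_density u B C"
      | "link_density u B A \<le> link_density u A C" "link_density u B C \<le> link_density u A C"
      | "link_density u C A \<le> link_density u A B" "link_density u C B \<le> link_density u A B"
      unfolding link_density_commute[of u B A] link_density_commute[of u C A] link_density_commute[of u C B] by linarith
    then show ?thesis
      using mem_dense_to_if_largest BAC.mem_dense_to_if_largest CAB.mem_dense_to_if_largest that by cases auto
  qed
  then show ?thesis
    using dense_to_subset by blast
qed

lemma (in core) share_diff_dense_to_le: "share (A - dense_to B C) \<le> 1275/100 * miss_density A B C"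
proof -
  interpret ACB: core E V A C B
    by (rule core_commute[OF core_axioms])
  have BC: "143/500 * (143/500) \<le> share B * share C"
    using share_bounds by (intro mult_mono) auto
  have "100/1275 \<le> share B * share C - link_density a B C" if "a \<in> A - dense_to B C" for a
  proof -
    have "a \<in> dense_to A C \<or> a \<in> dense_to A B"
      using that dense_to_cover subset by blast
    then have "link_density a B C \<le> 32/10000"
      using link_density_le_if_mem_dense_to ACB.link_density_le_if_mem_dense_to by (metis link_density_commute)
    then show ?thesis
      using BC by simp
  qed
  then have "(\<Sum>a\<in>A - dense_to B C. 100/1275) \<le> (\<Sum>a\<in>A - dense_to B C. share B * share C - link_density a B C)"
    by (intro sum_mono)
  also have "\<dots> \<le> (\<Sum>a\<in>A. share B * share C - link_density a B C)"
    using finite_parts link_density_le by (intro sum_mono2) auto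
  finally have "real (card (A - dense_to B C)) * (100/1275) / n \<le> miss_density A B C"
    unfolding miss_density_eq by (intro divide_right_mono) simp_all
  then show ?thesis
    using n_pos by (simp add: share_def field_simps)
qed

section \<open>Edges meeting only two parts\<close>

abbreviation missing_codegree :: "('a \<Rightarrow> 'a \<Rightarrow> 'a \<Rightarrow> bool) \<Rightarrow> 'a \<Rightarrow> 'a \<Rightarrow> 'a set \<Rightarrow> real" where
  "missing_codegree E \<equiv> codegree (\<lambda>x y z. \<not> E x y z)"

lemma sum_missing_codegree_le:
  assumes "finite A" "finite U" and b: "3/4 * (real (card A) * real (card C)) \<le> link E b A C"
  shows "(\<Sum>a\<in>U. missing_codegree E b a C) \<le> real (card C) * (real (card A) / 4 + real (card (U - A)))"
proof -
  have "(\<Sum>a\<in>U. missing_codegree E b a C) \<le> (\<Sum>a\<in>A \<union> (U - A). missing_codegree E b a C)"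
    using assms by (intro sum_mono2 codegree_nonneg) auto
  also have "\<dots> = (\<Sum>a\<in>A. missing_codegree E b a C) + (\<Sum>a\<in>U - A. missing_codegree E b a C)"
    using assms by (intro sum.union_disjoint) auto
  also have "(\<Sum>a\<in>U - A. missing_codegree E b a C) \<le> (\<Sum>a\<in>U - A. real (card C))"
    by (intro sum_mono codegree_le)
  also have "(\<Sum>a\<in>A. missing_codegree E b a C) = real (card A) * real (card C) - link E b A C"
    by (simp add: codegree_def link_eq_sum of_bool_not_iff sum_subtractf)
  finally show ?thesis
    using b by (simp add: algebra_simps)
qed

lemma missing_codegree_mult_le:
  assumes "finite C" "finite W" and large: "real (card C) \<le> 2 * missing_codegree E b a C"
  shows "(real (card C) - 2 * real (card (C - W))) * missing_codegree E b a C \<le> real (card C) * missing_codegree E b a W"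
proof -
  have "missing_codegree E b a C \<le> missing_codegree E b a (W \<union> (C - W))"
    using assms by (intro codegree_mono) auto
  also have "\<dots> = missing_codegree E b a W + missing_codegree E b a (C - W)"
    unfolding codegree_def using assms by (intro sum.union_disjoint) auto
  also have "\<dots> \<le> missing_codegree E b a W + real (card (C - W))"
    using codegree_le by simp
  finally have "real (card C) * missing_codegree E b a C \<le> real (card C) * (missing_codegree E b a W + real (card (C - W)))"
    by (rule mult_left_mono) simp
  moreover have "real (card (C - W)) * real (card C) \<le> real (card (C - W)) * (2 * missing_codegree E b a C)"
    using large by (intro mult_left_mono) simp_all
  ultimately show ?thesis
    by (simp add: algebra_simps)
qed

context hom_free
begin

text \<open>A pair \<open>b' c\<close> in the links of both \<open>a\<close> and \<open>a'\<close> excludes the edges \<open>abc\<close> and \<open>a'bc\<close> by the cycle on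
  \<open>a', b', c, a, b\<close>; for every other \<open>c\<close> one of the two is missing.\<close>

lemma missing_codegree_add_ge:
  assumes "finite B" "B \<noteq> {}" "E b a a'"
    and dense: "3/4 * (real (card B) * real (card C)) \<le> link E a B C" "3/4 * (real (card B) * real (card C)) \<le> link E a' B C"
  shows "3/2 * real (card C) \<le> missing_codegree E b a C + missing_codegree E b a' C"
proof -
  define S where "S = {c. \<exists>b'\<in>B. E a b' c \<and> E a' b' c}"
  have "link E a B C + link E a' B C - real (card B) * real (card C)
      = (\<Sum>b'\<in>B. \<Sum>c\<in>C. of_bool (E a b' c) + of_bool (E a' b' c) - 1)"
    by (simp add: link_eq_sum sum.distrib sum_subtractf)
  also have "\<dots> \<le> (\<Sum>b'\<in>B. \<Sum>c\<in>C. of_bool (c \<in> S))"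
    by (intro sum_mono) (auto simp: S_def)
  finally have "real (card B) * (1/2 * real (card C)) \<le> real (card B) * (\<Sum>c\<in>C. of_bool (c \<in> S))"
    using dense by simp
  moreover have "0 < real (card B)"
    using assms(1,2) by (simp add: card_gt_0_iff)
  ultimately have "1/2 * real (card C) \<le> (\<Sum>c\<in>C. of_bool (c \<in> S))"
    by (simp only: mult_le_cancel_left_pos)
  moreover have "1 + of_bool (c \<in> S) \<le> of_bool (\<not> E b a c) + (of_bool (\<not> E b a' c) :: real)" for c
  proof -
    have "\<not> (E b a c \<and> E b a' c)"
      using no_K4_minus[of b a a' c] assms(3) by blast
    moreover have "\<not> E b a c \<and> \<not> E b a' c" if "E a b' c" "E a' b' c" for b'
      using no_C5_minus[of a' b' c a b] no_C5_minus[of a b' c a' b] that assms(3) edge_ac by metis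
    ultimately show ?thesis
      by (auto simp: S_def)
  qed
  then have "(\<Sum>c\<in>C. 1 + of_bool (c \<in> S)) \<le> missing_codegree E b a C + missing_codegree E b a' C"
    unfolding codegree_def sum.distrib[symmetric] by (rule sum_mono)
  ultimately show ?thesis
    by (simp add: sum.distrib)
qed

lemma link_self_mult_square_le:
  assumes range: "\<And>a. a \<in> U \<Longrightarrow> 0 \<le> m a" "\<And>a. a \<in> U \<Longrightarrow> m a \<le> k"
    and sum: "\<And>a a'. a \<in> U \<Longrightarrow> a' \<in> U \<Longrightarrow> E b a a' \<Longrightarrow> 3/2 * k \<le> m a + m a'"
  defines "w \<equiv> \<lambda>a. if k \<le> 2 * m a then m a else 0"
  shows "k\<^sup>2 * link E b U U \<le> (sum w U)\<^sup>2"
proof -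
  have "k\<^sup>2 / 2 * of_bool (E b a a') \<le> w a * w a' * of_bool (E b a a')" if "a \<in> U" "a' \<in> U" for a a'
  proof (cases "E b a a'")
    case True
    have le: "m a \<le> k" "m a' \<le> k" "3/2 * k \<le> m a + m a'" "0 \<le> m a"
      using range sum that True by auto
    have "k * (3/2 * k) \<le> k * (m a + m a')"
      using le by (intro mult_left_mono) auto
    moreover have "0 \<le> (k - m a) * (k - m a')"
      using le by simp
    ultimately have "k\<^sup>2 / 2 \<le> m a * m a'"
      by (simp add: power2_eq_square algebra_simps)
    then show ?thesis
      using le True by (simp add: w_def)
  qed simp
  then have "k\<^sup>2 / 2 * link E b U U \<le> (\<Sum>a\<in>U. \<Sum>a'\<in>U. w a * w a' * of_bool (E b a a'))"
    unfolding link_eq_sum sum_distrib_left by (intro sum_mono)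
  also have "\<dots> \<le> (sum w U)\<^sup>2 / 2"
    by (intro weighted_mantel right_commute; (erule (1) no_K4_minus)?) (simp add: w_def range)
  finally show ?thesis
    by simp
qed

lemma link_self_le_missing:
  assumes fin: "finite A" "finite B" "finite C" "finite U" "finite W" and nonempty: "B \<noteq> {}" "C \<noteq> {}"
    and dense: "\<And>a. a \<in> U \<Longrightarrow> 3/4 * (real (card B) * real (card C)) \<le> link E a B C"
    and b: "3/4 * (real (card A) * real (card C)) \<le> link E b A C"
    and small: "0 \<le> real (card C) - 2 * real (card (C - W))"
  shows "(real (card C) - 2 * real (card (C - W))) * link E b U U
    \<le> (real (card A) / 4 + real (card (U - A))) * (\<Sum>a\<in>U. missing_codegree E b a W)"
proof -
  define k r \<psi> where "k = real (card C)" and "r = k - 2 * real (card (C - W))"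
      and "\<psi> = real (card A) / 4 + real (card (U - A))"
  let ?m = "\<lambda>a. missing_codegree E b a C" and ?m' = "\<lambda>a. missing_codegree E b a W"
  define w where "w a = (if k \<le> 2 * ?m a then ?m a else 0)" for a
  have k: "0 < k" and r: "0 \<le> r"
    using fin nonempty small by (simp_all add: k_def r_def card_gt_0_iff)
  have w: "0 \<le> w a" "w a \<le> ?m a" for a
    by (simp_all add: w_def codegree_nonneg)
  have "k\<^sup>2 * link E b U U \<le> (sum w U)\<^sup>2"
    unfolding w_def using missing_codegree_add_ge[OF fin(2) nonempty(1)] dense
    by (intro link_self_mult_square_le codegree_nonneg) (auto simp: k_def codegree_le)
  then have "r * (k\<^sup>2 * link E b U U) \<le> r * (sum w U)\<^sup>2"
    using r by (rule mult_left_mono)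
  also have "\<dots> = (r * sum w U) * sum w U"
    by (simp add: power2_eq_square)
  also have "\<dots> \<le> (k * sum ?m' U) * (k * \<psi>)"
  proof (rule mult_mono)
    have "r * w a \<le> k * ?m' a" for a
      using missing_codegree_mult_le[OF fin(3,5), of E b a] k by (simp add: w_def k_def r_def codegree_nonneg)
    then show "r * sum w U \<le> k * sum ?m' U"
      unfolding sum_distrib_left by (rule sum_mono)
    have "sum w U \<le> sum ?m U"
      by (intro sum_mono w)
    then show "sum w U \<le> k * \<psi>"
      using sum_missing_codegree_le[OF fin(1,4) b] by (simp add: k_def \<psi>_def)
    show "0 \<le> k * sum ?m' U" "0 \<le> sum w U"
      using k w by (simp_all add: sum_nonneg codegree_nonneg)
  qed
  finally have "k\<^sup>2 * (r * link E b U U) \<le> k\<^sup>2 * (\<psi> * sum ?m' U)"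
    by (simp add: power2_eq_square mult_ac)
  then show ?thesis
    using k by (simp add: k_def r_def \<psi>_def)
qed

lemma edges_self_le_miss:
  assumes "finite A" "finite B" "finite C" "finite U" "finite W" "B \<noteq> {}" "C \<noteq> {}"
    and "\<And>a. a \<in> U \<Longrightarrow> 3/4 * (real (card B) * real (card C)) \<le> link E a B C"
    and "\<And>b. b \<in> Y \<Longrightarrow> 3/4 * (real (card A) * real (card C)) \<le> link E b A C"
    and "0 \<le> real (card C) - 2 * real (card (C - W))"
  shows "(real (card C) - 2 * real (card (C - W))) * edges E Y U U
      \<le> (real (card A) / 4 + real (card (U - A))) * miss E U Y W"
proof -
  have "(real (card C) - 2 * real (card (C - W))) * edges E Y U U
      \<le> (\<Sum>b\<in>Y. (real (card A) / 4 + real (card (U - A))) * (\<Sum>a\<in>U. missing_codegree E b a W))"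
    unfolding edges_def sum_distrib_left[of _ "\<lambda>b. link E b U U"] by (intro sum_mono link_self_le_missing[where B = B] assms)
  also have "\<dots> = (real (card A) / 4 + real (card (U - A))) * miss E Y U W"
    by (simp only: edges_def link_def sum_distrib_left)
  finally show ?thesis
    by (simp only: miss_ac(1)[of Y])
qed

end

lemma (in host) dense_to_iff: "u \<in> dense_to X Y \<longleftrightarrow> u \<in> V \<and> 3/4 * (real (card X) * real (card Y)) \<le> link E u X Y"
  using n_pos by (simp add: dense_to_def share_def link_density_def power2_eq_square pos_le_divide_eq pos_divide_le_eq
      divide_le_cancel)

lemma (in host) edge_density_self_le:
  assumes "finite A" "finite B" "finite C" "B \<noteq> {}" "C \<noteq> {}" and small: "2 * share (C - W) \<le> share C" "finite W"
  defines "X \<equiv> dense_to B C" and "Y \<equiv> dense_to A C"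
  shows "(share C - 2 * share (C - W)) * edge_density Y X X \<le> (share A / 4 + share (X - A)) * miss_density X Y W"
proof -
  have "finite X"
    unfolding X_def using finite_V dense_to_subset by (rule finite_subset[rotated])
  moreover have "0 \<le> real (card C) - 2 * real (card (C - W))"
    using small n_pos by (simp add: share_def divide_le_cancel)
  ultimately have "(real (card C) - 2 * real (card (C - W))) * edges E Y X X
      \<le> (real (card A) / 4 + real (card (X - A))) * miss E X Y W"
    using assms by (intro edges_self_le_miss[where B = B]) (simp_all add: dense_to_iff)
  then have "(real (card C) - 2 * real (card (C - W))) * edges E Y X X / n ^ 4
      \<le> (real (card A) / 4 + real (card (X - A))) * miss E X Y W / n ^ 4"
    by (rule divide_right_mono) simp
  then show ?thesis
    using n_pos by (simp add: share_def edge_density_def miss_density_def power3_eq_cube power4_eq_xxxx field_simps)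
qed

context core
begin

lemma dense_to_pairwise_disjoint:
  "dense_to B C \<inter> dense_to A C = {}" "dense_to B C \<inter> dense_to A B = {}" "dense_to A C \<inter> dense_to A B = {}"
proof -
  interpret ACB: core E V A C B
    by (rule core_commute[OF core_axioms])
  interpret BCA: core E V B C A
    by (rule core_commute(2)[OF core_commute(1)[OF core_axioms]])
  show "dense_to B C \<inter> dense_to A C = {}" "dense_to B C \<inter> dense_to A B = {}" "dense_to A C \<inter> dense_to A B = {}"
    using dense_to_disjoint ACB.dense_to_disjoint BCA.dense_to_disjoint
    by (auto simp: dense_to_commute[of C B] dense_to_commute[of B A] dense_to_commute[of C A])
qed

lemma share_dense_to_diff_le: "share (dense_to B C - A) \<le> 1/50"
proof -
  interpret BAC: core E V B A C
    by (rule core_commute[OF core_axioms])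
  interpret CAB: core E V C A B
    by (rule core_commute(1)[OF core_commute(2)[OF core_axioms]])
  let ?R = "V - (A \<union> B \<union> C)"
  have "dense_to B C - A \<subseteq> ?R \<union> (B - dense_to A C) \<union> (C - dense_to A B)"
    using dense_to_subset dense_to_pairwise_disjoint by blast
  then have "share (dense_to B C - A) \<le> share (?R \<union> (B - dense_to A C) \<union> (C - dense_to A B))"
    using finite_V finite_parts by (intro share_mono) auto
  also have "\<dots> \<le> share ?R + share (B - dense_to A C) + share (C - dense_to A B)"
    using share_Un_le[of "?R \<union> (B - dense_to A C)"] share_Un_le[of ?R] by (meson add_right_mono order_trans)
  also have "\<dots> \<le> share ?R + 1275/100 * miss_density A B C + 1275/100 * miss_density A B C"
    using BAC.share_diff_dense_to_le CAB.share_diff_dense_to_le miss_density_ac by (metis add_mono order_refl)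
  also have "\<dots> \<le> 1/50"
    using miss_density_le densities_nonneg(4)[of A B C] by linarith
  finally show ?thesis .
qed

lemma edge_density_dense_to_le:
  "97/100 * share C * edge_density (dense_to A C) (dense_to B C) (dense_to B C)
    \<le> (share A / 4 + 1/50) * miss_density (dense_to B C) (dense_to A C) (dense_to A B)"
proof -
  interpret CAB: core E V C A B
    by (rule core_commute(1)[OF core_commute(2)[OF core_axioms]])
  let ?X = "dense_to B C" and ?Y = "dense_to A C" and ?Z = "dense_to A B"
  have "share (C - ?Z) \<le> 1275/100 * miss_density A B C"
    using CAB.share_diff_dense_to_le miss_density_ac by metis
  then have "97/100 * share C \<le> share C - 2 * share (C - ?Z)"
    using miss_density_le densities_nonneg(1)[of "V - (A \<union> B \<union> C)"] share_bounds by linarith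
  moreover from this have "(share C - 2 * share (C - ?Z)) * edge_density ?Y ?X ?X
      \<le> (share A / 4 + share (?X - A)) * miss_density ?X ?Y ?Z"
    using share_bounds finite_subset[OF dense_to_subset finite_V]
    by (intro edge_density_self_le finite_parts) (auto simp: share_def)
  moreover have "(share A / 4 + share (?X - A)) * miss_density ?X ?Y ?Z \<le> (share A / 4 + 1/50) * miss_density ?X ?Y ?Z"
    using share_dense_to_diff_le by (intro mult_right_mono densities_nonneg) simp
  ultimately show ?thesis
    using mult_right_mono[of "97/100 * share C" "share C - 2 * share (C - ?Z)" "edge_density ?Y ?X ?X"] densities_nonneg(3)
    by (meson order_trans)
qed

end

lemma sum_irregular_le:
  assumes balanced: "near_balanced a b c" and m: "0 \<le> m"
    and t: "97/100 * c * t1 \<le> (a / 4 + 1/50) * m" "97/100 * b * t2 \<le> (a / 4 + 1/50) * m"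
      "97/100 * c * t3 \<le> (b / 4 + 1/50) * m" "97/100 * a * t4 \<le> (b / 4 + 1/50) * m"
      "97/100 * b * t5 \<le> (c / 4 + 1/50) * m" "97/100 * a * t6 \<le> (c / 4 + 1/50) * m"
  shows "t1 + t2 + t3 + t4 + t5 + t6 \<le> 2 * m"
proof -
  define R where "R = 1 / a + 1 / b + 1 / c"
  have pos: "0 < a" "0 < b" "0 < c"
    using near_balanced_bounds(1)[of a b c] near_balanced_bounds(1)[of b a c] near_balanced_bounds(1)[of c a b] balanced
    by (simp_all add: near_balanced_commute)
  have sR: "(a + b + c) * R \<le> 91/10"
    unfolding R_def by (rule near_balanced_sum_inverse[OF balanced])
  moreover have "49/50 * R \<le> (a + b + c) * R"
    using pos balanced by (intro mult_right_mono) (auto simp: R_def near_balanced_def)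
  ultimately have R: "R \<le> 929/100"
    by linarith
  have divide: "97/100 * t \<le> (x / 4 + 1/50) / y * m" if "97/100 * y * t \<le> (x / 4 + 1/50) * m" "0 < y" for x y t
    using that by (simp add: pos_le_divide_eq mult_ac)
  have "97/100 * (t1 + t2 + t3 + t4 + t5 + t6) \<le>
     ((a / 4 + 1/50) / c + (a / 4 + 1/50) / b + (b / 4 + 1/50) / c + (b / 4 + 1/50) / a + (c / 4 + 1/50) / b
         + (c / 4 + 1/50) / a) * m"
    using divide[OF t(1) pos(3)] divide[OF t(2) pos(2)] divide[OF t(3) pos(3)] divide[OF t(4) pos(1)]
      divide[OF t(5) pos(2)] divide[OF t(6) pos(1)]
    by (simp only: distrib_right distrib_left)
  also have "(a / 4 + 1/50) / c + (a / 4 + 1/50) / b + (b / 4 + 1/50) / c + (b / 4 + 1/50) / a + (c / 4 + 1/50) / b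
      + (c / 4 + 1/50) / a
     = (a + b + c) * R / 4 - 3/4 + R / 25"
    using pos by (simp add: R_def field_simps)
  also have "((a + b + c) * R / 4 - 3/4 + R / 25) * m \<le> 194/100 * m"
    using sR R by (intro mult_right_mono[OF _ m]) linarith
  finally show ?thesis
    by simp
qed

context core
begin

lemma irregular_edges_le:
  defines "X \<equiv> dense_to B C" and "Y \<equiv> dense_to A C" and "Z \<equiv> dense_to A B"
  shows "edge_density Y X X + edge_density Z X X + edge_density X Y Y + edge_density Z Y Y + edge_density X Z Z
      + edge_density Y Z Z
    \<le> 2 * miss_density X Y Z"
proof -
  interpret ACB: core E V A C B
    by (rule core_commute[OF core_axioms])
  interpret BAC: core E V B A C
    by (rule core_commute[OF core_axioms])
  interpret BCA: core E V B C A
    by (rule core_commute[OF BAC.core_axioms])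
  interpret CAB: core E V C A B
    by (rule core_commute[OF ACB.core_axioms])
  interpret CBA: core E V C B A
    by (rule core_commute[OF CAB.core_axioms])
  have XYZ: "dense_to C B = X" "dense_to C A = Y" "dense_to B A = Z"
    unfolding X_def Y_def Z_def by (rule dense_to_commute)+
  have miss: "miss_density X Z Y = miss_density X Y Z" "miss_density Y X Z = miss_density X Y Z"
      "miss_density Y Z X = miss_density X Y Z"
    "miss_density Z X Y = miss_density X Y Z" "miss_density Z Y X = miss_density X Y Z"
    using miss_density_ac by metis+
  show ?thesis
    using edge_density_dense_to_le ACB.edge_density_dense_to_le BAC.edge_density_dense_to_le
      BCA.edge_density_dense_to_le CAB.edge_density_dense_to_le CBA.edge_density_dense_to_le
    by (intro sum_irregular_le[OF near_balanced_parts densities_nonneg(4)])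
      (simp_all only: XYZ miss X_def[symmetric] Y_def[symmetric] Z_def[symmetric])
qed

lemma share_dense_to_le: "share (dense_to B C) \<le> 2/5"
proof -
  have "share (dense_to B C) \<le> share ((dense_to B C - A) \<union> A)"
    using finite_subset[OF dense_to_subset finite_V] finite_parts by (intro share_mono) auto
  also have "\<dots> \<le> share (dense_to B C - A) + share A"
    by (rule share_Un_le)
  finally show ?thesis
    using share_dense_to_diff_le share_bounds by simp
qed

lemma edge_density_le:
  defines "X \<equiv> dense_to B C" and "Y \<equiv> dense_to A C" and "Z \<equiv> dense_to A B"
  shows "edge_density V V V
    \<le> extremal_density * (share X ^ 3 + share Y ^ 3 + share Z ^ 3) + 6 * (share X * share Y * share Z)"
proof -
  have fin: "finite X" "finite Y" "finite Z"
    unfolding X_def Y_def Z_def by (intro finite_subset[OF dense_to_subset finite_V])+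
  have "edge_density V V V = edges E (X \<union> Y \<union> Z) (X \<union> Y \<union> Z) (X \<union> Y \<union> Z) / n ^ 3"
    unfolding edge_density_def X_def Y_def Z_def using dense_to_cover by simp
  also have "\<dots> = edge_density X X X + edge_density Y Y Y + edge_density Z Z Z + 6 * edge_density X Y Z
    + 3 * (edge_density Y X X + edge_density Z X X + edge_density X Y Y + edge_density Z Y Y + edge_density X Z Z
        + edge_density Y Z Z)"
    unfolding edge_density_def nedge_Un3[OF fin dense_to_pairwise_disjoint[folded X_def Y_def Z_def]]
    by (simp add: add_divide_distrib)
  also have "\<dots> \<le> edge_density X X X + edge_density Y Y Y + edge_density Z Z Z + 6 * (share X * share Y * share Z)"
    using irregular_edges_le[folded X_def Y_def Z_def] edge_density_add_miss_density[of X Y Z] by argo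
  finally have "edge_density V V V \<le> edge_density X X X + edge_density Y Y Y + edge_density Z Z Z
      + 6 * (share X * share Y * share Z)" .
  moreover have inside: "edge_density W W W \<le> extremal_density * share W ^ 3" if "finite W" for W
    using deficit_nonneg[OF that] n_pos
    by (simp add: deficit_def edge_density_def share_def power_divide divide_right_mono)
  ultimately show ?thesis
    using inside[OF fin(1)] inside[OF fin(2)] inside[OF fin(3)] by (simp add: distrib_left)
qed

theorem extremal_density_diff_le:
  assumes "deficit E V \<le> \<epsilon> * n ^ 3"
  shows "extremal_density - 1/4 \<le> 2 * \<epsilon>"
proof -
  interpret BAC: core E V B A C
    by (rule core_commute[OF core_axioms])
  interpret CAB: core E V C A B
    by (rule core_commute(1)[OF core_commute(2)[OF core_axioms]])
  define x y z where "x = share (dense_to B C)" and "y = share (dense_to A C)" and "z = share (dense_to A B)"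
  define q where "q = x ^ 3 + y ^ 3 + z ^ 3"
  have nonneg: "0 \<le> x" "0 \<le> y" "0 \<le> z"
    by (simp_all add: x_def y_def z_def densities_nonneg)
  have total: "x + y + z = 1"
  proof -
    have "share V = x + y + z"
      unfolding x_def y_def z_def using dense_to_pairwise_disjoint finite_subset[OF dense_to_subset finite_V]
      by (subst dense_to_cover) (simp add: share_Un_disjoint Int_Un_distrib2)
    then show ?thesis
      by (simp add: share_V)
  qed
  have cube: "w ^ 3 \<le> 4/25 * w" if "0 \<le> w" "w \<le> 2/5" for w :: real
    using mult_mono[of w "2/5" w "2/5"] mult_left_mono[of "w * w" "4/25" w] that by (simp add: power3_eq_cube mult_ac)
  have "q \<le> 4/25"
    using cube[of x] cube[of y] cube[of z] nonneg total share_dense_to_le BAC.share_dense_to_le CAB.share_dense_to_le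
    unfolding q_def by (simp add: x_def y_def z_def)
  have "extremal_density - \<epsilon> \<le> edge_density V V V"
    using assms n_pos by (simp add: deficit_def edge_density_def pos_le_divide_eq left_diff_distrib)
  also have "\<dots> \<le> extremal_density * q + 6 * (x * y * z)"
    using edge_density_le by (simp add: q_def x_def y_def z_def)
  also have "\<dots> \<le> extremal_density * q + (1 - q) / 4"
    using sum_cubes_le[OF nonneg] by (simp add: total q_def)
  finally have "(extremal_density - 1/4) * (1 - q) \<le> \<epsilon>"
    by (simp add: field_simps)
  moreover have "(extremal_density - 1/4) * (1/2) \<le> (extremal_density - 1/4) * (1 - q)"
    using extremal_density_ge \<open>q \<le> 4/25\<close> by (intro mult_left_mono) auto
  ultimately show ?thesis
    by simp
qed

end

section \<open>The upper bound on the extremal density\<close>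

lemma (in coloured_set) colour_class_None:
  "colour_class None = V - (colour_class (Some i) \<union> colour_class (Some j) \<union> colour_class (Some k))"
proof -
  have "colour p = None \<longleftrightarrow> colour p \<notin> {Some i, Some j, Some k}" for p
    using colour[of p] by auto
  then show ?thesis
    by (auto simp: colour_class_def)
qed

lemma (in coloured_set) colour_class_subset: "colour_class c \<subseteq> V"
  by (simp add: colour_class_def)

lemma (in coloured_set) colour_class_disjoint: "c \<noteq> c' \<Longrightarrow> colour_class c \<inter> colour_class c' = {}"
  by (auto simp: colour_class_def)

lemma budget_of_objective_neg:
  fixes v s M D I :: real
  assumes v: "v + s = 1" "0 \<le> v" "0 \<le> s" and nonneg: "0 \<le> M" "0 \<le> I" "0 \<le> D"
    and neg: "27000 * M + 900 * I + 3600 * D + (49 * v - s) * (3 * s - v)\<^sup>2 < 0"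
  shows "v + 60 * M + 2 * I + 8 * D \<le> 1/50"
proof -
  have s: "49 * v - s = 50 * v - 1"
    using v by simp
  have "50 * v < 1"
  proof (rule ccontr)
    assume "\<not> 50 * v < 1"
    then have "0 \<le> (49 * v - s) * (3 * s - v)\<^sup>2"
      by (simp add: s)
    then show False
      using neg nonneg by linarith
  qed
  moreover have "(3 * s - v)\<^sup>2 \<le> 3\<^sup>2"
    using v by (intro power2_le_iff_abs_le[THEN iffD2]) (auto simp: abs_le_iff)
  ultimately have "(1 - 50 * v) * (3 * s - v)\<^sup>2 \<le> (1 - 50 * v) * 9"
    by (intro mult_left_mono) auto
  then show ?thesis
    using neg unfolding s left_diff_distrib by argo
qed

context host
begin

lemma link_density_ge_of_minimal_deficit:
  assumes minimal: "\<And>F. hom_free F \<Longrightarrow> deficit E V \<le> deficit F V" and n: "4000 \<le> n"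
    and deficit: "deficit E V \<le> n ^ 3 / 20000" and u: "u \<in> V"
  shows "extremal_density - 1/1000 \<le> link_density u V V"
proof -
  have "extremal_density * n ^ 3 - n ^ 3 / 20000 \<le> n * link E u V V + 2 * n ^ 2"
    using nedge_le_of_minimal_deficit[OF minimal finite_V u] deficit by (simp add: deficit_def)
  also have "\<dots> \<le> n * link E u V V + n ^ 3 / 2000"
    using n mult_right_mono[of 4000 n "n ^ 2"] by (simp add: power2_eq_square power3_eq_cube)
  finally have "n * (n ^ 2 * (extremal_density - 1/20000 - 1/2000)) \<le> n * link E u V V"
    by (simp add: power2_eq_square power3_eq_cube algebra_simps)
  then have "extremal_density - 1/20000 - 1/2000 \<le> link_density u V V"
    using n_pos by (simp add: link_density_def pos_le_divide_eq mult.commute)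
  then show ?thesis
    by simp
qed

lemma ex_core:
  assumes "1/4 \<le> extremal_density" "40 dvd card V" and minimal: "\<And>F. hom_free F \<Longrightarrow> deficit E V \<le> deficit F V"
    and n: "4000 \<le> n" and deficit: "deficit E V \<le> n ^ 3 / 20000"
  shows "\<exists>A B C. core E V A B C"
proof -
  obtain i j k where ijk: "E i j k" "objective_sum i j k < 0"
    using ex_edge_objective_sum_neg[OF assms(1) deficit] by blast
  interpret coloured_set V "twin E i j k" i j k
    by (rule coloured_set_twin[OF finite_V ijk(1)])
  let ?A = "colour_class (Some i)" and ?B = "colour_class (Some j)" and ?C = "colour_class (Some k)"
    and ?R = "colour_class None"
  have finite: "finite (colour_class c)" for c
    using colour_class_subset finite_V by (rule finite_subset)
  have total: "share ?R + (share ?A + share ?B + share ?C) = 1"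
    using sum_by_colour[of "\<lambda>_. 1"] n_pos by (simp add: share_def add_divide_distrib[symmetric] add_ac)
  have neg: "27000 * miss_density ?A ?B ?C + 900 * imbalance (share ?A) (share ?B) (share ?C)
      + 3600 * (deficit_density ?A + deficit_density ?B + deficit_density ?C)
      + (49 * share ?R - (share ?A + share ?B + share ?C)) * (3 * (share ?A + share ?B + share ?C) - share ?R)\<^sup>2 < 0"
    using ijk(2) n_pos unfolding objective_sum_eq[OF ijk(1)] by (simp add: mult_less_0_iff)
  have "share ?R + 60 * miss_density ?A ?B ?C + 2 * imbalance (share ?A) (share ?B) (share ?C)
      + 8 * (deficit_density ?A + deficit_density ?B + deficit_density ?C) \<le> 1/50"
    by (intro budget_of_objective_neg[OF total _ _ _ _ _ neg] add_nonneg_nonneg imbalance_nonneg densities_nonneg finite)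
  then have "core E V ?A ?B ?C"
    using assms(1,2) distinct_colours colour_class_subset link_density_ge_of_minimal_deficit[OF minimal n deficit]
    by unfold_locales (simp_all add: colour_class_None colour_class_disjoint)
  then show ?thesis
    by blast
qed

end

theorem extremal_density_le: "extremal_density \<le> 1/4"
proof (rule ccontr)
  assume large: "\<not> ?thesis"
  define \<epsilon> where "\<epsilon> = min (1/20000) ((extremal_density - 1/4) / 4)"
  have \<epsilon>: "0 < \<epsilon>" "\<epsilon> \<le> 1/20000"
    using large by (auto simp: \<epsilon>_def)
  have \<epsilon>_le: "\<epsilon> \<le> (extremal_density - 1/4) / 4"
    unfolding \<epsilon>_def by (rule min.cobounded2)
  obtain E :: "nat \<Rightarrow> nat \<Rightarrow> nat \<Rightarrow> bool" and m where E: "hom_free E" "m > 0" "deficit E {..<m} < \<epsilon> * real m ^ 3"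
    using extremal_density_nearly_attained[OF \<epsilon>(1)] .
  let ?V = "{..<4000 * m}"
  obtain F :: "nat \<Rightarrow> nat \<Rightarrow> nat \<Rightarrow> bool" where F: "hom_free F" "\<And>G. hom_free G \<Longrightarrow> deficit F ?V \<le> deficit G ?V"
    using ex_minimal_deficit[of ?V] by auto
  have "deficit F ?V \<le> real 4000 ^ 3 * deficit E {..<m}"
    using F(2)[OF hom_free_pullback[OF E(1)]] deficit_blow_up[OF E(2)] by metis
  also have "\<dots> \<le> real 4000 ^ 3 * (\<epsilon> * real m ^ 3)"
    using E(3) by (intro mult_left_mono) auto
  finally have deficit: "deficit F ?V \<le> \<epsilon> * real (card ?V) ^ 3"
    by (simp add: power_mult_distrib)
  interpret host F ?V
    using F(1) E(2) by (auto simp: host_def host_axioms_def lessThan_empty_iff)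
  have "\<epsilon> * n ^ 3 \<le> 1/20000 * n ^ 3"
    using \<epsilon>(2) by (intro mult_right_mono) auto
  then have "deficit F ?V \<le> n ^ 3 / 20000"
    using deficit by argo
  then have "\<exists>A B C. core F ?V A B C"
    using E(2) large by (intro ex_core F(2)) auto
  then obtain A B C where "core F ?V A B C"
    by blast
  then have "extremal_density - 1/4 \<le> 2 * \<epsilon>"
    using deficit by (rule core.extremal_density_diff_le)
  then show False
    using \<epsilon>_le large by argo
qed

section \<open>Sampling from cycle-free 3-graphs\<close>

locale C5_free_on = ternary_graph E for E :: "'a \<Rightarrow> 'a \<Rightarrow> 'a \<Rightarrow> bool" +
  fixes V :: "'a set"
  assumes no_copy: "{a, b, c, d, e} \<subseteq> V \<Longrightarrow> distinct [a, b, c, d, e] \<Longrightarrow> E a b c \<Longrightarrow> E b c d \<Longrightarrow> E c d e \<Longrightarrow> \<not> E d e a"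

lemma (in C5_free_on) homomorphic_copy_degenerate:
  assumes "{a, b, c, d, e} \<subseteq> V" "E a b c" "E b c d" "E c d e" "E d e a"
  shows "b = e"
proof (rule ccontr)
  assume "b \<noteq> e"
  have "distinct [x, y, z]" if "E x y z" for x y z
    using that not_edge_repeated by auto
  from this[OF assms(2)] this[OF assms(3)] this[OF assms(4)] this[OF assms(5)] \<open>b \<noteq> e\<close>
  have "distinct [a, b, c, d, e]"
    by auto
  then show False
    using no_copy assms by blast
qed

definition K4_minus_at :: "('a \<Rightarrow> 'a \<Rightarrow> 'a \<Rightarrow> bool) \<Rightarrow> 'a \<Rightarrow> 'a \<Rightarrow> 'a \<Rightarrow> 'a \<Rightarrow> bool" where
  "K4_minus_at E a b c d \<longleftrightarrow> E a b c \<and> E a b d \<and> E a c d"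

definition K4_minus_count :: "('a \<Rightarrow> 'a \<Rightarrow> 'a \<Rightarrow> bool) \<Rightarrow> 'a set \<Rightarrow> real" where
  "K4_minus_count E V = (\<Sum>a\<in>V. \<Sum>b\<in>V. \<Sum>c\<in>V. \<Sum>d\<in>V. of_bool (K4_minus_at E a b c d))"

lemma K4_minus_count_swap:
  "K4_minus_count E V = (\<Sum>b\<in>V. \<Sum>a\<in>V. \<Sum>c\<in>V. \<Sum>d\<in>V. of_bool (K4_minus_at E a b c d))"
  "K4_minus_count E V = (\<Sum>b\<in>V. \<Sum>c\<in>V. \<Sum>a\<in>V. \<Sum>d\<in>V. of_bool (K4_minus_at E a b c d))"
  "K4_minus_count E V = (\<Sum>b\<in>V. \<Sum>c\<in>V. \<Sum>d\<in>V. \<Sum>a\<in>V. of_bool (K4_minus_at E a b c d))"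
proof -
  show first: "K4_minus_count E V = (\<Sum>b\<in>V. \<Sum>a\<in>V. \<Sum>c\<in>V. \<Sum>d\<in>V. of_bool (K4_minus_at E a b c d))"
    unfolding K4_minus_count_def by (rule sum.swap)
  show second: "K4_minus_count E V = (\<Sum>b\<in>V. \<Sum>c\<in>V. \<Sum>a\<in>V. \<Sum>d\<in>V. of_bool (K4_minus_at E a b c d))"
    unfolding first by (intro sum.cong[OF refl] sum.swap)
  show "K4_minus_count E V = (\<Sum>b\<in>V. \<Sum>c\<in>V. \<Sum>d\<in>V. \<Sum>a\<in>V. of_bool (K4_minus_at E a b c d))"
    unfolding second by (intro sum.cong[OF refl] sum.swap)
qed

text \<open>Two vertices \<open>a\<close> and \<open>e\<close> over the same triple \<open>b, c, d\<close> span the cycle on \<open>b, a, c, d, e\<close>.\<close>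

lemma (in C5_free_on) K4_minus_count_le:
  assumes "finite V"
  shows "K4_minus_count E V \<le> real (card V) ^ 3"
proof -
  have "(\<Sum>a\<in>V. of_bool (K4_minus_at E a b c d)) \<le> (1 :: real)" if "b \<in> V" "c \<in> V" "d \<in> V" for b c d
  proof -
    have "a = e" if "a \<in> V \<inter> {a. K4_minus_at E a b c d}" "e \<in> V \<inter> {a. K4_minus_at E a b c d}" for a e
    proof (rule homomorphic_copy_degenerate[of b a c d e])
      show "{b, a, c, d, e} \<subseteq> V"
        using that \<open>b \<in> V\<close> \<open>c \<in> V\<close> \<open>d \<in> V\<close> by auto
    qed (use that in \<open>auto simp: K4_minus_at_def edge_ac\<close>)
    then have "card (V \<inter> {a. K4_minus_at E a b c d}) \<le> 1"
      using assms by (simp add: card_le_Suc0_iff_eq)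
    then show ?thesis
      using assms by (simp add: sum_of_bool_eq)
  qed
  then have "K4_minus_count E V \<le> (\<Sum>b\<in>V. \<Sum>c\<in>V. \<Sum>d\<in>V. 1)"
    unfolding K4_minus_count_swap(3) by (intro sum_mono)
  then show ?thesis
    by (simp add: power3_eq_cube)
qed

definition spans_K4_minus :: "('a \<Rightarrow> 'a \<Rightarrow> 'a \<Rightarrow> bool) \<Rightarrow> 'a \<Rightarrow> 'a \<Rightarrow> 'a \<Rightarrow> 'a \<Rightarrow> bool" where
  "spans_K4_minus E x y z w \<longleftrightarrow> E x y w \<and> E x z w \<or> E x y w \<and> E y z w \<or> E x z w \<and> E y z w"

definition prune :: "('a \<Rightarrow> 'a \<Rightarrow> 'a \<Rightarrow> bool) \<Rightarrow> 'a set \<Rightarrow> 'a \<Rightarrow> 'a \<Rightarrow> 'a \<Rightarrow> bool" where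
  "prune E U x y z \<longleftrightarrow> x \<in> U \<and> y \<in> U \<and> z \<in> U \<and> E x y z \<and> (\<forall>w\<in>U. \<not> spans_K4_minus E x y z w)"

lemma (in ternary_graph) ternary_graph_prune: "ternary_graph (prune E U)"
proof
  have "spans_K4_minus E y x z w = spans_K4_minus E x y z w" "spans_K4_minus E x z y w = spans_K4_minus E x y z w"
      for x y z w
    unfolding spans_K4_minus_def left_commute[of y x] left_commute[of z y] by blast+
  then show "prune E U x y z \<Longrightarrow> prune E U y x z" "prune E U x y z \<Longrightarrow> prune E U x z y" for x y z
    using edge_ac by (auto simp: prune_def)
  show "\<not> prune E U x x y" for x y
    by (simp add: prune_def)
qed

lemma ternary_graph_pullback: "ternary_graph E \<Longrightarrow> ternary_graph (pullback E f)"
  unfolding ternary_graph_def pullback_def by blast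

lemma (in C5_free_on) hom_free_prune:
  assumes "\<phi> ` U \<subseteq> V"
  shows "hom_free (prune (pullback E \<phi>) U)"
proof -
  interpret F: ternary_graph "pullback E \<phi>"
    by (rule ternary_graph_pullback[OF ternary_graph_axioms])
  interpret P: ternary_graph "prune (pullback E \<phi>) U"
    by (rule F.ternary_graph_prune)
  show ?thesis
  proof
    fix a b c d e
    assume pruned: "prune (pullback E \<phi>) U a b c" "prune (pullback E \<phi>) U b c d" "prune (pullback E \<phi>) U c d e"
    show "\<not> prune (pullback E \<phi>) U d e a"
    proof
      assume "prune (pullback E \<phi>) U d e a"
      then have edges: "E (\<phi> a) (\<phi> b) (\<phi> c)" "E (\<phi> b) (\<phi> c) (\<phi> d)" "E (\<phi> c) (\<phi> d) (\<phi> e)" "E (\<phi> d) (\<phi> e) (\<phi> a)"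
        and U: "{a, b, c, d, e} \<subseteq> U"
        using pruned by (auto simp: prune_def pullback_def)
      have "\<phi> b = \<phi> e"
        using U assms edges by (intro homomorphic_copy_degenerate[of "\<phi> a" "\<phi> b" "\<phi> c" "\<phi> d" "\<phi> e"]) auto
      then have "E (\<phi> a) (\<phi> b) (\<phi> d)"
        using edges(4) edge_ac by metis
      then have "spans_K4_minus (pullback E \<phi>) a b c d"
        using edges(2) by (simp add: spans_K4_minus_def pullback_def)
      then show False
        using pruned(1) U by (simp add: prune_def)
    qed
  qed
qed

lemma (in ternary_graph) nedge_le_prune:
  assumes "finite U"
  shows "nedge E U \<le> nedge (prune E U) U + 3 * K4_minus_count E U"
proof -
  let ?apex = "\<lambda>x y z w. of_bool (K4_minus_at E x y z w) :: real"
  have "of_bool (E x y z) \<le> of_bool (prune E U x y z) + (\<Sum>w\<in>U. ?apex x y z w + ?apex y x z w + ?apex z x y w)"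
    if "x \<in> U" "y \<in> U" "z \<in> U" for x y z
  proof (cases "E x y z \<and> (\<exists>w\<in>U. spans_K4_minus E x y z w)")
    case True
    then obtain w where w: "w \<in> U" "spans_K4_minus E x y z w"
      by blast
    have "E y x z" "E z x y" "E y x w = E x y w" "E z x w = E x z w" "E z y w = E y z w"
      using True edge_ac by blast+
    then have "1 \<le> ?apex x y z w + ?apex y x z w + ?apex z x y w"
      using True w(2) by (auto simp: spans_K4_minus_def K4_minus_at_def)
    also have "\<dots> \<le> (\<Sum>w\<in>U. ?apex x y z w + ?apex y x z w + ?apex z x y w)"
      using assms w by (intro member_le_sum) auto
    finally show ?thesis
      by (cases "prune E U x y z") auto
  next
    case False
    moreover have "0 \<le> (\<Sum>w\<in>U. ?apex x y z w + ?apex y x z w + ?apex z x y w)"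
      by (intro sum_nonneg) simp
    ultimately show ?thesis
      using that by (auto simp: prune_def)
  qed
  then have "nedge E U \<le> nedge (prune E U) U + (\<Sum>x\<in>U. \<Sum>y\<in>U. \<Sum>z\<in>U. \<Sum>w\<in>U. ?apex x y z w + ?apex y x z w + ?apex z x y w)"
    unfolding edges_eq_sum sum.distrib[symmetric] by (intro sum_mono)
  also have "(\<Sum>x\<in>U. \<Sum>y\<in>U. \<Sum>z\<in>U. \<Sum>w\<in>U. ?apex x y z w + ?apex y x z w + ?apex z x y w) = 3 * K4_minus_count E U"
    unfolding sum.distrib K4_minus_count_def[symmetric] K4_minus_count_swap(1)[symmetric]
        K4_minus_count_swap(2)[symmetric] by simp
  finally show ?thesis .
qed

lemma sum_PiE_triple:
  assumes "finite I" "{i, j, k} \<subseteq> I" "distinct [i, j, k]"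
  shows "(\<Sum>\<phi>\<in>I \<rightarrow>\<^sub>E V. of_bool (E (\<phi> i) (\<phi> j) (\<phi> k))) = real (card V) ^ (card I - 3) * nedge E V"
  using sum_PiE_sample[of I "[i, j, k]", where V = V and g = "\<lambda>vs. of_bool (E (vs ! 0) (vs ! 1) (vs ! 2)) :: real"] assms
  by (simp add: edges_eq_sum numeral_3_eq_3)

lemma sum_PiE_K4_minus:
  assumes "finite I" "{i, j, k, l} \<subseteq> I" "distinct [i, j, k, l]"
  shows "(\<Sum>\<phi>\<in>I \<rightarrow>\<^sub>E V. of_bool (K4_minus_at E (\<phi> i) (\<phi> j) (\<phi> k) (\<phi> l))) = real (card V) ^ (card I - 4) * K4_minus_count E V"
  using sum_PiE_sample[of I "[i, j, k, l]", where V = V and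
      g = "\<lambda>vs. of_bool (K4_minus_at E (vs ! 0) (vs ! 1) (vs ! 2) (vs ! 3)) :: real"] assms
  by (simp add: K4_minus_count_def eval_nat_numeral)

lemma sum_nedge_pullback_ge:
  assumes "finite V" "3 \<le> m"
  shows "real m * (real m - 1) * (real m - 2) * (real (card V) ^ (m - 3) * nedge E V)
    \<le> (\<Sum>\<phi>\<in>{..<m} \<rightarrow>\<^sub>E V. nedge (pullback E \<phi>) {..<m})"
proof -
  let ?I = "{..<m}"
  have "real m * (real m - 1) * (real m - 2) * (real (card V) ^ (m - 3) * nedge E V)
      = (\<Sum>i\<in>?I. \<Sum>j\<in>?I - {i}. \<Sum>k\<in>?I - {i} - {j}. real (card V) ^ (m - 3) * nedge E V)"
    using assms(2) by (simp add: of_nat_diff mult_ac)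
  also have "\<dots> = (\<Sum>i\<in>?I. \<Sum>j\<in>?I - {i}. \<Sum>k\<in>?I - {i} - {j}. \<Sum>\<phi>\<in>?I \<rightarrow>\<^sub>E V. of_bool (pullback E \<phi> i j k))"
    unfolding pullback_def by (intro sum.cong refl sum_PiE_triple[of ?I, unfolded card_lessThan, symmetric]) auto
  also have "\<dots> \<le> (\<Sum>i\<in>?I. \<Sum>j\<in>?I. \<Sum>k\<in>?I. \<Sum>\<phi>\<in>?I \<rightarrow>\<^sub>E V. of_bool (pullback E \<phi> i j k))"
    by (intro sum_mono order.trans[OF sum_mono sum_mono2] sum_mono2 sum_nonneg) auto
  also have "\<dots> = (\<Sum>\<phi>\<in>?I \<rightarrow>\<^sub>E V. nedge (pullback E \<phi>) ?I)"
    unfolding edges_eq_sum by (rule sym, (subst sum.swap[of _ _ "?I \<rightarrow>\<^sub>E V"], intro sum.cong refl)+)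
  finally show ?thesis .
qed

lemma (in C5_free_on) sum_K4_minus_count_pullback_le:
  assumes "finite V"
  shows "(\<Sum>\<phi>\<in>{..<m} \<rightarrow>\<^sub>E V. K4_minus_count (pullback E \<phi>) {..<m})
      \<le> real m ^ 4 * (real (card V) ^ (m - 4) * real (card V) ^ 3)"
proof -
  let ?I = "{..<m}"
  have "(\<Sum>\<phi>\<in>?I \<rightarrow>\<^sub>E V. K4_minus_count (pullback E \<phi>) ?I)
      = (\<Sum>i\<in>?I. \<Sum>j\<in>?I. \<Sum>k\<in>?I. \<Sum>l\<in>?I. \<Sum>\<phi>\<in>?I \<rightarrow>\<^sub>E V. of_bool (K4_minus_at E (\<phi> i) (\<phi> j) (\<phi> k) (\<phi> l)))"
    unfolding K4_minus_count_def K4_minus_at_def pullback_def by (subst sum.swap[of _ _ "?I \<rightarrow>\<^sub>E V"], intro sum.cong refl)+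
  also have "\<dots> \<le> (\<Sum>i\<in>?I. \<Sum>j\<in>?I. \<Sum>k\<in>?I. \<Sum>l\<in>?I. real (card V) ^ (m - 4) * real (card V) ^ 3)"
  proof (intro sum_mono)
    fix i j k l assume ijkl: "i \<in> ?I" "j \<in> ?I" "k \<in> ?I" "l \<in> ?I"
    show "(\<Sum>\<phi>\<in>?I \<rightarrow>\<^sub>E V. of_bool (K4_minus_at E (\<phi> i) (\<phi> j) (\<phi> k) (\<phi> l))) \<le> real (card V) ^ (m - 4) * real (card V) ^ 3"
    proof (cases "distinct [i, j, k, l]")
      case True
      then have "(\<Sum>\<phi>\<in>?I \<rightarrow>\<^sub>E V. of_bool (K4_minus_at E (\<phi> i) (\<phi> j) (\<phi> k) (\<phi> l)))
          = real (card V) ^ (m - 4) * K4_minus_count E V"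
        using ijkl sum_PiE_K4_minus[of ?I i j k l E V] by simp
      also have "\<dots> \<le> real (card V) ^ (m - 4) * real (card V) ^ 3"
        using K4_minus_count_le[OF assms] by (intro mult_left_mono) simp_all
      finally show ?thesis .
    next
      case False
      then have "\<not> K4_minus_at E (\<phi> i) (\<phi> j) (\<phi> k) (\<phi> l)" for \<phi>
        by (auto simp: K4_minus_at_def)
      then show ?thesis
        by simp
    qed
  qed
  also have "\<dots> = real m ^ 4 * (real (card V) ^ (m - 4) * real (card V) ^ 3)"
    by (simp add: power4_eq_xxxx)
  finally show ?thesis .
qed

lemma (in C5_free_on) nedge_pullback_le:
  assumes "\<phi> ` {..<m} \<subseteq> V"
  shows "nedge (pullback E \<phi>) {..<m} \<le> 1/4 * real m ^ 3 + 3 * K4_minus_count (pullback E \<phi>) {..<m}"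
proof -
  interpret F: ternary_graph "pullback E \<phi>"
    by (rule ternary_graph_pullback[OF ternary_graph_axioms])
  interpret pruned: hom_free "prune (pullback E \<phi>) {..<m}"
    by (rule hom_free_prune[OF assms])
  have "nedge (prune (pullback E \<phi>) {..<m}) {..<m} \<le> extremal_density * real m ^ 3"
    using pruned.deficit_nonneg[of "{..<m}"] by (simp add: deficit_def)
  also have "\<dots> \<le> 1/4 * real m ^ 3"
    by (intro mult_right_mono extremal_density_le) simp
  finally show ?thesis
    using F.nedge_le_prune[of "{..<m}"] by simp
qed

lemma falling_factorial_mult_ge:
  fixes m \<rho> :: real
  assumes "0 < m" "0 \<le> \<rho>" "\<rho> \<le> 1"
  shows "m ^ 3 * (\<rho> - 3 / m) \<le> m * (m - 1) * (m - 2) * \<rho>"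
proof -
  have "3 * m ^ 2 * \<rho> \<le> 3 * m ^ 2 * 1" "0 \<le> 2 * m * \<rho>"
    using assms by (auto intro!: mult_left_mono)
  moreover have "m ^ 3 * (\<rho> - 3 / m) = m ^ 3 * \<rho> - 3 * m ^ 2"
    using assms(1) by (simp add: power2_eq_square power3_eq_cube field_simps)
  moreover have "m * (m - 1) * (m - 2) * \<rho> = m ^ 3 * \<rho> - 3 * m ^ 2 * \<rho> + 2 * m * \<rho>"
    by (simp add: power2_eq_square power3_eq_cube algebra_simps)
  ultimately show ?thesis
    by linarith
qed

theorem (in C5_free_on) nedge_density_le:
  assumes "finite V" "V \<noteq> {}" and m: "4 \<le> m"
  shows "nedge E V / real (card V) ^ 3 \<le> 1/4 + 3 / real m + 3 * real m / real (card V)"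
proof -
  let ?I = "{..<m}" and ?P = "{..<m} \<rightarrow>\<^sub>E V"
  define n \<rho> where "n = real (card V)" and "\<rho> = nedge E V / n ^ 3"
  have n: "0 < n" and m_pos: "0 < real m"
    using assms by (simp_all add: n_def card_gt_0_iff)
  have \<rho>: "0 \<le> \<rho>" "\<rho> \<le> 1"
    using n edges_nonneg[of E V V V] edges_le[of E V V V] by (simp_all add: \<rho>_def n_def power3_eq_cube mult.assoc)
  have powers: "n ^ (m - 3) * nedge E V = n ^ m * \<rho>" "n ^ (m - 4) * n ^ 3 = n ^ m / n"
    using n m by (simp_all add: \<rho>_def power_diff power3_eq_cube power4_eq_xxxx)
  have "(\<Sum>\<phi>\<in>?P. nedge (pullback E \<phi>) ?I) \<le> (\<Sum>\<phi>\<in>?P. 1/4 * real m ^ 3 + 3 * K4_minus_count (pullback E \<phi>) ?I)"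
    by (intro sum_mono nedge_pullback_le) auto
  also have "\<dots> \<le> n ^ m * (1/4 * real m ^ 3) + 3 * (real m ^ 4 * (n ^ m / n))"
    using sum_K4_minus_count_pullback_le[OF assms(1), of m] powers(2)
    by (simp add: sum.distrib sum_distrib_left[symmetric] card_PiE n_def)
  finally have "real m * (real m - 1) * (real m - 2) * (n ^ m * \<rho>)
      \<le> n ^ m * (1/4 * real m ^ 3) + 3 * (real m ^ 4 * (n ^ m / n))"
    using sum_nedge_pullback_ge[OF assms(1), of m E] m powers(1) by (simp add: n_def)
  then have "n ^ m * (real m * (real m - 1) * (real m - 2) * \<rho>) \<le> n ^ m * (real m ^ 3 * (1/4 + 3 * real m / n))"
    by (simp add: power3_eq_cube power4_eq_xxxx algebra_simps)
  then have "real m * (real m - 1) * (real m - 2) * \<rho> \<le> real m ^ 3 * (1/4 + 3 * real m / n)"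
    using n by (simp only: mult_le_cancel_left_pos zero_less_power)
  then have "real m ^ 3 * (\<rho> - 3 / real m) \<le> real m ^ 3 * (1/4 + 3 * real m / n)"
    using falling_factorial_mult_ge[OF m_pos \<rho>] by linarith
  then show ?thesis
    using m_pos unfolding \<rho>_def n_def by (simp only: mult_le_cancel_left_pos zero_less_power)
qed

section \<open>The iterated tripartite construction\<close>

definition digit :: "nat \<Rightarrow> nat \<Rightarrow> nat" where
  "digit k x = x div 3 ^ k mod 3"

definition first_difference :: "nat \<Rightarrow> nat \<Rightarrow> nat \<Rightarrow> bool" where
  "first_difference k x y \<longleftrightarrow> x mod 3 ^ k = y mod 3 ^ k \<and> digit k x \<noteq> digit k y"

definition iterated_tripartite :: "nat \<Rightarrow> nat \<Rightarrow> nat \<Rightarrow> bool" where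
  "iterated_tripartite x y z \<longleftrightarrow> (\<exists>k. first_difference k x y \<and> first_difference k x z \<and> first_difference k y z)"

lemma digit_less: "digit k x < 3"
  by (simp add: digit_def)

lemma digit_eq_if_mod_eq:
  assumes "x mod 3 ^ l = y mod 3 ^ l" "k < l"
  shows "digit k x = digit k y"
proof -
  have "x mod 3 ^ Suc k = y mod 3 ^ Suc k"
    using assms mod_mod_cancel[of "3 ^ Suc k" "3 ^ l"] le_imp_power_dvd[of "Suc k" l 3] by (metis Suc_leI)
  moreover have "digit k w = w mod 3 ^ Suc k div 3 ^ k" for w
    using mod_mult2_eq[of w "3 ^ k" 3] by (simp add: digit_def mult.commute)
  ultimately show ?thesis
    by simp
qed

lemma first_difference_unique:
  assumes "first_difference k x y" "first_difference l x y"
  shows "k = l"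
  using assms digit_eq_if_mod_eq[of x l y k] digit_eq_if_mod_eq[of x k y l]
  unfolding first_difference_def by (metis linorder_neqE_nat)

lemma first_difference_commute: "first_difference k x y = first_difference k y x"
  by (auto simp: first_difference_def)

text \<open>Consecutive edges of the cycle share two vertices, so all of them live at the same level; there the third vertex of
  each edge has the only remaining digit.\<close>

lemma hom_free_iterated_tripartite: "hom_free iterated_tripartite"
proof
  show "iterated_tripartite x y z \<Longrightarrow> iterated_tripartite y x z" "iterated_tripartite x y z \<Longrightarrow> iterated_tripartite x z y"
      for x y z
    unfolding iterated_tripartite_def using first_difference_commute by blast+
  show "\<not> iterated_tripartite x x y" for x y
    by (simp add: iterated_tripartite_def first_difference_def)
  fix a b c d e
  assume "iterated_tripartite a b c" "iterated_tripartite b c d" "iterated_tripartite c d e"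
  then obtain k where k: "first_difference k a b" "first_difference k a c" "first_difference k b c" "first_difference k b d"
    "first_difference k c d" "first_difference k c e" "first_difference k d e"
    unfolding iterated_tripartite_def using first_difference_unique by metis
  show "\<not> iterated_tripartite d e a"
  proof
    assume "iterated_tripartite d e a"
    then have "first_difference k d a"
      unfolding iterated_tripartite_def using first_difference_unique k(7) by blast
    moreover have "digit k a = digit k d"
      using k(1-5) digit_less[of k a] digit_less[of k b] digit_less[of k c] digit_less[of k d]
      unfolding first_difference_def by linarith
    ultimately show False
      by (simp add: first_difference_def)
  qed
qed

lemma iterated_tripartite_append_digit:
  assumes "iterated_tripartite x y z" "r < 3"
  shows "iterated_tripartite (x * 3 + r) (y * 3 + r) (z * 3 + r)"
proof -
  have "(w * 3 + r) mod 3 ^ Suc k = 3 * (w mod 3 ^ k) + r" "digit (Suc k) (w * 3 + r) = digit k w" for w k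
    using assms(2) mod_mult2_eq[of "w * 3 + r" 3 "3 ^ k"] by (simp_all add: digit_def div_mult2_eq)
  then have "first_difference k v w \<Longrightarrow> first_difference (Suc k) (v * 3 + r) (w * 3 + r)" for k v w
    by (simp add: first_difference_def)
  then show ?thesis
    using assms(1) unfolding iterated_tripartite_def by blast
qed

lemma iterated_tripartite_last_digits:
  assumes "r < 3" "r' < 3" "r'' < 3" "distinct [r, r', r'']"
  shows "iterated_tripartite (x * 3 + r) (y * 3 + r') (z * 3 + r'')"
  unfolding iterated_tripartite_def using assms by (intro exI[of _ 0]) (auto simp: first_difference_def digit_def)

lemma nedge_iterated_tripartite_triple_ge:
  "3 * nedge iterated_tripartite {..<k} + 6 * real k ^ 3 \<le> nedge iterated_tripartite {..<k * 3}"
proof -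
  let ?extensions = "\<lambda>x y z. \<Sum>r<3::nat. \<Sum>r'<3::nat. \<Sum>r''<3::nat.
    of_bool (iterated_tripartite (x * 3 + r) (y * 3 + r') (z * 3 + r'')) :: real"
  have "3 * of_bool (iterated_tripartite x y z) + 6 \<le> ?extensions x y z" for x y z
  proof -
    have "3 * of_bool (iterated_tripartite x y z) + 6
        = (\<Sum>r<3::nat. \<Sum>r'<3::nat. \<Sum>r''<3::nat. of_bool (r = r' \<and> r' = r'') * of_bool (iterated_tripartite x y z)
            + of_bool (distinct [r, r', r'']) :: real)"
      by (simp add: eval_nat_numeral lessThan_Suc)
    also have "\<dots> \<le> ?extensions x y z"
      using iterated_tripartite_append_digit iterated_tripartite_last_digits by (intro sum_mono) auto
    finally show ?thesis .
  qed
  then have "(\<Sum>x<k. \<Sum>y<k. \<Sum>z<k. 3 * of_bool (iterated_tripartite x y z) + 6) \<le> (\<Sum>x<k. \<Sum>y<k. \<Sum>z<k. ?extensions x y z)"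
    by (intro sum_mono)
  also have "\<dots> = nedge iterated_tripartite {..<k * 3}"
    by (simp only: edges_eq_sum sum_lessThan_mult sum.swap[where A = "{..<3}" and B = "{..<k}"])
  finally show ?thesis
    by (simp add: sum.distrib sum_distrib_left[symmetric] edges_eq_sum power3_eq_cube mult_ac)
qed

lemma nedge_iterated_tripartite_ge: "real n ^ 3 / 4 - 3 * real n ^ 2 \<le> nedge iterated_tripartite {..<n}"
proof (induction n rule: less_induct)
  case (less n)
  show ?case
  proof (cases "n = 0")
    case True
    then show ?thesis
      by (simp add: edges_nonneg)
  next
    case False
    define k r where "k = real (n div 3)" and "r = real (n mod 3)"
    have n: "real n = 3 * k + r"
      unfolding k_def r_def by (metis mult_div_mod_eq of_nat_add of_nat_mult of_nat_numeral)
    have k: "0 \<le> k" and "n mod 3 = 0 \<or> n mod 3 = 1 \<or> n mod 3 = 2"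
      by (auto simp: k_def)
    then have "r = 0 \<or> r = 1 \<or> r = 2"
      by (auto simp: r_def)
    then have "real n ^ 3 / 4 - 3 * real n ^ 2 \<le> 3 * (k ^ 3 / 4 - 3 * k ^ 2) + 6 * k ^ 3"
      using k mult_nonneg_nonneg[OF k k] unfolding n by (auto simp: power2_eq_square power3_eq_cube field_simps)
    also have "\<dots> \<le> 3 * nedge iterated_tripartite {..<n div 3} + 6 * k ^ 3"
      using less.IH[of "n div 3"] False by (simp add: k_def)
    also have "\<dots> \<le> nedge iterated_tripartite {..<n div 3 * 3}"
      unfolding k_def by (rule nedge_iterated_tripartite_triple_ge)
    also have "\<dots> \<le> nedge iterated_tripartite {..<n}"
      by (intro edges_mono) auto
    finally show ?thesis .
  qed
qed

section \<open>The Turan density\<close>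

definition hyperedges :: "('a \<Rightarrow> 'a \<Rightarrow> 'a \<Rightarrow> bool) \<Rightarrow> 'a set \<Rightarrow> 'a set set" where
  "hyperedges E V = {{x, y, z} | x y z. x \<in> V \<and> y \<in> V \<and> z \<in> V \<and> E x y z}"

lemma triple_cases:
  assumes "{x, y, z} = {a, b, c}" "distinct [a, b, c]"
  shows "(x, y, z) \<in> {(a, b, c), (a, c, b), (b, a, c), (b, c, a), (c, a, b), (c, b, a)}"
proof -
  have "x \<in> {a, b, c}" "y \<in> {a, b, c}" "z \<in> {a, b, c}" "a \<in> {x, y, z}" "b \<in> {x, y, z}" "c \<in> {x, y, z}"
    using assms(1) by blast+
  then show ?thesis
    using assms(2) by auto
qed

context ternary_graph
begin

lemma distinct_of_edge: "E x y z \<Longrightarrow> distinct [x, y, z]"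
  using not_edge_repeated by auto

lemma edge_orderings: "E a b c \<Longrightarrow> E a c b" "E a b c \<Longrightarrow> E b a c" "E a b c \<Longrightarrow> E b c a" "E a b c \<Longrightarrow> E c a b" "E a b c \<Longrightarrow> E c b a"
  using edge_ac by blast+

lemma mem_hyperedges_iff: "{x, y, z} \<in> hyperedges E V \<longleftrightarrow> {x, y, z} \<subseteq> V \<and> E x y z"
proof
  assume "{x, y, z} \<in> hyperedges E V"
  then obtain a b c where abc: "{x, y, z} = {a, b, c}" "{a, b, c} \<subseteq> V" "E a b c"
    by (auto simp: hyperedges_def)
  from triple_cases[OF this(1) distinct_of_edge[OF this(3)]] have "E x y z"
    using abc(3) edge_orderings[OF abc(3)] by auto
  with abc show "{x, y, z} \<subseteq> V \<and> E x y z"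
    by simp
qed (auto simp: hyperedges_def)

lemma card_hyperedge: "e \<in> hyperedges E V \<Longrightarrow> e \<subseteq> V \<and> card e = 3"
  using distinct_of_edge by (fastforce simp: hyperedges_def)

lemma nedge_eq_card_hyperedges:
  assumes "finite V"
  shows "nedge E V = 6 * real (card (hyperedges E V))"
proof -
  let ?set = "\<lambda>(x, y, z). {x, y, z}"
  define T where "T = (V \<times> V \<times> V) \<inter> {(x, y, z). E x y z}"
  have "finite T" and image: "?set ` T = hyperedges E V"
    using assms by (force simp: T_def hyperedges_def)+
  have orderings: "card {t \<in> T. ?set t = e} = 6" if e: "e \<in> hyperedges E V" for e
  proof -
    obtain a b c where abc: "e = {a, b, c}" "{a, b, c} \<subseteq> V" "E a b c"
      using e unfolding hyperedges_def by blast
    note distinct = distinct_of_edge[OF abc(3)]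
    have "{t \<in> T. ?set t = e} = {(a, b, c), (a, c, b), (b, a, c), (b, c, a), (c, a, b), (c, b, a)}"
    proof (intro equalityI subsetI)
      fix t assume "t \<in> {t \<in> T. ?set t = e}"
      then show "t \<in> {(a, b, c), (a, c, b), (b, a, c), (b, c, a), (c, a, b), (c, b, a)}"
        using triple_cases[OF _ distinct] abc(1) by (cases t) simp
    next
      fix t assume "t \<in> {(a, b, c), (a, c, b), (b, a, c), (b, c, a), (c, a, b), (c, b, a)}"
      then show "t \<in> {t \<in> T. ?set t = e}"
        using abc edge_orderings[OF abc(3)] by (auto simp: T_def)
    qed
    then show ?thesis
      using distinct by simp
  qed
  have "nedge E V = (\<Sum>t\<in>V \<times> V \<times> V. of_bool (t \<in> {(x, y, z). E x y z}))"
    by (simp add: edges_eq_sum sum.cartesian_product split_def)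
  also have "\<dots> = real (card T)"
    using assms by (simp add: sum_of_bool_eq T_def)
  also have "card T = (\<Sum>e\<in>hyperedges E V. card {t \<in> T. ?set t = e})"
    using sum.group[OF \<open>finite T\<close> finite_imageI[OF \<open>finite T\<close>] order.refl, where g = ?set and h = "\<lambda>_. 1 :: nat"]
    by (simp add: image)
  finally show ?thesis
    by (simp add: orderings)
qed

end

lemma C5_free_on_hypergraph:
  assumes "three_graph G" "\<not> contains_copy G C5_minus"
  shows "C5_free_on (\<lambda>x y z. {x, y, z} \<in> snd G) (fst G)"
proof
  show "{y, x, z} \<in> snd G" "{x, z, y} \<in> snd G" if "{x, y, z} \<in> snd G" for x y z
    using that by (simp_all add: insert_commute)
  have "card {x, x, y} \<noteq> 3" for x y :: 'a
    by (simp add: card_insert_if)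
  then show "{x, x, y} \<notin> snd G" for x y
    using assms(1) by (auto simp only: three_graph_def)
  fix a b c d e
  assume cycle: "{a, b, c, d, e} \<subseteq> fst G" "distinct [a, b, c, d, e]" "{a, b, c} \<in> snd G" "{b, c, d} \<in> snd G"
      "{c, d, e} \<in> snd G"
  show "{d, e, a} \<notin> snd G"
  proof
    assume "{d, e, a} \<in> snd G"
    then have "contains_copy G C5_minus"
      unfolding contains_copy_def using cycle
      by (intro exI[of _ "\<lambda>i. [a, b, c, d, e] ! (i - 1)"]) (auto simp: inj_on_def C5_minus_def insert_commute)
    then show False
      using assms(2) by simp
  qed
qed

lemma hyperedges_hypergraph:
  assumes "three_graph G"
  shows "hyperedges (\<lambda>x y z. {x, y, z} \<in> snd G) (fst G) = snd G"
proof (intro equalityI subsetI)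
  fix e assume "e \<in> snd G"
  then have e: "e \<subseteq> fst G" "card e = 3"
    using assms by (simp_all add: three_graph_def)
  then obtain x y z where "e = {x, y, z}"
    by (auto simp: card_3_iff)
  then show "e \<in> hyperedges (\<lambda>x y z. {x, y, z} \<in> snd G) (fst G)"
    unfolding hyperedges_def using \<open>e \<in> snd G\<close> e(1) by (intro CollectI exI[of _ x] exI[of _ y] exI[of _ z]) simp
qed (auto simp: hyperedges_def)

lemma not_contains_copy_hyperedges:
  assumes "hom_free E"
  shows "\<not> contains_copy (V, hyperedges E V) C5_minus"
proof
  interpret hom_free E by (rule assms)
  assume "contains_copy (V, hyperedges E V) C5_minus"
  then obtain \<phi> where "\<forall>e\<in>snd C5_minus. \<phi> ` e \<in> hyperedges E V"
    by (auto simp: contains_copy_def)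
  then have "E (\<phi> 1) (\<phi> 2) (\<phi> 3)" "E (\<phi> 2) (\<phi> 3) (\<phi> 4)" "E (\<phi> 3) (\<phi> 4) (\<phi> 5)" "E (\<phi> 4) (\<phi> 5) (\<phi> 1)"
    by (simp_all add: C5_minus_def mem_hyperedges_iff)
  then show False
    using no_C5_minus by blast
qed

lemma ex_turan_le:
  assumes "0 < n" "4 \<le> m"
  shows "6 * real (ex_turan n C5_minus) / real n ^ 3 \<le> 1/4 + 3 / real m + 3 * real m / real n"
proof -
  have "ex_turan n C5_minus \<in> free_sizes n C5_minus"
    unfolding ex_turan_def by (rule Max_in[OF finite_free_sizes free_sizes_nonempty]) (simp add: C5_minus_def)
  then obtain G :: "nat hypergraph" where G: "finite (fst G)" "card (fst G) = n" "three_graph G" "\<not> contains_copy G C5_minus"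
    and size: "ex_turan n C5_minus = card (snd G)"
    by (auto simp: free_sizes_def)
  interpret C5_free_on "\<lambda>x y z. {x, y, z} \<in> snd G" "fst G"
    by (rule C5_free_on_hypergraph[OF G(3,4)])
  have "fst G \<noteq> {}"
    using G(2) assms(1) by auto
  then show ?thesis
    using nedge_density_le[OF G(1) _ assms(2)] nedge_eq_card_hyperedges[OF G(1)] hyperedges_hypergraph[OF G(3)] G(2) size
    by simp
qed

lemma ex_turan_ge: "real n ^ 3 / 4 - 3 * real n ^ 2 \<le> 6 * real (ex_turan n C5_minus)"
proof -
  interpret hom_free iterated_tripartite
    by (rule hom_free_iterated_tripartite)
  let ?H = "hyperedges iterated_tripartite {..<n}"
  have "card ?H \<in> free_sizes n C5_minus"
    unfolding free_sizes_def using card_hyperedge not_contains_copy_hyperedges[OF hom_free_axioms]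
    by (intro CollectI exI[of _ "({..<n}, ?H)"]) (auto simp: three_graph_def)
  then have "card ?H \<le> ex_turan n C5_minus"
    unfolding ex_turan_def by (rule Max_ge[OF finite_free_sizes])
  then show ?thesis
    using nedge_iterated_tripartite_ge[of n] nedge_eq_card_hyperedges[of "{..<n}"] by simp
qed

lemma choose_three: "real (n choose 3) = real n * (real n - 1) * (real n - 2) / 6"
  by (simp add: binomial_gbinomial gbinomial_prod_rev numeral_3_eq_3 lessThan_Suc fact_numeral mult_ac)

lemma ex_turan_cube_limit: "(\<lambda>n. 6 * real (ex_turan n C5_minus) / real n ^ 3) \<longlonglongrightarrow> 1/4"
proof (rule tendsto_sandwich)
  let ?m = "\<lambda>n. nat \<lfloor>sqrt (real n)\<rfloor>"
  show "\<forall>\<^sub>F n in sequentially. 1/4 - 3 / real n \<le> 6 * real (ex_turan n C5_minus) / real n ^ 3"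
    using eventually_gt_at_top[of 0]
  proof eventually_elim
    case (elim n)
    then show ?case
      using divide_right_mono[OF ex_turan_ge[of n], of "real n ^ 3"]
      by (simp add: diff_divide_distrib power2_eq_square power3_eq_cube)
  qed
  show "\<forall>\<^sub>F n in sequentially. 6 * real (ex_turan n C5_minus) / real n ^ 3
      \<le> 1/4 + 3 / real (?m n) + 3 * real (?m n) / real n"
    using eventually_ge_at_top[of "16"]
  proof eventually_elim
    case (elim n)
    then have "4 \<le> sqrt (real n)"
      by (intro real_le_rsqrt) simp
    then show ?case
      using elim by (intro ex_turan_le) (simp_all add: le_nat_floor)
  qed
  show "(\<lambda>n. 1/4 - 3 / real n) \<longlonglongrightarrow> 1/4" "(\<lambda>n. 1/4 + 3 / real (?m n) + 3 * real (?m n) / real n) \<longlonglongrightarrow> 1/4"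
    by real_asymp+
qed

theorem theorem1p1:
  shows "(\<lambda>n. real (ex_turan n C5_minus) / real (n choose 3)) \<longlonglongrightarrow> 1 / 4
    \<and> turan_density C5_minus = 1 / 4"
proof -
  have "(\<lambda>n. real n ^ 3 / (real n * (real n - 1) * (real n - 2))) \<longlonglongrightarrow> 1"
    by real_asymp
  from tendsto_mult[OF ex_turan_cube_limit this]
  have "(\<lambda>n. 6 * real (ex_turan n C5_minus) / real n ^ 3 * (real n ^ 3 / (real n * (real n - 1) * (real n - 2)))) \<longlonglongrightarrow> 1/4"
    by simp
  moreover have "\<forall>\<^sub>F n in sequentially. 6 * real (ex_turan n C5_minus) / real n ^ 3 *
      (real n ^ 3 / (real n * (real n - 1) * (real n - 2)))
      = real (ex_turan n C5_minus) / real (n choose 3)"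
    using eventually_gt_at_top[of 0] by eventually_elim (simp add: choose_three)
  ultimately have "(\<lambda>n. real (ex_turan n C5_minus) / real (n choose 3)) \<longlonglongrightarrow> 1 / 4"
    by (rule Lim_transform_eventually)
  then show ?thesis
    unfolding turan_density_def by (simp add: limI)
qed

end
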